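(* Let $k\in\{1,\dots,5\}$, let $h$ be a height function on $H^5$, and write $\nu_k(D_h)=a\,e^k_\infty+b\,e^k_4+c\,e^k_2$ (with $a\in\mathbb{Z}$, $b\in\mathbb{Z}/4$, $c\in\mathbb{Z}/2$). Then $0\le|a|\le 8$, $b\equiv-a \bmod 4$, and $c=0$. Moreover, for each $k$, among the $395094$ height functions on $H^5$ (up to constants), the number of $h$ with $\nu_k(D_h)=m(e^k_\infty-e^k_4)$ is: $83830$ for $m=0$; $72384$ for each of $m=\pm1$; $47200$ for each of $m=\pm2$; $23392$ for each of $m=\pm3$; $9048$ for each of $m=\pm4$; $2752$ for each of $m=\pm5$; $704$ for each of $m=\pm6$; $128$ for each of $m=\pm7$; $24$ for each of $m=\pm8$.
   Context: **Hypercube.** Color indices are taken modulo 5 in $\{1,\dots,5\}$. $H^5$ is the graph on $\{0,1\}^5$ with two vertices adjacent iff they differ in exactly one coordinate; an edge flipping coordinate $j$ has color $j$; the rainbow is the cyclic order $(1,2,3,4,5)$. $\mathbf 1=(1,1,1,1,1)$. Vertices at even distance from $\mathbf 1$ are white, the others black. $v_j$ is the neighbor of $v$ along color $j$. $f_{j,j+1}(v)$ is the (formal) face center of the 4-cycle through $v$ with colors $j,j+1$; it depends only on the 4-cycle. **Heights.** A height function is $h:\{0,1\}^5\to\mathbb{Z}$ with $|h(u)-h(v)|=1$ for adjacent $u,v$; heights differing by a constant are identified. **Discrete Morse divisor.** Fill each 4-cycle with two consecutive colors $j,j+1$ by a 2-cell and triangulate: if $h$ takes three values on the cycle (diamond)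 join its maximum and minimum by an edge; if $h$ takes two values (bow-tie) add the face center as a new vertex joined to the four vertices, with height the average of the four heights. For a vertex $p$ of this mesh, let $\lambda_p$ be the number of sign changes of $h(u)-h(p)$ as $u$ runs once around the boundary of the star of $p$, and $\kappa_p=\lambda_p/2-1$. Then $D_h=\sum_p\kappa_p\,p$. Concretely, $\kappa_v=\tfrac12\#\{j: h(v_j)\ne h(v_{j+1})\}-1$ for a hypercube vertex $v$, and a face center has coefficient $1$ if its 4-cycle is a bow-tie and $0$ if it is a diamond. **Curve and embedded points.** $\phi=(1+\sqrt5)/2$, $\zeta=e^{2\pi i/10}$. $X^5_{\rm alg}\subset\mathbb{P}^4$ is given by $x_1^2+x_2^2+x_3^2=0$, $\phi x_1^2+x_2^2+x_4^2=0$, $(\phi+1)x_1^2+x_2^2+x_5^2=0$. The sign ${\rm sgn}_k(j)$ for $j=1,\dots,5$ is: $k=1$: $+,+,+,+,+$; $k=2$: $-,-,-,-,+$; $k=3$: $-,+,+,+,-$; $k=4$: $-,-,+,+,-$; $k=5$: $-,-,-,+,-$. The vertex $\mathbf 1$ is placed at $[1:\zeta^2\sqrt\phi:\zeta^9:i\zeta^6:\zeta^8\sqrt\phi]$, and the face centers at $\mathbf 1$ at: $f_{5,1}(\mathbf 1)=[1:0:-i:-i\sqrt\phi:-i\sqrt{\phi+1}]$, $f_{1,2}(\mathbf 1)=[1:i:0:-i\sqrt{\phi-1}:-i\sqrt\phi]$, $f_{2,3}(\mathbf 1)=[1:i\sqrt\phi:\sqrt{\phi-1}:0:-i]$, $f_{3,4}(\mathbf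 1)=[1:i\sqrt{\phi+1}:\sqrt\phi:1:0]$, $f_{4,5}(\mathbf 1)=[0:1:-i:-i:-i]$. If $v$ (resp. $f_{m,m+1}(v)$) is placed at $[x_1:\dots:x_5]$, then $v_j$ (resp. $f_{m,m+1}(v_j)$) is placed at $[{\rm sgn}_1(j)\overline{x_1}:\dots:{\rm sgn}_5(j)\overline{x_5}]$; this determines all positions consistently. **Elliptic curves and maps.** $E_1,E_4: y^2=x(x-1)(x-(\phi+1))$; $E_2,E_5: y^2=x(x-1)(x-\phi)$; $E_3: y^2=x(x-1)(x+\phi)$, with point at infinity $O_k$ as identity. The morphisms $\nu_k:X^5_{\rm alg}\to E_k$ are $\nu_1=\big(-(2\phi+1)\tfrac{x_1^2}{x_5^2}-\phi,\ (2\phi+1)\tfrac{x_2x_3x_4}{x_5^3}\big)$, $\nu_2=\big(\tfrac{x_2^2}{x_1^2}+\phi+1,\ i\tfrac{x_3x_4x_5}{x_1^3}\big)$, $\nu_3=\big((2\phi+1)\tfrac{x_3^2}{x_2^2}+\phi+1,\ i(2\phi+1)\tfrac{x_1x_4x_5}{x_2^3}\big)$, $\nu_4=\big((\phi+1)\tfrac{x_4^2}{x_3^2}-\phi,\ i\phi\tfrac{x_1x_2x_5}{x_3^3}\big)$, $\nu_5=\big(-\tfrac{x_5^2}{x_4^2}+\phi+1,\ i\tfrac{x_1x_2x_3}{x_4^3}\big)$, where points with vanishing denominator go to $O_k$. For a divisor $D=\sum\kappa_p p$, $\nu_k(D)=\sum\kappa_p\,\nu_k(p)$ in $E_k(\mathbb{C})$.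 **Generators.** $e^k_\infty=\nu_k(\mathbf 1)$ (infinite order), $e^k_4=\nu_k(f_{k-2,k-1}(\mathbf 1))$ (order 4), $e^k_2=\nu_k(f_{k,k+1}(\mathbf 1))$ (order 2). The images of all vertices and face centers lie in the subgroup generated by these, which is the internal direct sum $\mathbb{Z}\oplus\mathbb{Z}/4\oplus\mathbb{Z}/2$. *)

theory Defs
  imports
    "HOL-Analysis.Analysis"
    "HOL-Algebra.FiniteProduct"
    "HOL-Number_Theory.Cong"
begin

text \<open>
  Colours, coordinates and the index of the elliptic curve all live in the numeral type \<open>5\<close>, whose
  arithmetic is modulo 5, so that \<open>5 = 0\<close> and \<open>j + 1\<close> is the successor of \<open>j\<close> in the rainbow.
\<close>

lemma exhaust_5: "x = 1 \<or> x = 2 \<or> x = 3 \<or> x = 4 \<or> x = 5" for x :: 5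
proof (induct x)
  case (of_int z)
  then have "0 \<le> z" and "z < 5" by simp_all
  then have "z = 0 \<or> z = 1 \<or> z = 2 \<or> z = 3 \<or> z = 4" by arith
  then show ?case by auto
qed

lemma forall_5: "(\<forall>i::5. P i) \<longleftrightarrow> P 1 \<and> P 2 \<and> P 3 \<and> P 4 \<and> P 5"
  by (metis exhaust_5)

lemma UNIV_5: "(UNIV :: 5 set) = {1, 2, 3, 4, 5}"
  using exhaust_5 by auto

lemma vector_5:
  "(vector [a, b, c, d, e] :: 'a::zero^5) $ 1 = a"
  "(vector [a, b, c, d, e] :: 'a::zero^5) $ 2 = b"
  "(vector [a, b, c, d, e] :: 'a::zero^5) $ 3 = c"
  "(vector [a, b, c, d, e] :: 'a::zero^5) $ 4 = d"
  "(vector [a, b, c, d, e] :: 'a::zero^5) $ 5 = e"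
  unfolding vector_def by simp_all


section \<open>The hypercube and its height functions\<close>

text \<open>A vertex of the hypercube is a 0/1-vector, with \<^const>\<open>True\<close> for 1.\<close>

type_synonym cube_vertex = "bool^5"

definition all_ones :: cube_vertex where
  "all_ones = (\<chi> i. True)"

definition adjacent :: "cube_vertex \<Rightarrow> cube_vertex \<Rightarrow> bool" where
  "adjacent u v \<longleftrightarrow> (\<exists>!j. u $ j \<noteq> v $ j)"

definition nbr :: "5 \<Rightarrow> cube_vertex \<Rightarrow> cube_vertex" where
  "nbr j v = (\<chi> i. if i = j then \<not> v $ i else v $ i)"

definition height_function :: "(cube_vertex \<Rightarrow> int) \<Rightarrow> bool" where
  "height_function h \<longleftrightarrow> (\<forall>u v. adjacent u v \<longrightarrow> \<bar>h u - h v\<bar> = 1)"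

definition shift_rel :: "((cube_vertex \<Rightarrow> int) \<times> (cube_vertex \<Rightarrow> int)) set" where
  "shift_rel = {(g, h). \<exists>c. \<forall>v. g v = h v + c}"


section \<open>The discrete Morse divisor\<close>

definition cycle4 :: "5 \<Rightarrow> cube_vertex \<Rightarrow> cube_vertex set" where
  "cycle4 m v = {v, nbr m v, nbr m (nbr (m + 1) v), nbr (m + 1) v}"

text \<open>
  A face centre is recorded by the first of its two colours and the vertex set of its 4-cycle, so
  that it depends only on the 4-cycle.
\<close>

datatype mesh_point = Vertex cube_vertex | Center 5 "cube_vertex set"

definition face_center :: "5 \<Rightarrow> cube_vertex \<Rightarrow> mesh_point" where
  "face_center m v = Center m (cycle4 m v)"

definition bow_tie :: "(cube_vertex \<Rightarrow> int) \<Rightarrow> 5 \<Rightarrow> cube_vertex \<Rightarrow> bool" where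
  "bow_tie h m v \<longleftrightarrow> card (h ` cycle4 m v) = 2"

definition mesh_points :: "(cube_vertex \<Rightarrow> int) \<Rightarrow> mesh_point set" where
  "mesh_points h = range Vertex \<union> {face_center m v | m v. bow_tie h m v}"

fun mesh_height :: "(cube_vertex \<Rightarrow> int) \<Rightarrow> mesh_point \<Rightarrow> real" where
  "mesh_height h (Vertex v) = real_of_int (h v)"
| "mesh_height h (Center m C) = (\<Sum>u\<in>C. real_of_int (h u)) / 4"

text \<open>
  The boundary of the star of a mesh point, listed in cyclic order.  In the cell through \<open>v\<close> with
  colours \<open>j, j + 1\<close>, the boundary runs from \<open>nbr j v\<close> to \<open>nbr (j + 1) v\<close>: through the face centre
  in a bow-tie; through the opposite vertex in a diamond cut by an edge at \<open>v\<close>, that is, when \<open>v\<close> is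
  its maximum or minimum; and directly along the cutting edge in the remaining diamonds.
\<close>

fun star_boundary :: "(cube_vertex \<Rightarrow> int) \<Rightarrow> mesh_point \<Rightarrow> mesh_point list" where
  "star_boundary h (Vertex v) = concat (map (\<lambda>j. Vertex (nbr j v) #
      (if bow_tie h j v then [face_center j v]
       else if h v = Max (h ` cycle4 j v) \<or> h v = Min (h ` cycle4 j v)
         then [Vertex (nbr j (nbr (j + 1) v))]
       else [])) [1, 2, 3, 4, 5])"
| "star_boundary h (Center m C) = (let v = (SOME v. v \<in> C) in
      map Vertex [v, nbr m v, nbr m (nbr (m + 1) v), nbr (m + 1) v])"

definition sign_changes :: "real list \<Rightarrow> nat" where
  "sign_changes xs = length (filter (\<lambda>(x, y). sgn x \<noteq> sgn y) (zip xs (rotate1 xs)))"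

definition morse_lambda :: "(cube_vertex \<Rightarrow> int) \<Rightarrow> mesh_point \<Rightarrow> nat" where
  "morse_lambda h p =
     sign_changes (map (\<lambda>u. mesh_height h u - mesh_height h p) (star_boundary h p))"

text \<open>The number of sign changes around a closed path is even, so the division by 2 is exact.\<close>

definition morse_divisor :: "(cube_vertex \<Rightarrow> int) \<Rightarrow> mesh_point \<Rightarrow> int" where
  "morse_divisor h p = (if p \<in> mesh_points h then int (morse_lambda h p) div 2 - 1 else 0)"


section \<open>Projective 4-space, the curve and the embedded points\<close>

definition proportional :: "complex^5 \<Rightarrow> complex^5 \<Rightarrow> bool" where
  "proportional x y \<longleftrightarrow> x \<noteq> 0 \<and> (\<exists>c. c \<noteq> 0 \<and> y = c *s x)"

lemma part_equivp_proportional: "part_equivp proportional"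
proof (rule part_equivpI)
  show "\<exists>x. proportional x x"
    unfolding proportional_def by (intro exI[of _ "vec 1"] conjI exI[of _ 1]) (auto simp: vec_eq_iff)
  show "symp proportional"
  proof (rule sympI)
    fix x y assume "proportional x y"
    then obtain c where c: "x \<noteq> 0" "c \<noteq> 0" "y = c *s x" by (auto simp: proportional_def)
    then have "x = inverse c *s y" by (simp add: vec_eq_iff)
    then show "proportional y x" using c
      by (auto simp: proportional_def intro!: exI[of _ "inverse c"])
  qed
  show "transp proportional"
  proof (rule transpI)
    fix x y z assume "proportional x y" "proportional y z"
    then obtain c d where "x \<noteq> 0" "c \<noteq> 0" "y = c *s x" "d \<noteq> 0" "z = d *s y"
      by (auto simp: proportional_def)
    then show "proportional x z"
      by (auto simp: proportional_def vec_eq_iff intro!: exI[of _ "d * c"])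
  qed
qed

quotient_type proj4 = "complex^5" / partial: proportional
  by (rule part_equivp_proportional)

definition phi :: real where
  "phi = (1 + sqrt 5) / 2"

definition zeta :: complex where
  "zeta = exp (2 * of_real pi * \<i> / 10)"

lift_definition on_X5 :: "proj4 \<Rightarrow> bool" is
  "\<lambda>x. (x $ 1)\<^sup>2 + (x $ 2)\<^sup>2 + (x $ 3)\<^sup>2 = 0 \<and>
       of_real phi * (x $ 1)\<^sup>2 + (x $ 2)\<^sup>2 + (x $ 4)\<^sup>2 = 0 \<and>
       (of_real phi + 1) * (x $ 1)\<^sup>2 + (x $ 2)\<^sup>2 + (x $ 5)\<^sup>2 = 0"
  subgoal for x y
  proof -
    have *: "a * (c * x)\<^sup>2 + (c * y)\<^sup>2 + (c * z)\<^sup>2 = 0 \<longleftrightarrow> a * x\<^sup>2 + y\<^sup>2 + z\<^sup>2 = 0"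
      if "c \<noteq> 0" for a c x y z :: complex
    proof -
      have "a * (c * x)\<^sup>2 + (c * y)\<^sup>2 + (c * z)\<^sup>2 = c\<^sup>2 * (a * x\<^sup>2 + y\<^sup>2 + z\<^sup>2)"
        by (simp add: algebra_simps power2_eq_square)
      then show ?thesis using that by simp
    qed
    assume "proportional x y"
    then obtain c where "c \<noteq> 0" "y = c *s x" by (auto simp: proportional_def)
    then show ?thesis using *[where a = 1] * by simp
  qed
  done

definition X5_alg :: "proj4 set" where
  "X5_alg = {P. on_X5 P}"

text \<open>Row \<open>k\<close>, column \<open>j\<close> is the sign with which colour \<open>j\<close> acts on the \<open>k\<close>-th coordinate.\<close>

definition sgn_table :: "complex^5^5" where
  "sgn_table = vector
     [vector [ 1,  1,  1,  1,  1],
      vector [-1, -1, -1, -1,  1],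
      vector [-1,  1,  1,  1, -1],
      vector [-1, -1,  1,  1, -1],
      vector [-1, -1, -1,  1, -1]]"

lemma sgn_table_cases: "sgn_table $ k $ j = 1 \<or> sgn_table $ k $ j = -1"
  using exhaust_5[of k] exhaust_5[of j] by (auto simp: sgn_table_def vector_5)

lift_definition reflect :: "5 \<Rightarrow> proj4 \<Rightarrow> proj4" is
  "\<lambda>j x. \<chi> k. sgn_table $ k $ j * cnj (x $ k)"
proof -
  fix j and x y :: "complex^5"
  assume "proportional x y"
  then obtain c where c: "x \<noteq> 0" "c \<noteq> 0" "y = c *s x" by (auto simp: proportional_def)
  have "sgn_table $ k $ j \<noteq> 0" for k using sgn_table_cases[of k j] by auto
  then show "proportional (\<chi> k. sgn_table $ k $ j * cnj (x $ k)) (\<chi> k. sgn_table $ k $ j * cnj (y $ k))"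
    using c by (auto simp: proportional_def vec_eq_iff intro!: exI[of _ "cnj c"])
qed

definition base_vertex :: proj4 where
  "base_vertex = abs_proj4 (vector
     [1, zeta ^ 2 * of_real (sqrt phi), zeta ^ 9, \<i> * zeta ^ 6, zeta ^ 8 * of_real (sqrt phi)])"

text \<open>The centre of the face with colours \<open>m, m + 1\<close> at \<^const>\<open>all_ones\<close>.\<close>

definition base_face :: "5 \<Rightarrow> proj4" where
  "base_face m = abs_proj4 ((vector
     [vector [1, \<i>, 0, - \<i> * of_real (sqrt (phi - 1)), - \<i> * of_real (sqrt phi)],
      vector [1, \<i> * of_real (sqrt phi), of_real (sqrt (phi - 1)), 0, - \<i>],
      vector [1, \<i> * of_real (sqrt (phi + 1)), of_real (sqrt phi), 1, 0],
      vector [0, 1, - \<i>, - \<i>, - \<i>],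
      vector [1, 0, - \<i>, - \<i> * of_real (sqrt phi), - \<i> * of_real (sqrt (phi + 1))]] :: complex^5^5) $ m)"

text \<open>
  The reflections commute, so a position at \<^const>\<open>all_ones\<close> is carried to \<open>v\<close> by applying, in any
  order, those for the coordinates in which \<open>v\<close> differs from \<^const>\<open>all_ones\<close>.
\<close>

definition propagate :: "proj4 \<Rightarrow> cube_vertex \<Rightarrow> proj4" where
  "propagate P v = Finite_Set.fold reflect P {j. \<not> v $ j}"

text \<open>
  The same point of projective space is obtained from all four vertices of a 4-cycle (see
  \<open>position_face_center\<close> below), so \<^const>\<open>the_elem\<close> is applied to a singleton.
\<close>

fun position :: "mesh_point \<Rightarrow> proj4" where
  "position (Vertex v) = propagate base_vertex v"
| "position (Center m C) = the_elem (propagate (base_face m) ` C)"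


section \<open>Elliptic curves in Legendre form\<close>

datatype ec_point = Infty | Affine complex complex

text \<open>Chord-tangent addition on \<open>y\<^sup>2 = x (x - 1) (x - l) = x\<^sup>3 - (1 + l) x\<^sup>2 + l x\<close>.\<close>

fun ec_add :: "complex \<Rightarrow> ec_point \<Rightarrow> ec_point \<Rightarrow> ec_point" where
  "ec_add l Infty Q = Q"
| "ec_add l P Infty = P"
| "ec_add l (Affine x1 y1) (Affine x2 y2) =
     (if x1 = x2 \<and> y1 = - y2 then Infty
      else let s = (if x1 = x2 then (3 * x1\<^sup>2 - 2 * (1 + l) * x1 + l) / (2 * y1)
                    else (y2 - y1) / (x2 - x1));
               x3 = s\<^sup>2 + (1 + l) - x1 - x2
           in Affine x3 (s * (x1 - x3) - y1))"

definition legendre_group :: "complex \<Rightarrow> ec_point monoid" where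
  "legendre_group l =
     \<lparr>carrier = insert Infty {Affine x y | x y. y\<^sup>2 = x * (x - 1) * (x - l)},
      monoid.mult = ec_add l, one = Infty\<rparr>"

text \<open>
  The group \<open>E\<^sub>k(\<complex>)\<close>, in the multiplicative notation of HOL-Algebra.
\<close>

definition EC :: "5 \<Rightarrow> ec_point monoid" where
  "EC k = legendre_group (of_real
     ((vector [phi + 1, phi, - phi, phi + 1, phi] :: real^5) $ k))"

definition affine_or_infty :: "complex \<Rightarrow> complex \<Rightarrow> complex \<Rightarrow> ec_point" where
  "affine_or_infty d x y = (if d = 0 then Infty else Affine x y)"

lift_definition nu :: "5 \<Rightarrow> proj4 \<Rightarrow> ec_point" is
  "\<lambda>k x. let x1 = x $ 1; x2 = x $ 2; x3 = x $ 3; x4 = x $ 4; x5 = x $ 5; f = complex_of_real phi in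
     if k = 1 then affine_or_infty x5
       (- (2 * f + 1) * (x1\<^sup>2 / x5\<^sup>2) - f) ((2 * f + 1) * (x2 * x3 * x4 / x5 ^ 3))
     else if k = 2 then affine_or_infty x1
       (x2\<^sup>2 / x1\<^sup>2 + f + 1) (\<i> * (x3 * x4 * x5 / x1 ^ 3))
     else if k = 3 then affine_or_infty x2
       ((2 * f + 1) * (x3\<^sup>2 / x2\<^sup>2) + f + 1) (\<i> * (2 * f + 1) * (x1 * x4 * x5 / x2 ^ 3))
     else if k = 4 then affine_or_infty x3
       ((f + 1) * (x4\<^sup>2 / x3\<^sup>2) - f) (\<i> * f * (x1 * x2 * x5 / x3 ^ 3))
     else affine_or_infty x4
       (- (x5\<^sup>2 / x4\<^sup>2) + f + 1) (\<i> * (x1 * x2 * x3 / x4 ^ 3))"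
  subgoal for k x y
  proof -
    assume "proportional x y"
    then obtain c where c: "c \<noteq> 0" "y = c *s x" by (auto simp: proportional_def)
    have 2: "(c * u)\<^sup>2 / (c * v)\<^sup>2 = u\<^sup>2 / v\<^sup>2" for u v
      using c(1) by (simp add: power_mult_distrib)
    have 3: "c * u * (c * v) * (c * w) / (c * z) ^ 3 = u * v * w / z ^ 3" for u v w z
    proof -
      have "c * u * (c * v) * (c * w) = c ^ 3 * (u * v * w)" by (simp add: power3_eq_cube)
      then show ?thesis using c(1) by (simp only: power_mult_distrib) simp
    qed
    show ?thesis
      using c(1) unfolding c(2) Let_def affine_or_infty_def vector_smult_component 2 3 by simp
  qed
  done

definition nu_divisor :: "5 \<Rightarrow> (mesh_point \<Rightarrow> int) \<Rightarrow> ec_point" where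
  "nu_divisor k D = finprod (EC k) (\<lambda>p. nu k (position p) [^]\<^bsub>EC k\<^esub> D p) {p. D p \<noteq> 0}"

definition e_inf :: "5 \<Rightarrow> ec_point" where
  "e_inf k = nu k (position (Vertex all_ones))"

definition e_four :: "5 \<Rightarrow> ec_point" where
  "e_four k = nu k (position (face_center (k - 2) all_ones))"

definition e_two :: "5 \<Rightarrow> ec_point" where
  "e_two k = nu k (position (face_center k all_ones))"

text \<open>
  The set being divided is closed under \<^const>\<open>shift_rel\<close> (see \<open>shift_invariant\<close> below), so this
  counts height functions up to an additive constant.
\<close>

definition height_count :: "5 \<Rightarrow> int \<Rightarrow> nat" where
  "height_count k m =
     card ({h. height_function h \<and>
               nu_divisor k (morse_divisor h) =
                 (e_inf k \<otimes>\<^bsub>EC k\<^esub> inv\<^bsub>EC k\<^esub> e_four k) [^]\<^bsub>EC k\<^esub> m} // shift_rel)"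


section \<open>Consistency of the positions; the maps into the elliptic curves\<close>

lemma proportional_refl: "x \<noteq> 0 \<Longrightarrow> proportional x x"
  by (auto simp: proportional_def vec_eq_iff intro!: exI[of _ 1])

lemma abs_proj4_eqI: "proportional x y \<Longrightarrow> abs_proj4 x = abs_proj4 y"
  using Quotient3_rel_abs[OF Quotient3_proj4] .

lemma cnj_sgn_table: "cnj (sgn_table $ k $ j) = sgn_table $ k $ j"
  using sgn_table_cases[of k j] by auto

lemma sgn_table_square: "sgn_table $ k $ j * sgn_table $ k $ j = 1"
  using sgn_table_cases[of k j] by auto

lemma reflect_commute: "reflect i (reflect j P) = reflect j (reflect i P)"
proof (transfer, goal_cases)
  case (1 i j x)
  have "(\<chi> k. sgn_table $ k $ i * cnj ((\<chi> k. sgn_table $ k $ j * cnj (x $ k)) $ k)) =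
        (\<chi> k. sgn_table $ k $ j * cnj ((\<chi> k. sgn_table $ k $ i * cnj (x $ k)) $ k))"
    by (simp add: vec_eq_iff cnj_sgn_table)
  moreover have "proportional (\<chi> k. sgn_table $ k $ i * cnj ((\<chi> k. sgn_table $ k $ j * cnj (x $ k)) $ k))
     (\<chi> k. sgn_table $ k $ i * cnj ((\<chi> k. sgn_table $ k $ j * cnj (x $ k)) $ k))"
    by (intro reflect.rsp[unfolded rel_fun_def, rule_format] refl 1)
  ultimately show ?case by simp
qed

lemma reflect_involution: "reflect j (reflect j P) = P"
proof (transfer, goal_cases)
  case (1 j x)
  have "(\<chi> k. sgn_table $ k $ j * cnj ((\<chi> k. sgn_table $ k $ j * cnj (x $ k)) $ k)) = x"
    using sgn_table_square by (simp add: vec_eq_iff cnj_sgn_table flip: mult.assoc)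
  then show ?case using 1 by simp
qed

interpretation reflect: comp_fun_commute reflect
  by unfold_locales (auto simp: reflect_commute)

lemma propagate_all_ones: "propagate P all_ones = P"
  by (simp add: propagate_def all_ones_def)

lemma propagate_nbr: "propagate P (nbr j v) = reflect j (propagate P v)"
proof -
  have *: "propagate P (nbr j v) = reflect j (propagate P v)" if "v $ j" for v
  proof -
    have "{i. \<not> nbr j v $ i} = insert j {i. \<not> v $ i}" using that by (auto simp: nbr_def)
    then show ?thesis using that by (simp add: propagate_def)
  qed
  show ?thesis
  proof (cases "v $ j")
    case False
    have "nbr j (nbr j v) = v" "nbr j v $ j" using False by (auto simp: nbr_def vec_eq_iff)
    then have "propagate P v = reflect j (propagate P (nbr j v))" using *[of "nbr j v"] by simp
    then show ?thesis by (simp add: reflect_involution)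
  qed (rule *)
qed

lemma reflect_propagate: "reflect j (propagate P v) = propagate (reflect j P) v"
  unfolding propagate_def by (rule reflect.fold_fun_left_comm) simp

lemma base_face_reflect: "reflect m (base_face m) = base_face m"
  "reflect (m + 1) (base_face m) = base_face m"
proof -
  have nz: "m = 1 \<or> m = 2 \<or> m = 3 \<or> m = 4 \<or> m = 5" by (rule exhaust_5)
  have six: "(6 :: 5) = 1" by simp
  have *: "reflect j (abs_proj4 x) = abs_proj4 x"
    if "x \<noteq> 0" "c \<noteq> 0" "(\<chi> k. sgn_table $ k $ j * cnj (x $ k)) = c *s x" for j c and x
  proof -
    have "proportional x (c *s x)" using that by (auto simp: proportional_def)
    then show ?thesis
      by (metis abs_proj4_eqI proportional_refl reflect.abs_eq that(1,3))
  qed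
  show "reflect m (base_face m) = base_face m"
    unfolding base_face_def
    apply (rule *[where c = "if m = 4 then -1 else 1"])
    using nz by (auto simp: vec_eq_iff forall_5 vector_5 sgn_table_def)
  show "reflect (m + 1) (base_face m) = base_face m"
    unfolding base_face_def
    apply (rule *[where c = 1])
    using nz by (auto simp: six vec_eq_iff forall_5 vector_5 sgn_table_def)
qed

lemma position_face_center: "position (face_center m v) = propagate (base_face m) v"
  by (simp add: face_center_def cycle4_def propagate_nbr reflect_propagate base_face_reflect)

lemma position_rules:
  "position (Vertex all_ones) = base_vertex"
  "position (face_center m all_ones) = base_face m"
  "position (Vertex (nbr j v)) = reflect j (position (Vertex v))"
  "position (face_center m (nbr j v)) = reflect j (position (face_center m v))"
  by (simp_all add: position_face_center propagate_all_ones propagate_nbr)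

lemma phi_square: "phi\<^sup>2 = phi + 1"
  by (simp add: phi_def power2_eq_square field_simps)

lemma phi_gt_1: "phi > 1"
  by (simp add: phi_def)

lemma zeta_power: "zeta ^ 5 = -1"
proof -
  have "zeta = cis (pi / 5)"
    by (simp add: zeta_def cis_conv_exp mult.commute)
  then show ?thesis using Complex.DeMoivre[of "pi / 5" 5] by simp
qed

lemma zeta_phi: "of_real phi = zeta - zeta ^ 4"
proof -
  define z where "z = zeta"
  have z: "z = cis (pi / 5)" by (simp add: z_def zeta_def cis_conv_exp mult.commute)
  have 5: "z ^ 5 = -1" using zeta_power by (simp add: z_def)
  have "z \<noteq> -1"
  proof
    assume "z = -1"
    then have "cos (pi / 5) = -1" unfolding z by (metis Re_complex_of_real cis.sel(1) one_complex.sel(1) uminus_complex.sel(1))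
    moreover have "cos (pi / 5) > 0" by (intro cos_gt_zero) auto
    ultimately show False by simp
  qed
  moreover have "(z + 1) * (z ^ 4 - z ^ 3 + z ^ 2 - z + 1) = 0" using 5 by algebra
  ultimately have m: "z ^ 4 - z ^ 3 + z ^ 2 - z + 1 = 0" by (metis eq_neg_iff_add_eq_0 mult_eq_0_iff)
  have "- (z ^ 4) = cis (- (pi / 5))"
  proof -
    have "z * (- (z ^ 4)) = 1" using 5 by algebra
    moreover have "z * cis (- (pi / 5)) = 1" by (simp add: z cis_mult)
    ultimately show ?thesis by (metis mult_cancel_left mult_zero_left zero_neq_one)
  qed
  then have c: "z - z ^ 4 = of_real (2 * cos (pi / 5))"
    by (simp add: z complex_eq_iff)
  define t where "t = 2 * cos (pi / 5)"
  have "(z - z ^ 4) ^ 2 = (z - z ^ 4) + 1" using m 5 by algebra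
  then have "complex_of_real (t\<^sup>2) = of_real (t + 1)" unfolding c t_def[symmetric] by simp
  then have "t\<^sup>2 = t + 1" using of_real_eq_iff by blast
  then have "(t - phi) * (t - (1 - phi)) = 0" using phi_square by algebra
  moreover have "t > 0" unfolding t_def by (simp add: cos_gt_zero)
  ultimately have "t = phi" using phi_gt_1 by auto
  then show ?thesis using c by (simp add: t_def z_def)
qed

lemma zeta_min: "zeta ^ 4 - zeta ^ 3 + zeta ^ 2 - zeta + 1 = 0"
proof -
  have "complex_of_real (phi\<^sup>2) = of_real (phi + 1)" by (simp only: phi_square)
  then have "(zeta - zeta ^ 4) ^ 2 = zeta - zeta ^ 4 + 1" by (simp add: zeta_phi)
  then show ?thesis using zeta_power by algebra
qed

lemma base_in_X5: "base_vertex \<in> X5_alg" "base_face m \<in> X5_alg"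
proof -
  have s: "(complex_of_real (sqrt a))\<^sup>2 = of_real a" if "a \<ge> 0" for a
    using that by (metis of_real_power real_sqrt_pow2)
  have p2: "(complex_of_real phi)\<^sup>2 = of_real phi + 1"
    using phi_square by (metis of_real_1 of_real_add of_real_power)
  have r1: "(complex_of_real (sqrt phi))\<^sup>2 = of_real phi"
    and r2: "(complex_of_real (sqrt (phi + 1)))\<^sup>2 = of_real phi + 1"
    and r3: "(complex_of_real (sqrt (phi - 1)))\<^sup>2 = of_real phi - 1"
    using phi_gt_1 by (auto simp: s)
  have pm: "(zeta ^ a)\<^sup>2 = zeta ^ (2 * a)" for a by (simp add: power_mult[symmetric] mult.commute)
  define q where "q = complex_of_real (sqrt phi)"
  have q: "q\<^sup>2 = zeta - zeta ^ 4" using r1 zeta_phi by (simp add: q_def)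
  have z8: "zeta ^ 8 = - (zeta ^ 3)" "zeta ^ 12 = zeta ^ 2" "zeta ^ 16 = - zeta" "zeta ^ 18 = - (zeta ^ 3)"
  proof -
    have "zeta ^ 8 = zeta ^ 5 * zeta ^ 3" "zeta ^ 12 = (zeta ^ 5)\<^sup>2 * zeta ^ 2"
      "zeta ^ 16 = (zeta ^ 5) ^ 3 * zeta" "zeta ^ 18 = (zeta ^ 5) ^ 3 * zeta ^ 3"
      by (simp_all flip: power_mult power_add power_Suc2)
    then show "zeta ^ 8 = - (zeta ^ 3)" "zeta ^ 12 = zeta ^ 2" "zeta ^ 16 = - zeta" "zeta ^ 18 = - (zeta ^ 3)"
      by (simp_all add: zeta_power)
  qed
  have v1: "1\<^sup>2 + (zeta ^ 2 * q)\<^sup>2 + (zeta ^ 9)\<^sup>2 = 0"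
    unfolding power_mult_distrib pm q using z8 zeta_power by (simp add: right_diff_distrib flip: power_add power_Suc2)
  have v2: "(zeta - zeta ^ 4) * 1\<^sup>2 + (zeta ^ 2 * q)\<^sup>2 + (\<i> * zeta ^ 6)\<^sup>2 = 0"
    unfolding power_mult_distrib pm q using z8 zeta_power zeta_min
    by (simp add: right_diff_distrib flip: power_add power_Suc2) algebra
  have v3: "((zeta - zeta ^ 4) + 1) * 1\<^sup>2 + (zeta ^ 2 * q)\<^sup>2 + (zeta ^ 8 * q)\<^sup>2 = 0"
    unfolding power_mult_distrib pm q using z8 zeta_power zeta_min
    by (simp add: right_diff_distrib flip: power_add power_Suc2) algebra
  show "base_vertex \<in> X5_alg"
    unfolding base_vertex_def X5_alg_def mem_Collect_eq
    apply (subst on_X5.abs_eq)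
    subgoal by (rule proportional_refl) (auto simp: vec_eq_iff forall_5 vector_5)
    unfolding vector_5 zeta_phi q_def[symmetric] using v1 v2 v3 by blast
  have nz: "m = 1 \<or> m = 2 \<or> m = 3 \<or> m = 4 \<or> m = 5" by (rule exhaust_5)
  show "base_face m \<in> X5_alg"
    unfolding base_face_def X5_alg_def mem_Collect_eq
    apply (subst on_X5.abs_eq)
    subgoal using nz by (intro proportional_refl) (auto simp: vec_eq_iff forall_5 vector_5)
    using nz p2 by (auto simp: vector_5 power_mult_distrib r1 r2 r3 algebra_simps power2_eq_square[symmetric])
qed

lemma reflect_in_X5: "P \<in> X5_alg \<Longrightarrow> reflect j P \<in> X5_alg"
proof -
  have sq: "(sgn_table $ k $ j * cnj z)\<^sup>2 = (cnj z)\<^sup>2" for k j z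
    using sgn_table_cases[of k j] by auto
  have *: "a * (cnj u)\<^sup>2 + (cnj v)\<^sup>2 + (cnj w)\<^sup>2 = 0"
    if "a * u\<^sup>2 + v\<^sup>2 + w\<^sup>2 = 0" "cnj a = a" for a u v w
    using arg_cong[OF that(1), of cnj] that(2) by simp
  have "on_X5 P \<Longrightarrow> on_X5 (reflect j P)"
    apply transfer
    unfolding vec_lambda_beta sq
    using *[of 1] *[of "complex_of_real phi"] *[of "complex_of_real phi + 1"] by simp
  then show "P \<in> X5_alg \<Longrightarrow> reflect j P \<in> X5_alg" by (simp add: X5_alg_def)
qed

lemma propagate_in_X5: "P \<in> X5_alg \<Longrightarrow> propagate P v \<in> X5_alg"
proof -
  assume "P \<in> X5_alg"
  have "Finite_Set.fold reflect P S \<in> X5_alg" if "finite S" for S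
    using that by induction (auto simp: \<open>P \<in> X5_alg\<close> reflect_in_X5)
  then show ?thesis by (simp add: propagate_def)
qed

lemma position_in_X5: "position (Vertex v) \<in> X5_alg" "position (face_center m v) \<in> X5_alg"
  by (simp_all only: position_face_center position.simps propagate_in_X5 base_in_X5)

lemma nu_in_EC:
  assumes "P \<in> X5_alg"
  shows "nu k P \<in> carrier (EC k)"
proof -
  have p2: "(complex_of_real phi)\<^sup>2 = of_real phi + 1"
    using phi_square by (metis of_real_1 of_real_add of_real_power)
  define f where "f = complex_of_real phi"
  have p2: "f\<^sup>2 = f + 1" using p2 by (simp add: f_def)
  have L: "affine_or_infty d X (n * (u * v * w / d ^ 3)) \<in> carrier (legendre_group l)"
    if "X = p * (t\<^sup>2 / d\<^sup>2) + q" "p * t\<^sup>2 + q * d\<^sup>2 = a" "a - d\<^sup>2 = b" "a - l * d\<^sup>2 = c" "a * b * c = n\<^sup>2 * (u\<^sup>2 * v\<^sup>2 * w\<^sup>2)"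
    for d X n u v w l a b c p q t
  proof (cases "d = 0")
    case False
    have X: "X = a / d\<^sup>2" "X - 1 = b / d\<^sup>2" "X - l = c / d\<^sup>2"
      using that(1-4) False by (auto simp: field_simps)
    have "X * (X - 1) * (X - l) = a * b * c / d ^ 6"
      unfolding X(2,3) by (simp add: X(1) flip: power_add)
    also have "\<dots> = (n * (u * v * w / d ^ 3))\<^sup>2"
      unfolding that(5) by (simp add: power_mult_distrib power_divide flip: power_mult)
    finally show ?thesis using False by (simp add: affine_or_infty_def legendre_group_def)
  qed (simp add: affine_or_infty_def legendre_group_def)
  have nz: "k = 1 \<or> k = 2 \<or> k = 3 \<or> k = 4 \<or> k = 5" by (rule exhaust_5)
  define x where "x = rep_proj4 P"
  have xx: "proportional x x" and P: "P = abs_proj4 x"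
    unfolding x_def using Quotient3_rep_reflp[OF Quotient3_proj4] Quotient3_abs_rep[OF Quotient3_proj4]
    by metis+
  note eqs = assms[unfolded X5_alg_def mem_Collect_eq P on_X5.abs_eq[OF xx]]
  define x1 x2 x3 x4 x5 where x: "x1 = x $ 1" "x2 = x $ 2" "x3 = x $ 3" "x4 = x $ 4" "x5 = x $ 5"
  have e: "x3\<^sup>2 = - x1\<^sup>2 - x2\<^sup>2" "x4\<^sup>2 = - f * x1\<^sup>2 - x2\<^sup>2" "x5\<^sup>2 = - (f + 1) * x1\<^sup>2 - x2\<^sup>2"
  proof -
    have "x1\<^sup>2 + x2\<^sup>2 + x3\<^sup>2 = 0" "f * x1\<^sup>2 + x2\<^sup>2 + x4\<^sup>2 = 0" "(f + 1) * x1\<^sup>2 + x2\<^sup>2 + x5\<^sup>2 = 0"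
      using eqs unfolding x f_def by blast+
    then show "x3\<^sup>2 = - x1\<^sup>2 - x2\<^sup>2" "x4\<^sup>2 = - f * x1\<^sup>2 - x2\<^sup>2" "x5\<^sup>2 = - (f + 1) * x1\<^sup>2 - x2\<^sup>2"
      by algebra+
  qed
  have c1: "affine_or_infty x5 (- (2 * f + 1) * (x1\<^sup>2 / x5\<^sup>2) - f) ((2 * f + 1) * (x2 * x3 * x4 / x5 ^ 3))
      \<in> carrier (legendre_group (f + 1))"
    apply (rule L[where p = "- (2 * f + 1)" and q = "- f" and t = "x1" and a = "f * x2\<^sup>2" and b = "- (f + 1) * x3\<^sup>2" and c = "- (2 * f + 1) * x4\<^sup>2"])
        apply simp
    using e p2 by algebra+
  have c2: "affine_or_infty x1 (x2\<^sup>2 / x1\<^sup>2 + f + 1) (\<i> * (x3 * x4 * x5 / x1 ^ 3))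
      \<in> carrier (legendre_group f)"
    apply (rule L[where p = "1" and q = "f + 1" and t = "x2" and a = "- x5\<^sup>2" and b = "- x4\<^sup>2" and c = "- x3\<^sup>2"])
        apply simp
    using e p2 i_squared by algebra+
  have c3: "affine_or_infty x2 ((2 * f + 1) * (x3\<^sup>2 / x2\<^sup>2) + f + 1) (\<i> * (2 * f + 1) * (x1 * x4 * x5 / x2 ^ 3))
      \<in> carrier (legendre_group (- f))"
    apply (rule L[where p = "2 * f + 1" and q = "f + 1" and t = "x3" and a = "f * x5\<^sup>2" and b = "(f + 1) * x4\<^sup>2" and c = "- (2 * f + 1) * x1\<^sup>2"])
        apply simp
    using e p2 i_squared by algebra+
  have c4: "affine_or_infty x3 ((f + 1) * (x4\<^sup>2 / x3\<^sup>2) - f) (\<i> * f * (x1 * x2 * x5 / x3 ^ 3))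
      \<in> carrier (legendre_group (f + 1))"
    apply (rule L[where p = "f + 1" and q = "- f" and t = "x4" and a = "x5\<^sup>2" and b = "- f * x1\<^sup>2" and c = "f * x2\<^sup>2"])
        apply simp
    using e p2 i_squared by algebra+
  have c5: "affine_or_infty x4 (- (x5\<^sup>2 / x4\<^sup>2) + f + 1) (\<i> * (x1 * x2 * x3 / x4 ^ 3))
      \<in> carrier (legendre_group f)"
    apply (rule L[where p = "- 1" and q = "f + 1" and t = "x5" and a = "f * x3\<^sup>2" and b = "(1 - f) * x2\<^sup>2" and c = "x1\<^sup>2"])
        apply simp
    using e p2 i_squared by algebra+
  show ?thesis
    using nz c1 c2 c3 c4 c5
    unfolding P nu.abs_eq[OF xx] Let_def x[symmetric] f_def[symmetric]
    by (elim disjE) (simp_all add: EC_def vector_5 f_def)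
qed


section \<open>Explicit coefficients of the discrete Morse divisor\<close>

lemma sum_5: "sum f (UNIV :: 5 set) = f 1 + f 2 + f 3 + f 4 + f 5"
  unfolding UNIV_5 by (simp add: ac_simps)

lemma next_neq: "j + 1 \<noteq> (j :: 5)"
  by simp

lemma nbr_nbr: "nbr j (nbr j v) = v"
  by (auto simp: nbr_def vec_eq_iff)

lemma nbr_commute: "nbr i (nbr j v) = nbr j (nbr i v)"
  by (auto simp: nbr_def vec_eq_iff)

lemma adjacent_nbr: "adjacent v (nbr j v)"
  by (auto simp: adjacent_def nbr_def)

lemma cycle4_cases:
  assumes "height_function h"
  obtains "h (nbr j v) = h v + 1 \<or> h (nbr j v) = h v - 1"
    and "h (nbr (j + 1) v) = h v + 1 \<or> h (nbr (j + 1) v) = h v - 1"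
    and "\<bar>h (nbr j (nbr (j + 1) v)) - h (nbr j v)\<bar> = 1"
    and "\<bar>h (nbr j (nbr (j + 1) v)) - h (nbr (j + 1) v)\<bar> = 1"
proof -
  have *: "\<bar>h u - h (nbr i u)\<bar> = 1" for i u
    using assms adjacent_nbr unfolding height_function_def by blast
  show thesis
  proof (rule that)
    show "h (nbr j v) = h v + 1 \<or> h (nbr j v) = h v - 1" using *[of v j] by arith
    show "h (nbr (j + 1) v) = h v + 1 \<or> h (nbr (j + 1) v) = h v - 1" using *[of v "j + 1"] by arith
    show "\<bar>h (nbr j (nbr (j + 1) v)) - h (nbr j v)\<bar> = 1"
      using *[of "nbr j v" "j + 1"] nbr_commute[of j "j + 1" v] by simp
    show "\<bar>h (nbr j (nbr (j + 1) v)) - h (nbr (j + 1) v)\<bar> = 1"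
      using *[of "nbr (j + 1) v" j] by simp
  qed
qed

lemma card_four_heights:
  fixes a b c d :: int
  assumes "b = a + 1 \<or> b = a - 1" "d = a + 1 \<or> d = a - 1" "\<bar>c - b\<bar> = 1" "\<bar>c - d\<bar> = 1"
  shows "card {a, b, c, d} = 2 \<longleftrightarrow> c = a \<and> b = d"
proof -
  have "c = b + 1 \<or> c = b - 1" using assms(3) by arith
  then show ?thesis
    using assms(1,2,4) by (elim disjE) (simp_all add: card_insert_if)
qed

lemma bow_tie_iff:
  assumes "height_function h"
  shows "bow_tie h j v \<longleftrightarrow> h (nbr j (nbr (j + 1) v)) = h v \<and> h (nbr j v) = h (nbr (j + 1) v)"
  by (rule cycle4_cases[OF assms, of j v]) (simp add: bow_tie_def cycle4_def card_four_heights)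

lemma extreme_sgn:
  fixes a b c d :: int
  assumes "b = a + 1 \<or> b = a - 1" "d = a + 1 \<or> d = a - 1" "\<bar>c - b\<bar> = 1" "\<bar>c - d\<bar> = 1"
    and "\<not> (c = a \<and> b = d)" "a = Max {a, b, c, d} \<or> a = Min {a, b, c, d}"
  shows "sgn (real_of_int c - a) = sgn (real_of_int b - a) \<and>
         sgn (real_of_int c - a) = sgn (real_of_int d - a)"
proof -
  have "(b \<le> a \<and> c \<le> a \<and> d \<le> a) \<or> (b \<ge> a \<and> c \<ge> a \<and> d \<ge> a)"
  proof -
    have "x \<le> Max {a, b, c, d} \<and> x \<ge> Min {a, b, c, d}" if "x \<in> {a, b, c, d}" for x
      using that by (intro conjI Max_ge Min_le) auto
    then show ?thesis using assms(6) by (metis insertCI)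
  qed
  then have "(b < a \<and> c < a \<and> d < a) \<or> (b > a \<and> c > a \<and> d > a)"
    using assms(1-5) by linarith
  then show ?thesis by auto
qed

lemma cycle4_distinct: "distinct [v, nbr j v, nbr j (nbr (j + 1) v), nbr (j + 1) v]"
proof -
  have "nbr j v $ j \<noteq> v $ j" "nbr (j + 1) v $ j = v $ j" "nbr (j + 1) v $ (j + 1) \<noteq> v $ (j + 1)"
    "nbr j (nbr (j + 1) v) $ j \<noteq> v $ j" "nbr j (nbr (j + 1) v) $ (j + 1) \<noteq> v $ (j + 1)"
    "nbr j v $ (j + 1) = v $ (j + 1)"
    by (auto simp: nbr_def)
  then show ?thesis by (simp, metis)
qed

lemma mesh_height_face_center:
  "mesh_height h (face_center j v) =
     (h v + h (nbr j v) + h (nbr j (nbr (j + 1) v)) + h (nbr (j + 1) v)) / 4"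
  using cycle4_distinct[of v j] by (simp add: face_center_def cycle4_def algebra_simps)

fun sign_path :: "real \<Rightarrow> real list \<Rightarrow> real \<Rightarrow> nat" where
  "sign_path x [] z = (if sgn x \<noteq> sgn z then 1 else 0)"
| "sign_path x (y # ys) z = (if sgn x \<noteq> sgn y then 1 else 0) + sign_path y ys z"

lemma sign_changes_Cons: "sign_changes (x # xs) = sign_path x xs x"
proof -
  have "length (filter (\<lambda>(x, y). sgn x \<noteq> sgn y) (zip (x # xs) (xs @ [z]))) = sign_path x xs z" for z
    by (induction x xs z rule: sign_path.induct) auto
  then show ?thesis by (simp add: sign_changes_def)
qed

lemma sign_path_skip:
  assumes "\<And>m. m \<in> set ms \<Longrightarrow> sgn m = sgn x \<and> sgn m = sgn y" "length ms \<le> 1"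
  shows "sign_path x (ms @ y # ys) z = (if sgn x \<noteq> sgn y then 1 else 0) + sign_path y ys z"
    "sign_path x ms y = (if sgn x \<noteq> sgn y then 1 else 0)"
proof -
  consider "ms = []" | m where "ms = [m]" "sgn m = sgn x" "sgn x = sgn y"
    using assms by (cases ms) fastforce+
  then show "sign_path x (ms @ y # ys) z = (if sgn x \<noteq> sgn y then 1 else 0) + sign_path y ys z"
    "sign_path x ms y = (if sgn x \<noteq> sgn y then 1 else 0)"
    by (cases; simp)+
qed

lemma morse_divisor_Vertex:
  assumes "height_function h"
  shows "morse_divisor h (Vertex v) = int (card {j. h (nbr j v) \<noteq> h (nbr (j + 1) v)}) div 2 - 1"
proof -
  have six: "(6 :: 5) = 1" by simp
  define x where "x j = real_of_int (h (nbr j v)) - h v" for j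
  define ms where "ms j = map (\<lambda>u. mesh_height h u - h v)
      (if bow_tie h j v then [face_center j v]
       else if h v = Max (h ` cycle4 j v) \<or> h v = Min (h ` cycle4 j v)
         then [Vertex (nbr j (nbr (j + 1) v))] else [])" for j
  define d where "d j = (if h (nbr j v) \<noteq> h (nbr (j + 1) v) then 1 else 0 :: nat)" for j
  have ms: "sgn m = sgn (x j) \<and> sgn m = sgn (x (j + 1))" if m: "m \<in> set (ms j)" for j m
  proof (cases "bow_tie h j v")
    case True
    then have "m = mesh_height h (face_center j v) - h v" using m by (simp add: ms_def)
    then show ?thesis
      using True by (rule_tac cycle4_cases[OF assms, of j v])
        (auto simp: x_def mesh_height_face_center bow_tie_iff[OF assms] sgn_if)
  next
    case False
    then have "h v = Max (h ` cycle4 j v) \<or> h v = Min (h ` cycle4 j v)"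
      and "m = real_of_int (h (nbr j (nbr (j + 1) v))) - h v"
      using m by (auto simp: ms_def split: if_splits)
    then show ?thesis
      using False extreme_sgn[of "h (nbr j v)" "h v" "h (nbr (j + 1) v)" "h (nbr j (nbr (j + 1) v))"]
      by (rule_tac cycle4_cases[OF assms, of j v])
        (simp add: x_def bow_tie_iff[OF assms] cycle4_def insert_commute)
  qed
  have len: "length (ms j) \<le> 1" for j by (simp add: ms_def)
  have d: "(if sgn (x j) \<noteq> sgn (x (j + 1)) then 1 else 0) = d j" for j
    by (rule cycle4_cases[OF assms, of j v]) (auto simp: x_def d_def)
  have steps: "sign_path (x j) (ms j @ x (j + 1) # ys) z = d j + sign_path (x (j + 1)) ys z"
    "sign_path (x j) (ms j) (x (j + 1)) = d j" for j ys z
    using sign_path_skip[OF ms len, of j] by (simp_all only: d)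
  have "map (\<lambda>u. mesh_height h u - mesh_height h (Vertex v)) (star_boundary h (Vertex v)) =
      concat (map (\<lambda>j. x j # ms j) [1, 2, 3, 4, 5])"
    by (simp only: star_boundary.simps map_concat map_map o_def list.map ms_def x_def mesh_height.simps)
  then have "morse_lambda h (Vertex v) = sign_path (x 1)
      (ms 1 @ x 2 # ms 2 @ x 3 # ms 3 @ x 4 # ms 4 @ x 5 # ms 5) (x 1)"
    by (simp add: morse_lambda_def sign_changes_Cons del: star_boundary.simps sign_path.simps)
  also have "\<dots> = d 1 + d 2 + d 3 + d 4 + d 5"
    using steps[of 1] steps[of 2] steps[of 3] steps[of 4] steps[of 5] by (simp add: six)
  also have "\<dots> = (\<Sum>j\<in>UNIV. d j)" by (simp only: sum_5)
  also have "\<dots> = card {j. h (nbr j v) \<noteq> h (nbr (j + 1) v)}"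
    by (simp add: d_def sum.If_cases)
  finally show ?thesis by (simp add: morse_divisor_def mesh_points_def)
qed

lemma morse_divisor_face_center:
  assumes "height_function h"
  shows "morse_divisor h (face_center m v) = (if bow_tie h m v then 1 else 0)"
proof (cases "bow_tie h m v")
  case True
  define w where "w = (SOME w. w \<in> cycle4 m v)"
  have "w \<in> cycle4 m v" unfolding w_def by (rule someI[of _ v]) (simp add: cycle4_def)
  then have c: "cycle4 m v = cycle4 m w"
    by (auto simp: cycle4_def nbr_nbr nbr_commute[of m "m + 1"])
  then have "bow_tie h m w" using True by (simp add: bow_tie_def)
  moreover have "morse_lambda h (face_center m v) = sign_changes (map (\<lambda>u. h u - mesh_height h (face_center m w))
      [w, nbr m w, nbr m (nbr (m + 1) w), nbr (m + 1) w])"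
    unfolding morse_lambda_def by (simp add: face_center_def Let_def w_def[symmetric] flip: c)
  ultimately have "morse_lambda h (face_center m v) = 4"
    by (rule_tac cycle4_cases[OF assms, of m w])
      (auto simp: bow_tie_iff[OF assms] mesh_height_face_center sign_changes_Cons sgn_if)
  moreover have "face_center m v \<in> mesh_points h" using True by (auto simp: mesh_points_def)
  ultimately show ?thesis using True by (simp add: morse_divisor_def)
next
  case False
  then have "face_center m v \<notin> mesh_points h"
    by (auto simp: mesh_points_def face_center_def bow_tie_def)
  then show ?thesis using False by (simp add: morse_divisor_def)
qed

lemma equiv_shift_rel: "equiv UNIV shift_rel"
proof (rule equivI)
  show "shift_rel \<subseteq> UNIV \<times> UNIV" by simp
  show "refl shift_rel" by (auto simp: refl_on_def shift_rel_def intro!: exI[of _ 0])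
  show "sym shift_rel"
  proof (rule symI)
    fix g h assume "(g, h) \<in> shift_rel"
    then obtain c where "\<forall>v. g v = h v + c" by (auto simp: shift_rel_def)
    then show "(h, g) \<in> shift_rel" by (auto simp: shift_rel_def intro!: exI[of _ "- c"])
  qed
  show "trans shift_rel"
  proof (rule transI)
    fix f g h assume "(f, g) \<in> shift_rel" "(g, h) \<in> shift_rel"
    then obtain c d where "\<forall>v. f v = g v + c" "\<forall>v. g v = h v + d" by (auto simp: shift_rel_def)
    then show "(f, h) \<in> shift_rel" by (auto simp: shift_rel_def intro!: exI[of _ "d + c"])
  qed
qed

lemma shift_invariant:
  assumes "height_function h" "(g, h) \<in> shift_rel"
  shows "height_function g" "morse_divisor g = morse_divisor h"
proof -
  obtain c where c: "\<And>v. g v = h v + c" using assms(2) by (auto simp: shift_rel_def)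
  show g: "height_function g" using assms(1) by (simp add: height_function_def c)
  have b: "bow_tie g m v = bow_tie h m v" for m v
    by (simp add: bow_tie_iff assms(1) g c)
  have m: "mesh_points g = mesh_points h" by (simp add: mesh_points_def b)
  show "morse_divisor g = morse_divisor h"
  proof
    fix p
    show "morse_divisor g p = morse_divisor h p"
    proof (cases "p \<in> mesh_points h")
      case True
      then show ?thesis
        by (auto simp: mesh_points_def morse_divisor_Vertex morse_divisor_face_center assms(1) g b c)
    next
      case False
      then show ?thesis by (simp add: morse_divisor_def m)
    qed
  qed
qed

end

theory Submission
  imports Defs
begin

text \<open>
  A reflection of the curve acts on \<open>E\<^sub>k\<close> as plus or minus complex conjugation, and conjugation sends
  \<open>e\<^sup>k\<^sub>\<infinity>\<close> to \<open>\<plusminus>e\<^sup>k\<^sub>\<infinity> + 2 e\<^sup>k\<^sub>4\<close>.  Hence the image of a vertex or face centre depends on the vertex only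
  through signs, and \<open>\<nu>\<^sub>k(D\<^sub>h)\<close> becomes an explicit combination of the three generators in which, after
  rotating the colours by \<open>k\<close>, the index \<open>k\<close> no longer occurs.  In the coefficient of \<open>e\<^sup>k\<^sub>\<infinity>\<close> everything
  cancels except one number in \<open>{-1, 0, 1}\<close> for each of the eight 2-faces with colours \<open>k + 3, k + 4\<close>,
  which bounds it by 8.  The torsion coefficients are controlled modulo 4 by comparing a diagonal of a
  2-face, which has height difference 0 or \<open>\<plusminus>2\<close>, with the sum of the heights at its ends.

  The combination is unique because \<open>e\<^sup>k\<^sub>\<infinity>\<close> has infinite order: the abscissa of its double has a pole at
  the prime 2 of \<open>\<int>[\<phi>]\<close>, and every further doubling increases the order of that pole.

  For the counts, \<open>H\<^sup>5\<close> is a 4-cycle (colours \<open>k, k + 2\<close>) of 3-cubes.  A height function is a closed walk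
  of length 4 in the graph of height functions on the 3-cube, and the coefficient of \<open>e\<^sup>k\<^sub>\<infinity>\<close> is a sum of
  weights of the four steps, so that one counts common neighbours of the first and third step by weight.
\<close>

text \<open>Sums in \<open>EC k\<close> have no meaning before associativity is known, and chord and
  tangent cases multiply quickly there; counting every incidence with multiplicity treats them
  together. The infinite order of \<open>e_inf k\<close> is not visible at the point itself, whose
  abscissa is not real. Conjugation, with a suitable sign, moves it only by a point of order 2, so
  its double has a real abscissa, and this one lies in the field of \<open>phi\<close>. Modulo 4,
  twice the number of slanted diagonals with white ends, taken over the eight 2-faces of one pair of
  consecutive colours, equals the sum of all white heights. That sum does not depend on the pair, so
  the five counts have the same parity; likewise for black. This forces both \<open>c = 0\<close>
  and \<open>b = - a\<close> modulo 4. In a closed walk of four layers the second and the fourth are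
  independent once the first and the third are fixed, so the distribution of their joint weight is a
  square and no list of all height functions is formed.\<close>

section \<open>The group law of a Legendre curve\<close>

text \<open>
  The line \<open>y = s x + t\<close> meets the curve in \<open>A\<close>, \<open>B\<close>, \<open>C\<close> with multiplicity: the first three equations
  compare coefficients in \<open>x (x - 1) (x - l) - (s x + t)\<^sup>2 = (x - fst A) (x - fst B) (x - fst C)\<close>.
\<close>

definition line_meets :: "complex \<Rightarrow> complex \<times> complex \<Rightarrow> complex \<times> complex \<Rightarrow> complex \<times> complex \<Rightarrow> complex \<Rightarrow> complex \<Rightarrow> bool" where
  "line_meets l A B C s t \<longleftrightarrow>
     fst A + fst B + fst C = 1 + l + s\<^sup>2 \<and>
     fst A * fst B + fst A * fst C + fst B * fst C = l - 2 * s * t \<and>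
     fst A * fst B * fst C = t\<^sup>2 \<and>
     snd A = s * fst A + t \<and> snd B = s * fst B + t \<and> snd C = s * fst C + t"

definition on_legendre :: "complex \<Rightarrow> complex \<times> complex \<Rightarrow> bool" where
  "on_legendre l A \<longleftrightarrow> (snd A)\<^sup>2 = fst A * (fst A - 1) * (fst A - l)"

definition flip :: "complex \<times> complex \<Rightarrow> complex \<times> complex" where
  "flip A = (fst A, - snd A)"

definition pt :: "complex \<times> complex \<Rightarrow> ec_point" where
  "pt A = Affine (fst A) (snd A)"

text \<open>The coefficient identities make the cubic agree with the square of the line at each of
  the three abscissas.\<close>

lemma line_meets_on_legendre:
  assumes "line_meets l A B C s t"
  shows "on_legendre l A" "on_legendre l B" "on_legendre l C"
  using assms unfolding line_meets_def on_legendre_def by algebra+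

lemma line_meets_permute:
  assumes "line_meets l A B C s t"
  shows "line_meets l B A C s t" "line_meets l A C B s t" "line_meets l C A B s t"
    "line_meets l B C A s t" "line_meets l C B A s t"
  using assms unfolding line_meets_def by (auto simp: algebra_simps)

lemma line_meets_flip:
  assumes "line_meets l A B C s t"
  shows "line_meets l (flip A) (flip B) (flip C) (- s) (- t)"
  using assms unfolding line_meets_def flip_def by (auto simp: algebra_simps)

lemma flip_flip [simp]: "flip (flip A) = A"
  by (simp add: flip_def)

lemma on_legendre_flip [simp]: "on_legendre l (flip A) = on_legendre l A"
  by (simp add: flip_def on_legendre_def)

lemma same_x:
  assumes "on_legendre l A" "on_legendre l B" "fst A = fst B"
  shows "B = A \<or> B = flip A"
proof -
  have "(snd A)\<^sup>2 = (snd B)\<^sup>2" using assms by (simp add: on_legendre_def)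
  then show ?thesis using assms(3) by (auto simp: power2_eq_iff flip_def prod_eq_iff)
qed

lemma ec_add_opposite: "ec_add l (pt A) (pt (flip A)) = Infty"
  by (simp add: pt_def flip_def)

lemma ec_add_line_meets:
  assumes "line_meets l A B C s t" "B \<noteq> flip A"
  shows "ec_add l (pt A) (pt B) = pt (flip C)"
proof -
  obtain x1 y1 x2 y2 x3 y3 where A: "A = (x1, y1)" and B: "B = (x2, y2)" and C: "C = (x3, y3)"
    by (meson surj_pair)
  have e: "x1 + x2 + x3 = 1 + l + s\<^sup>2" "x1 * x2 + x1 * x3 + x2 * x3 = l - 2 * s * t"
    "y1 = s * x1 + t" "y2 = s * x2 + t" "y3 = s * x3 + t"
    using assms(1) by (auto simp: line_meets_def A B C)
  have no: "\<not> (x1 = x2 \<and> y1 = - y2)" using assms(2) by (auto simp: flip_def A B)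
  have "(if x1 = x2 then (3 * x1\<^sup>2 - 2 * (1 + l) * x1 + l) / (2 * y1) else (y2 - y1) / (x2 - x1)) = s"
  proof (cases "x1 = x2")
    case True
    then have "y1 = y2" using e by simp
    then have "y1 \<noteq> 0" using no True by auto
    \<comment> \<open>The derivative of the factorization behind \<open>line_meets\<close>, taken at
      the double root \<open>x1\<close>.\<close>
    moreover have "3 * x1\<^sup>2 - 2 * (1 + l) * x1 + l = s * (2 * y1)" using e True by algebra
    ultimately show ?thesis using True by simp
  next
    case False
    moreover have "y2 - y1 = s * (x2 - x1)" using e by algebra
    ultimately show ?thesis by simp
  qed
  then have "ec_add l (pt A) (pt B) =
      Affine (s\<^sup>2 + (1 + l) - x1 - x2) (s * (x1 - (s\<^sup>2 + (1 + l) - x1 - x2)) - y1)"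
    by (simp only: A B pt_def fst_conv snd_conv ec_add.simps no if_False Let_def)
  moreover have x3: "s\<^sup>2 + (1 + l) - x1 - x2 = x3" using e(1) by algebra
  moreover have "s * (x1 - x3) - y1 = - y3" using e by algebra
  ultimately show ?thesis by (simp only: x3 C pt_def flip_def fst_conv snd_conv)
qed

lemma line_meets_exists:
  assumes "on_legendre l A" "on_legendre l B" "B \<noteq> flip A"
  shows "\<exists>C s t. line_meets l A B C s t"
proof -
  obtain x1 y1 x2 y2 where A: "A = (x1, y1)" and B: "B = (x2, y2)"
    by (meson surj_pair)
  have c: "y1\<^sup>2 = x1 * (x1 - 1) * (x1 - l)" "y2\<^sup>2 = x2 * (x2 - 1) * (x2 - l)"
    using assms by (auto simp: on_legendre_def A B)
  define s where "s = (if x1 = x2 then (3 * x1\<^sup>2 - 2 * (1 + l) * x1 + l) / (2 * y1) else (y2 - y1) / (x2 - x1))"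
  define t where "t = y1 - s * x1"
  define x3 where "x3 = 1 + l + s\<^sup>2 - x1 - x2"
  \<comment> \<open>The left side of \<open>q\<close> is the divided difference at
    \<open>x1\<close>, \<open>x2\<close> of the cubic minus the squared line. It vanishes because
    both abscissas are roots or, when they agree, because it is the derivative there and the slope
    is that of the tangent.\<close>
  have y2: "y2 = s * x2 + t"
    and q: "x1\<^sup>2 + x1 * x2 + x2\<^sup>2 - (1 + l + s\<^sup>2) * (x1 + x2) + (l - 2 * s * t) = 0"
  proof -
    show "y2 = s * x2 + t"
      using same_x[OF assms(1,2)] assms(3) by (auto simp: s_def t_def A B field_simps)
    show "x1\<^sup>2 + x1 * x2 + x2\<^sup>2 - (1 + l + s\<^sup>2) * (x1 + x2) + (l - 2 * s * t) = 0"
    proof (cases "x1 = x2")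
      case True
      then have "y1 = y2" using same_x[OF assms(1,2)] assms(3) by (auto simp: A B)
      then have "y1 \<noteq> 0" using True assms(3) by (auto simp: A B flip_def)
      then have "s * (2 * y1) = 3 * x1\<^sup>2 - 2 * (1 + l) * x1 + l" using True by (simp add: s_def)
      then show ?thesis using True t_def by algebra
    next
      case False
      have "(x1 - x2) * (x1\<^sup>2 + x1 * x2 + x2\<^sup>2 - (1 + l + s\<^sup>2) * (x1 + x2) + (l - 2 * s * t)) = 0"
        using c \<open>y2 = s * x2 + t\<close> t_def by algebra
      then show ?thesis using False by simp
    qed
  qed
  have "line_meets l A B (x3, s * x3 + t) s t"
    using c y2 q t_def unfolding line_meets_def A B fst_conv snd_conv x3_def
    by (intro conjI) (algebra | rule refl)+
  then show ?thesis by blast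
qed

text \<open>The line has a finite slope, so opposite points on it coincide and have ordinate 0. The
  cubic would then have a double root, but 0, 1 and \<open>l\<close> are distinct.\<close>

lemma line_meets_not_opposite:
  assumes "line_meets l A B C s t" "l \<noteq> 0" "l \<noteq> 1"
  shows "B \<noteq> flip A"
proof
  assume "B = flip A"
  then obtain x y where A: "A = (x, y)" and B: "B = (x, - y)"
    by (metis flip_def fst_conv snd_conv surj_pair)
  have e: "x + x + fst C = 1 + l + s\<^sup>2" "x * x + x * fst C + x * fst C = l - 2 * s * t"
    "y = s * x + t" "- y = s * x + t"
    using assms(1) by (auto simp: line_meets_def A B)
  have y: "y = 0" using e(3,4) by algebra
  have "3 * x\<^sup>2 - 2 * (1 + l) * x + l = 0" using e y by algebra
  moreover have "x * (x - 1) * (x - l) = 0"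
    using line_meets_on_legendre(1)[OF assms(1)] y by (simp add: on_legendre_def A)
  then have "x = 0 \<or> x = 1 \<or> x = l" by simp
  ultimately show False using assms(2,3)
    by (elim disjE) (auto simp: algebra_simps power2_eq_square)
qed

section \<open>Associativity by a parabola through three points\<close>

definition cubic :: "complex \<Rightarrow> complex poly" where
  "cubic l = [:0, l, - (1 + l), 1:]"

text \<open>
  The same for the curve \<open>\<beta> y = Q(x)\<close>.  It arises from two lines \<open>L\<close>, \<open>M\<close> through opposite points with
  abscissa \<open>d\<close> as \<open>(y - L) (y - M) = (x - d) (Q - \<beta> y)\<close>.
\<close>

definition parabola_meets :: "complex \<Rightarrow> (complex \<times> complex) list \<Rightarrow> complex poly \<Rightarrow> complex \<Rightarrow> bool" where
  "parabola_meets l As Q \<beta> \<longleftrightarrow> degree Q = 2 \<and> coeff Q 2 = 1 \<and>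
     Q\<^sup>2 - smult (\<beta>\<^sup>2) (cubic l) = (\<Prod>A\<leftarrow>As. [:- fst A, 1:]) \<and>
     (\<forall>A\<in>set As. poly Q (fst A) = \<beta> * snd A)"

text \<open>\<open>D\<close> is the sum of \<open>A\<close> and \<open>B\<close>, and
  \<open>flip F\<close> is the sum of \<open>D\<close> and \<open>C\<close>. If
  \<open>\<beta> = 0\<close>, the second line is the mirror image of the first, so it meets the
  curve in the mirror images of \<open>A\<close> and \<open>B\<close> besides
  \<open>D\<close>.\<close>

lemma line_pair_parabola:
  assumes AB: "line_meets l A B (flip D) s t" and DC: "line_meets l D C F s' t'"
  defines "\<beta> \<equiv> s + s'"
  defines "Q \<equiv> [:- fst A, 1:] * [:- fst B, 1:] + smult \<beta> [:t, s:]"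
  shows "parabola_meets l [A, B, C, F] Q \<beta>"
    "\<beta> = 0 \<Longrightarrow> C = flip A \<or> C = flip B"
proof -
  obtain a ya b yb c yc d yd e ye where A: "A = (a, ya)" and B: "B = (b, yb)" and C: "C = (c, yc)"
    and D: "D = (d, yd)" and F: "F = (e, ye)" by (meson surj_pair)
  have 1: "a + b + d = 1 + l + s\<^sup>2" "a * b + a * d + b * d = l - 2 * s * t" "a * b * d = t\<^sup>2"
    "ya = s * a + t" "yb = s * b + t" "- yd = s * d + t"
    using AB by (auto simp: line_meets_def A B D flip_def)
  have 2: "d + c + e = 1 + l + s'\<^sup>2" "d * c + d * e + c * e = l - 2 * s' * t'" "d * c * e = t'\<^sup>2"
    "yd = s' * d + t'" "yc = s' * c + t'" "ye = s' * e + t'"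
    using DC by (auto simp: line_meets_def C D F)
  have Q: "Q = [:a * b + \<beta> * t, \<beta> * s - a - b, 1:]"
    by (simp add: Q_def A B)
  \<comment> \<open>\<open>Q\<close> is symmetric in the two lines; this second form gives its
    values at \<open>C\<close> and \<open>F\<close>.\<close>
  have Q': "Q = [:c * e + \<beta> * t', \<beta> * s' - c - e, 1:]"
  proof -
    have "a * b + \<beta> * t = c * e + \<beta> * t'" "\<beta> * s - a - b = \<beta> * s' - c - e"
      using 1 2 unfolding \<beta>_def by algebra+
    then show ?thesis by (simp add: Q)
  qed
  define L M u where "L = [:t, s:]" and "M = [:t', s':]" and "u = [:\<beta>:]"
  \<comment> \<open>The lines pass through opposite points at abscissa \<open>d\<close>, so their
    sum vanishes there.\<close>
  have LM: "u * [:- d, 1:] = L + M"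
  proof -
    have "- (\<beta> * d) = t + t'" using 1(6) 2(4) unfolding \<beta>_def by algebra
    then show ?thesis by (simp add: L_def M_def u_def \<beta>_def mult.commute del: minus_mult_left)
  qed
  have f: "cubic l - L\<^sup>2 = [:- a, 1:] * [:- b, 1:] * [:- d, 1:]"
    using 1(1-3) by (simp add: cubic_def L_def power2_eq_square) algebra
  have e: "Q = [:- a, 1:] * [:- b, 1:] + u * L" "Q = [:- c, 1:] * [:- e, 1:] + u * M"
    by (simp add: Q_def A B L_def u_def, simp add: Q' M_def u_def)
  \<comment> \<open>The right side is \<open>(Q - u L) (Q - u M)\<close> by \<open>e\<close>, while
    \<open>f\<close> and \<open>LM\<close> give \<open>Q (x - d) = cubic l + L M\<close>.\<close>
  have "Q\<^sup>2 - u\<^sup>2 * cubic l = [:- a, 1:] * [:- b, 1:] * [:- c, 1:] * [:- e, 1:]"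
    using LM f e by algebra
  moreover have "u\<^sup>2 * cubic l = smult (\<beta>\<^sup>2) (cubic l)"
    by (simp add: u_def power2_eq_square)
  ultimately have "Q\<^sup>2 - smult (\<beta>\<^sup>2) (cubic l) = (\<Prod>A\<leftarrow>[A, B, C, F]. [:- fst A, 1:])"
    by (simp only: A B C F list.map prod_list.Cons prod_list.Nil fst_conv mult.assoc mult_1_right)
  moreover have "poly Q (fst P) = \<beta> * snd P" if "P \<in> set [A, B, C, F]" for P
  proof -
    have "poly Q a = \<beta> * ya" "poly Q b = \<beta> * yb"
      unfolding e(1) using 1(4,5) by (simp_all add: L_def u_def algebra_simps)
    moreover have "poly Q c = \<beta> * yc" "poly Q e = \<beta> * ye"
      unfolding e(2) using 2(5,6) by (simp_all add: M_def u_def algebra_simps)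
    ultimately show ?thesis using that by (auto simp: A B C F)
  qed
  moreover have "degree Q = 2" "coeff Q 2 = 1" by (simp_all add: Q numeral_2_eq_2)
  ultimately show "parabola_meets l [A, B, C, F] Q \<beta>"
    unfolding parabola_meets_def by blast
  show "C = flip A \<or> C = flip B" if "\<beta> = 0"
  proof -
    have "u = 0" using that by (simp add: u_def)
    then have "[:- a, 1:] * [:- b, 1:] = [:- c, 1:] * [:- e, 1:]" using e by simp
    then have "poly ([:- a, 1:] * [:- b, 1:]) c = poly ([:- c, 1:] * [:- e, 1:]) c" by simp
    then have "(c - a) * (c - b) = 0" by (simp only: poly_mult) simp
    moreover have "yc = - (s * c + t)" using that 1(6) 2(4,5) unfolding \<beta>_def by algebra
    ultimately show ?thesis using 1(4,5) by (auto simp: A B C flip_def)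
  qed
qed

lemma parabola_meets_permute:
  "parabola_meets l As Q \<beta> \<Longrightarrow> mset As = mset Bs \<Longrightarrow> parabola_meets l Bs Q \<beta>"
  unfolding parabola_meets_def prod_mset_prod_list[symmetric] mset_map by (auto dest: mset_eq_setD)

lemma linear_dvd_mult_root:
  fixes U V :: "complex poly"
  assumes "[:- a, 1:] dvd U * V" "poly U a = 0 \<or> poly V a \<noteq> 0"
  shows "[:- a, 1:] dvd U"
  using assms by (auto simp: dvd_iff_poly_eq_0)

text \<open>
  The product of the two combinations \<open>\<beta>' Q \<mp> \<beta> Q'\<close> is divisible by the linear factors at \<open>A\<close>,
  \<open>B\<close>, \<open>C\<close>, while the second one vanishes at such a point only if the point is 2-torsion.  Hence the
  first one, of degree at most 2, has three zeros counted with multiplicity and vanishes.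
\<close>

lemma parabola_unique:
  assumes Q: "parabola_meets l [A, B, C, F] Q \<beta>" "\<beta> \<noteq> 0"
    and Q': "parabola_meets l [A, B, C, F'] Q' \<beta>'" "\<beta>' \<noteq> 0"
    and on: "on_legendre l A" "on_legendre l B" "on_legendre l C"
    and no: "B \<noteq> flip A" "C \<noteq> flip A" "C \<noteq> flip B"
  shows "F = F'"
proof -
  define a b c where abc: "a = fst A" "b = fst B" "c = fst C"
  define W V where "W = smult \<beta>' Q - smult \<beta> Q'" and "V = smult \<beta>' Q + smult \<beta> Q'"
  define R where "R = smult (\<beta>'\<^sup>2) [:- fst F, 1:] - smult (\<beta>\<^sup>2) [:- fst F', 1:]"
  have n: "Q\<^sup>2 - smult (\<beta>\<^sup>2) (cubic l) = [:- a, 1:] * [:- b, 1:] * [:- c, 1:] * [:- fst F, 1:]"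
    "Q'\<^sup>2 - smult (\<beta>'\<^sup>2) (cubic l) = [:- a, 1:] * [:- b, 1:] * [:- c, 1:] * [:- fst F', 1:]"
    using Q(1) Q'(1) unfolding parabola_meets_def abc
    by (simp_all only: list.map prod_list.Cons prod_list.Nil mult.assoc mult_1_right)
  have "W * V = smult (\<beta>'\<^sup>2) (Q\<^sup>2) - smult (\<beta>\<^sup>2) (Q'\<^sup>2)"
    by (simp add: W_def V_def algebra_simps power2_eq_square)
  also have "\<dots> = smult (\<beta>'\<^sup>2) (Q\<^sup>2 - smult (\<beta>\<^sup>2) (cubic l)) - smult (\<beta>\<^sup>2) (Q'\<^sup>2 - smult (\<beta>'\<^sup>2) (cubic l))"
    by (simp add: smult_diff_right mult.commute)
  also have "\<dots> = [:- a, 1:] * [:- b, 1:] * [:- c, 1:] * R"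
    unfolding n R_def by (simp only: mult_smult_right right_diff_distrib)
  finally have WV: "[:- a, 1:] * ([:- b, 1:] * ([:- c, 1:] * R)) = W * V"
    by (simp only: mult.assoc)
  have W0: "poly W (fst P) = 0" and V0: "snd P \<noteq> 0 \<Longrightarrow> poly V (fst P) \<noteq> 0" if "P \<in> {A, B, C}" for P
  proof -
    have "poly Q (fst P) = \<beta> * snd P" "poly Q' (fst P) = \<beta>' * snd P"
      using Q(1) Q'(1) that by (auto simp: parabola_meets_def)
    then show "poly W (fst P) = 0" "snd P \<noteq> 0 \<Longrightarrow> poly V (fst P) \<noteq> 0"
      using Q(2) Q'(2) by (simp_all add: W_def V_def)
  qed
  have y: "snd P \<noteq> 0" if "on_legendre l P" "on_legendre l P'" "fst P = fst P'" "P' \<noteq> flip P" for P P'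
    using same_x[OF that(1-3)] that(4) by (auto simp: flip_def prod_eq_iff)
  obtain U1 where U1: "W = [:- a, 1:] * U1"
    using W0[of A] unfolding abc by (metis dvdE insertI1 minus_minus dvd_iff_poly_eq_0)
  then have WV1: "[:- b, 1:] * ([:- c, 1:] * R) = U1 * V"
    using WV by (metis (no_types, lifting) mult.assoc mult_cancel_left pCons_eq_0_iff zero_neq_one)
  \<comment> \<open>If the abscissas differ, the zero of \<open>W\<close> at \<open>b\<close> passes
    to the quotient \<open>U1\<close>. If they agree, the two points coincide outside the 2-torsion,
    where \<open>V\<close> does not vanish.\<close>
  have "poly U1 b = 0 \<or> poly V b \<noteq> 0"
  proof (cases "a = b")
    case True
    then show ?thesis using y[of A B] on no V0[of B] V0[of A] by (auto simp: abc)
  next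
    case False
    then show ?thesis using W0[of B] by (simp add: U1 flip: abc)
  qed
  then have "[:- b, 1:] dvd U1" by (rule linear_dvd_mult_root[rotated]) (metis WV1 dvd_triv_left)
  then obtain U2 where U2: "U1 = [:- b, 1:] * U2" by (elim dvdE)
  then have WV2: "[:- c, 1:] * R = U2 * V"
    using WV1 by (metis (no_types, lifting) mult.assoc mult_cancel_left pCons_eq_0_iff zero_neq_one)
  have "poly U2 c = 0 \<or> poly V c \<noteq> 0"
  proof (cases "a = c \<or> b = c")
    case True
    moreover have "A \<noteq> flip C" "B \<noteq> flip C" using no by auto
    ultimately show ?thesis using y[of C A] y[of C B] on no V0[of C] by (auto simp: abc)
  next
    case False
    then show ?thesis using W0[of C] by (auto simp: U1 U2 simp flip: abc)
  qed
  then have "[:- c, 1:] dvd U2" by (rule linear_dvd_mult_root[rotated]) (metis WV2 dvd_triv_left)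
  then obtain U3 where U3: "W = [:- a, 1:] * [:- b, 1:] * [:- c, 1:] * U3"
    unfolding U1 U2 by (metis dvdE mult.assoc)
  have "W = 0"
  proof (rule ccontr)
    assume "W \<noteq> 0"
    then have "degree W = degree ([:- a, 1:] * [:- b, 1:] * [:- c, 1:]) + degree U3"
      unfolding U3 by (intro degree_mult_eq) auto
    also have "degree ([:- a, 1:] * [:- b, 1:] * [:- c, 1:]) = 3" by simp
    finally have "degree W \<ge> 3" by simp
    moreover have "degree W \<le> 2"
      using Q(1) Q'(1) unfolding W_def parabola_meets_def
      by (intro degree_diff_le order.trans[OF degree_smult_le]) auto
    ultimately show False by simp
  qed
  \<comment> \<open>\<open>Q\<close> and \<open>Q'\<close> are monic quadratics, so their leading
    coefficients already give equality of the two scalars.\<close>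
  then have "coeff (smult \<beta>' Q) 2 = coeff (smult \<beta> Q') 2" by (simp add: W_def)
  then have \<beta>: "\<beta> = \<beta>'" using Q(1) Q'(1) by (simp add: parabola_meets_def)
  then have "smult \<beta> (Q - Q') = 0" using \<open>W = 0\<close> by (simp add: W_def smult_diff_right)
  then have QQ: "Q = Q'" using Q(2) by simp
  have "[:- a, 1:] * [:- b, 1:] * [:- c, 1:] \<noteq> 0" by (simp only: mult_eq_0_iff) simp
  then have "[:- fst F, 1:] = [:- fst F', 1:]"
    using n unfolding \<beta> QQ by (metis mult_left_cancel)
  then have "fst F = fst F'" by simp
  moreover have "poly Q (fst F) = \<beta> * snd F" "poly Q' (fst F') = \<beta>' * snd F'"
    using Q(1) Q'(1) unfolding parabola_meets_def by auto
  then have "\<beta> * snd F = \<beta> * snd F'"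
    using \<open>fst F = fst F'\<close> unfolding \<beta> QQ by metis
  ultimately show ?thesis using Q(2) by (simp add: prod_eq_iff)
qed


text \<open>Both bracketings add up to the fourth intersection with the same parabola through three points.\<close>

lemma ec_add_assoc_line:
  assumes l: "l \<noteq> 0" "l \<noteq> 1"
    and AB: "line_meets l A B (flip D) s t" and DC: "line_meets l D C F s' t'"
    and BC: "line_meets l B C (flip E) u v" and EA: "line_meets l E A F' u' v'"
    and CA: "C \<noteq> flip A"
  shows "F = F'"
proof -
  have no: "B \<noteq> flip A" "C \<noteq> flip B"
    using line_meets_not_opposite[OF AB l] line_meets_not_opposite[OF BC l] by auto
  have 1: "\<exists>Q \<beta>. parabola_meets l [A, B, C, F] Q \<beta> \<and> \<beta> \<noteq> 0"
    using line_pair_parabola[OF AB DC] no CA by blast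
  have "\<exists>Q \<beta>. parabola_meets l [B, C, A, F'] Q \<beta> \<and> \<beta> \<noteq> 0"
    using line_pair_parabola[OF BC EA] no CA flip_flip by metis
  moreover have "mset [B, C, A, F'] = mset [A, B, C, F']" by simp
  ultimately have 2: "\<exists>Q \<beta>. parabola_meets l [A, B, C, F'] Q \<beta> \<and> \<beta> \<noteq> 0"
    using parabola_meets_permute by blast
  show ?thesis
    using parabola_unique 1 2 line_meets_on_legendre[OF AB] line_meets_on_legendre[OF BC] no CA by metis
qed

section \<open>The abelian group of a Legendre curve\<close>

definition legendre_points :: "complex \<Rightarrow> ec_point set" where
  "legendre_points l = insert Infty (pt ` {A. on_legendre l A})"

lemma carrier_legendre_group: "carrier (legendre_group l) = legendre_points l"
  by (force simp: legendre_group_def legendre_points_def pt_def on_legendre_def image_iff)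

lemma legendre_points_cases:
  assumes "P \<in> legendre_points l"
  obtains "P = Infty" | A where "P = pt A" "on_legendre l A"
  using assms by (auto simp: legendre_points_def)

lemma ec_add_Infty_right [simp]: "ec_add l P Infty = P"
  by (cases P) auto

context
  fixes l :: complex
  assumes l: "l \<noteq> 0" "l \<noteq> 1"
begin

lemma ec_add_cases:
  assumes "on_legendre l A" "on_legendre l B"
  obtains "B = flip A" "ec_add l (pt A) (pt B) = Infty"
  | D s t where "B \<noteq> flip A" "on_legendre l D" "line_meets l A B (flip D) s t"
      "ec_add l (pt A) (pt B) = pt D"
proof (cases "B = flip A")
  case True
  then show ?thesis using that(1) ec_add_opposite by blast
next
  case False
  obtain C s t where C: "line_meets l A B C s t" using line_meets_exists[OF assms False] by blast
  show ?thesis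
    using that(2)[of "flip C" s t] False C ec_add_line_meets[OF C False] line_meets_on_legendre(3)[OF C]
    by simp
qed

lemma ec_add_commute:
  assumes "P \<in> legendre_points l" "Q \<in> legendre_points l"
  shows "ec_add l P Q = ec_add l Q P"
proof -
  have "ec_add l (pt A) (pt B) = ec_add l (pt B) (pt A)" if "on_legendre l A" "on_legendre l B" for A B
    using that
  proof (cases rule: ec_add_cases)
    case (2 D s t)
    have "A \<noteq> flip B" using 2(1) by auto
    then show ?thesis using ec_add_line_meets[OF line_meets_permute(1)[OF 2(3)]] 2(4) by simp
  qed (use ec_add_opposite[of l B] in simp)
  then show ?thesis using assms by (auto elim!: legendre_points_cases)
qed

lemma ec_add_closed:
  assumes "P \<in> legendre_points l" "Q \<in> legendre_points l"
  shows "ec_add l P Q \<in> legendre_points l"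
proof -
  have "ec_add l (pt A) (pt B) \<in> legendre_points l" if "on_legendre l A" "on_legendre l B" for A B
    using that by (cases rule: ec_add_cases) (auto simp: legendre_points_def)
  then show ?thesis
    using assms by (elim legendre_points_cases) (auto simp: legendre_points_def)
qed

lemma line_meets_unique_third:
  assumes "line_meets l A B C s t" "line_meets l A B C' s' t'"
  shows "C = C'"
  using ec_add_line_meets[OF assms(1)] ec_add_line_meets[OF assms(2)] line_meets_not_opposite[OF assms(1) l]
  by (auto simp: pt_def flip_def prod_eq_iff)

text \<open>Flipping the line through \<open>A\<close>, \<open>B\<close>, \<open>flip D\<close> puts
  \<open>D\<close>, \<open>flip A\<close>, \<open>flip B\<close> on one line.\<close>

lemma ec_add_cancel:
  assumes "on_legendre l A" "on_legendre l B"
  shows "ec_add l (ec_add l (pt A) (pt B)) (pt (flip A)) = pt B"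
  using assms
proof (cases rule: ec_add_cases)
  case (2 D s t)
  have *: "line_meets l D (flip A) (flip B) (- s) (- t)"
    using line_meets_permute(3)[OF line_meets_flip[OF 2(3)]] by simp
  show ?thesis
    using ec_add_line_meets[OF *] line_meets_not_opposite[OF * l] 2(4) by simp
qed simp

text \<open>In this cyclic form both sides are the same construction applied to rotated arguments,
  so both end on a parabola through the same three points; commutativity turns it into
  associativity. Opposite pairs are treated first, because they may make the parabola
  degenerate.\<close>

lemma ec_add_assoc_pt:
  assumes A: "on_legendre l A" and B: "on_legendre l B" and C: "on_legendre l C"
  shows "ec_add l (ec_add l (pt A) (pt B)) (pt C) = ec_add l (ec_add l (pt B) (pt C)) (pt A)"
proof (cases "C = flip A")
  case True
  have "ec_add l (pt B) (pt (flip A)) = ec_add l (pt (flip A)) (pt B)"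
    using A B by (intro ec_add_commute) (auto simp: legendre_points_def)
  then show ?thesis
    using ec_add_cancel[OF A B] ec_add_cancel[of "flip A" B] A B True by simp
next
  case CA: False
  show ?thesis
    using A B
  proof (cases rule: ec_add_cases)
    case 1
    have "ec_add l (pt (flip A)) (pt C) = ec_add l (pt C) (pt (flip A))"
      using A C by (intro ec_add_commute) (auto simp: legendre_points_def)
    moreover have "ec_add l (ec_add l (pt (flip A)) (pt C)) (pt A) = pt C"
      using ec_add_cancel[of "flip A" C] A C by simp
    ultimately show ?thesis using 1 by simp
  next
    case AB: (2 D s t)
    show ?thesis
      using B C
    proof (cases rule: ec_add_cases)
      case 1
      have "ec_add l (pt A) (pt B) = ec_add l (pt B) (pt A)"
        using A B by (intro ec_add_commute) (auto simp: legendre_points_def)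
      then show ?thesis using ec_add_cancel[OF B A] 1 by simp
    next
      case BC: (2 E u v)
      \<comment> \<open>Each condition says that \<open>A\<close>, \<open>B\<close>,
        \<open>C\<close> are the three intersections with one line, so either both sides are
        \<open>Infty\<close> or neither is.\<close>
      have DE: "C = flip D \<longleftrightarrow> A = flip E"
      proof
        assume "C = flip D"
        then have "line_meets l B C A s t" using AB(3) line_meets_permute(4) by blast
        then show "A = flip E" using line_meets_unique_third BC(3) by blast
      next
        assume "A = flip E"
        then have "line_meets l A B C u v" using BC(3) line_meets_permute(3) by blast
        then show "C = flip D" using line_meets_unique_third AB(3) by blast
      qed
      show ?thesis
        using AB(2) C
      proof (cases rule: ec_add_cases)
        case 1
        then show ?thesis using DE AB(4) BC(4) ec_add_opposite[of l E] by simp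
      next
        case DC: (2 F s' t')
        show ?thesis
          using BC(2) A
        proof (cases rule: ec_add_cases)
          case 1
          then show ?thesis using DE DC(1) by simp
        next
          case EA: (2 F' u' v')
          have "flip F = flip F'"
            by (rule ec_add_assoc_line[OF l AB(3) DC(3) BC(3) EA(3) CA])
          then show ?thesis using AB(4) BC(4) DC(4) EA(4) by (metis flip_flip)
        qed
      qed
    qed
  qed
qed

lemma comm_group_legendre_group: "comm_group (legendre_group l)"
proof (rule comm_groupI; unfold carrier_legendre_group)
  have sel: "mult (legendre_group l) = ec_add l" "one (legendre_group l) = Infty"
    by (simp_all add: legendre_group_def)
  fix P Q R
  assume P: "P \<in> legendre_points l" and Q: "Q \<in> legendre_points l"
  show "P \<otimes>\<^bsub>legendre_group l\<^esub> Q \<in> legendre_points l"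
    and comm: "P \<otimes>\<^bsub>legendre_group l\<^esub> Q = Q \<otimes>\<^bsub>legendre_group l\<^esub> P"
    unfolding sel using ec_add_closed ec_add_commute P Q by blast+
  show "\<exists>y\<in>legendre_points l. y \<otimes>\<^bsub>legendre_group l\<^esub> P = \<one>\<^bsub>legendre_group l\<^esub>"
    using P
  proof (cases rule: legendre_points_cases)
    case (2 A)
    then show ?thesis
      using ec_add_opposite[of l "flip A"] unfolding sel legendre_points_def
      by (intro bexI[of _ "pt (flip A)"]) auto
  qed (simp add: sel legendre_points_def)
  assume R: "R \<in> legendre_points l"
  have "ec_add l (ec_add l P Q) R = ec_add l (ec_add l Q R) P"
    using P
  proof (cases rule: legendre_points_cases)
    case 1
    then show ?thesis by simp
  next
    case A: (2 A)
    show ?thesis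
      using Q
    proof (cases rule: legendre_points_cases)
      case 1
      then show ?thesis using ec_add_commute[OF P R] by simp
    next
      case B: (2 B)
      show ?thesis
        using R
      proof (cases rule: legendre_points_cases)
        case 1
        then show ?thesis using ec_add_commute[OF P Q] by simp
      next
        case C: (2 C)
        then show ?thesis using A B ec_add_assoc_pt by simp
      qed
    qed
  qed
  also have "\<dots> = ec_add l P (ec_add l Q R)"
    using P Q R by (intro ec_add_commute ec_add_closed)
  finally show "P \<otimes>\<^bsub>legendre_group l\<^esub> Q \<otimes>\<^bsub>legendre_group l\<^esub> R =
      P \<otimes>\<^bsub>legendre_group l\<^esub> (Q \<otimes>\<^bsub>legendre_group l\<^esub> R)"
    by (simp add: sel)
qed (auto simp: legendre_group_def legendre_points_def)

end

section \<open>Points of infinite order\<close>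

lemma ec_add_double:
  assumes "on_legendre l (x, y)" "y \<noteq> 0"
  shows "\<exists>y'. ec_add l (Affine x y) (Affine x y) =
    Affine ((x\<^sup>2 - l)\<^sup>2 / (4 * (x * (x - 1) * (x - l)))) y'"
proof -
  define s where "s = (3 * x\<^sup>2 - 2 * (1 + l) * x + l) / (2 * y)"
  have y2: "y\<^sup>2 = x * (x - 1) * (x - l)" using assms(1) by (simp add: on_legendre_def)
  have "s * (2 * y) = 3 * x\<^sup>2 - 2 * (1 + l) * x + l" using assms(2) by (simp add: s_def)
  then have "(s\<^sup>2 + (1 + l) - x - x) * (4 * y\<^sup>2) = (x\<^sup>2 - l)\<^sup>2" using y2 by algebra
  then have x3: "s\<^sup>2 + (1 + l) - x - x = (x\<^sup>2 - l)\<^sup>2 / (4 * (x * (x - 1) * (x - l)))"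
  proof -
    have "4 * y\<^sup>2 \<noteq> 0" using assms(2) by simp
    then show ?thesis
      using \<open>(s\<^sup>2 + (1 + l) - x - x) * (4 * y\<^sup>2) = (x\<^sup>2 - l)\<^sup>2\<close>
      unfolding y2[symmetric] by (metis nonzero_eq_divide_eq)
  qed
  have no: "y \<noteq> - y" using assms(2) by simp
  then have "ec_add l (Affine x y) (Affine x y) =
      Affine (s\<^sup>2 + (1 + l) - x - x) (s * (x - (s\<^sup>2 + (1 + l) - x - x)) - y)"
    by (simp only: ec_add.simps simp_thms if_False if_True Let_def s_def)
  then show ?thesis unfolding x3 by blast
qed

section \<open>Valuation at the prime 2 of \<int>[\<phi>]\<close>

definition phi_integer :: "complex \<Rightarrow> bool" where
  "phi_integer z \<longleftrightarrow> (\<exists>a b. z = of_int a + of_int b * of_real phi)"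

text \<open>The elements of \<int>[\<phi>] not divisible by 2, that is, of valuation 0 at the prime
  2.\<close>

definition phi_odd :: "complex \<Rightarrow> bool" where
  "phi_odd z \<longleftrightarrow> (\<exists>a b. z = of_int a + of_int b * of_real phi \<and> (odd a \<or> odd b))"

lemma phi_square_complex: "(complex_of_real phi)\<^sup>2 = of_real phi + 1"
  using phi_square by (metis of_real_1 of_real_add of_real_power)

lemma phi_odd_integer: "phi_odd z \<Longrightarrow> phi_integer z"
  by (auto simp: phi_integer_def phi_odd_def)

lemma phi_integer_mult:
  assumes "phi_integer w" "phi_integer z"
  shows "phi_integer (w * z)"
proof -
  obtain a b c d :: int where "w = of_int a + of_int b * of_real phi" "z = of_int c + of_int d * of_real phi"
    using assms unfolding phi_integer_def by blast
  then have "w * z = of_int (a * c + b * d) + of_int (a * d + b * c + b * d) * of_real phi"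
    using phi_square_complex unfolding of_int_add of_int_mult by algebra
  then show ?thesis unfolding phi_integer_def by blast
qed

text \<open>2 is inert in \<open>\<int>[\<phi>]\<close>, so the odd elements are closed under multiplication.\<close>

lemma phi_odd_mult:
  assumes "phi_odd w" "phi_odd z"
  shows "phi_odd (w * z)"
proof -
  obtain a b c d :: int where wz: "w = of_int a + of_int b * of_real phi" "z = of_int c + of_int d * of_real phi"
    and o: "odd a \<or> odd b" "odd c \<or> odd d"
    using assms unfolding phi_odd_def by blast
  have "w * z = of_int (a * c + b * d) + of_int (a * d + b * c + b * d) * of_real phi"
    using wz phi_square_complex unfolding of_int_add of_int_mult by algebra
  moreover have "odd (a * c + b * d) \<or> odd (a * d + b * c + b * d)" using o by auto
  ultimately show ?thesis unfolding phi_odd_def by blast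
qed

lemma phi_odd_diff_even:
  assumes "phi_odd w" "phi_integer z"
  shows "phi_odd (w - 2 * z)"
proof -
  obtain a b c d :: int where wz: "w = of_int a + of_int b * of_real phi" "z = of_int c + of_int d * of_real phi"
    and o: "odd a \<or> odd b"
    using assms unfolding phi_odd_def phi_integer_def by blast
  have "w - 2 * z = of_int (a - 2 * c) + of_int (b - 2 * d) * of_real phi"
    using wz by (simp add: algebra_simps)
  moreover have "odd (a - 2 * c) \<or> odd (b - 2 * d)" using o by auto
  ultimately show ?thesis unfolding phi_odd_def by blast
qed

text \<open>The norm \<open>a^2 + a b - b^2\<close> is odd unless \<open>a\<close> and
  \<open>b\<close> are both even.\<close>

lemma phi_odd_nonzero: "phi_odd z \<Longrightarrow> z \<noteq> 0"
proof
  assume "phi_odd z" "z = 0"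
  then obtain a b :: int where 0: "of_int a + of_int b * complex_of_real phi = 0" and o: "odd a \<or> odd b"
    unfolding phi_odd_def by metis
  have "complex_of_int (a * a + a * b - b * b) = 0"
    using 0 phi_square_complex unfolding of_int_add of_int_diff of_int_mult by algebra
  then have "a * a + a * b - b * b = 0" by (simp only: of_int_eq_0_iff)
  then have "even (a * a + a * b - b * b)" by simp
  then show False using o by auto
qed

lemma phi_integer_of_int: "phi_integer (of_int a)"
  unfolding phi_integer_def by (intro exI[of _ a] exI[of _ 0]) simp

lemma phi_integer_2: "phi_integer 2"
  using phi_integer_of_int[of 2] by simp

lemma phi_integer_power4: "phi_integer (4 ^ n)"
  using phi_integer_of_int[of "4 ^ n"] by simp

text \<open>The valuation of \<open>x\<close> at 2 is exactly \<open>-2 n\<close>. Powers of 4 match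
  the factor 4 in the denominator of the duplication formula.\<close>

definition two_adic_pole :: "nat \<Rightarrow> complex \<Rightarrow> bool" where
  "two_adic_pole n x \<longleftrightarrow> (\<exists>\<alpha> \<beta>. phi_odd \<alpha> \<and> phi_odd \<beta> \<and> x = \<alpha> / (4 ^ n * \<beta>))"

lemma two_adic_pole_unique:
  assumes "two_adic_pole m x" "two_adic_pole n x"
  shows "m = n"
proof -
  have "\<not> m < n" if mx: "two_adic_pole m x" and nx: "two_adic_pole n x" for m n
  proof
    assume "m < n"
    then obtain k where n: "n = m + Suc k" by (metis less_imp_Suc_add add_Suc_right)
    obtain \<alpha> \<beta> \<alpha>' \<beta>' where o: "phi_odd \<alpha>" "phi_odd \<beta>" "phi_odd \<alpha>'" "phi_odd \<beta>'"
      and x: "x = \<alpha> / (4 ^ m * \<beta>)" "x = \<alpha>' / (4 ^ n * \<beta>')"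
      using mx nx unfolding two_adic_pole_def by blast
    have "\<alpha> / (4 ^ m * \<beta>) = \<alpha>' / (4 ^ n * \<beta>')" using x by simp
    then have "4 ^ m * (\<alpha>' * \<beta>) = 4 ^ m * (2 * ((2 * 4 ^ k) * (\<alpha> * \<beta>')))"
      using o[THEN phi_odd_nonzero] unfolding n by (simp add: field_simps power_add)
    then have "\<alpha>' * \<beta> - 2 * ((2 * 4 ^ k) * (\<alpha> * \<beta>')) = 0" by simp
    moreover have "phi_odd (\<alpha>' * \<beta> - 2 * ((2 * 4 ^ k) * (\<alpha> * \<beta>')))"
      using o o[THEN phi_odd_integer] phi_integer_2 phi_integer_power4[of k]
      by (blast intro: phi_odd_diff_even phi_odd_mult phi_integer_mult)
    ultimately show False using phi_odd_nonzero by metis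
  qed
  then show ?thesis using assms by (metis linorder_neqE_nat)
qed

text \<open>At a pole the constants 1 and \<open>l\<close> are negligible: \<open>x\<close>,
  \<open>x - 1\<close>, \<open>x - l\<close> have equal valuations \<open>-2 n\<close>, so the
  quotient has valuation \<open>-8 n + 6 n - 2\<close>.\<close>

lemma two_adic_pole_double:
  assumes "two_adic_pole n x" "n > 0" "phi_integer l"
  shows "x * (x - 1) * (x - l) \<noteq> 0"
    "two_adic_pole (Suc n) ((x\<^sup>2 - l)\<^sup>2 / (4 * (x * (x - 1) * (x - l))))"
proof -
  obtain m where m: "n = Suc m" using assms(2) by (cases n) auto
  obtain \<alpha> \<beta> where o: "phi_odd \<alpha>" "phi_odd \<beta>" and x: "x = \<alpha> / (4 ^ n * \<beta>)"
    using assms(1) unfolding two_adic_pole_def by blast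
  \<comment> \<open>Half of \<open>4 ^ n\<close>, so that the corrections to the odd numerators
    appear as explicit multiples of 2.\<close>
  define N where "N = (2 * 4 ^ m :: complex)"
  have "phi_integer N" unfolding N_def
    using phi_integer_2 phi_integer_power4 by (intro phi_integer_mult)
  then have odd: "phi_odd (\<alpha> - 2 * (N * \<beta>))" "phi_odd (\<alpha> - 2 * (N * (l * \<beta>)))"
    "phi_odd (\<alpha> * \<alpha> - 2 * (2 * (N * N) * (l * (\<beta> * \<beta>))))"
    using o o[THEN phi_odd_integer] assms(3) phi_integer_2
    by (blast intro: phi_odd_diff_even phi_odd_mult phi_integer_mult)+
  define A B C where "A = \<alpha> - 2 * (N * \<beta>)" "B = \<alpha> - 2 * (N * (l * \<beta>))"
    "C = \<alpha> * \<alpha> - 2 * (2 * (N * N) * (l * (\<beta> * \<beta>)))"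
  note nz = o[THEN phi_odd_nonzero] odd[THEN phi_odd_nonzero, folded A_B_C_def]
  have N: "4 ^ n = 2 * N" "N \<noteq> 0" by (simp_all add: N_def m)
  have e: "x - 1 = A / (2 * N * \<beta>)" "x - l = B / (2 * N * \<beta>)" "x\<^sup>2 - l = C / (2 * N * \<beta>)\<^sup>2"
    using nz N(2) unfolding x N(1) A_B_C_def by (simp_all add: field_simps power2_eq_square)
  show "x * (x - 1) * (x - l) \<noteq> 0"
    unfolding e using nz N(2) by (simp add: x)
  have "(x\<^sup>2 - l)\<^sup>2 / (4 * (x * (x - 1) * (x - l))) = (C * C) / (4 ^ Suc n * (\<beta> * \<alpha> * A * B))"
    unfolding e using nz N(2) by (simp add: x N(1) field_simps power2_eq_square)
  moreover have "phi_odd (C * C)" "phi_odd (\<beta> * \<alpha> * A * B)"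
    using o odd unfolding A_B_C_def by (blast intro: phi_odd_mult)+
  ultimately show "two_adic_pole (Suc n) ((x\<^sup>2 - l)\<^sup>2 / (4 * (x * (x - 1) * (x - l))))"
    unfolding two_adic_pole_def by blast
qed

text \<open>A nonzero exponent killing \<open>g\<close> would leave only finitely many powers, too
  few for the distinct iterated doubles.\<close>

lemma (in group) infinite_order_if_inj_doubling:
  assumes g: "g \<in> carrier G" and inj: "inj (\<lambda>j::nat. g [^] (2 ^ j :: nat))" and a: "g [^] (a :: int) = \<one>"
  shows "a = 0"
proof (rule ccontr)
  assume "a \<noteq> 0"
  define d where "d = nat \<bar>a\<bar>"
  have d: "d > 0" using \<open>a \<noteq> 0\<close> by (simp add: d_def)
  have "g [^] d = \<one>"
  proof (cases "a \<ge> 0")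
    case True
    then show ?thesis using a int_pow_int[of G g d] by (simp add: d_def)
  next
    case False
    then have "g [^] (int d) = inv (g [^] a)" using g by (simp add: d_def int_pow_neg)
    then show ?thesis using a by (simp add: int_pow_int)
  qed
  have "g [^] n = g [^] (n mod d)" for n :: nat
  proof -
    have "g [^] n = (g [^] d) [^] (n div d) \<otimes> g [^] (n mod d)"
      using g by (simp add: nat_pow_pow nat_pow_mult)
    then show ?thesis using g \<open>g [^] d = \<one>\<close> by simp
  qed
  then have "range (\<lambda>j::nat. g [^] (2 ^ j :: nat)) \<subseteq> (\<lambda>i. g [^] i) ` {..<d}"
    using d by (auto intro!: image_eqI[where x = "_ mod d"])
  then have "finite (range (\<lambda>j::nat. g [^] (2 ^ j :: nat)))" by (rule finite_subset) simp
  then show False using inj by (simp add: finite_image_iff)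
qed

lemma infinite_order_if_two_adic_pole:
  assumes l: "l \<noteq> 0" "l \<noteq> 1" "phi_integer l"
    and g: "Affine x y \<in> carrier (legendre_group l)" and x: "two_adic_pole n x" "n > 0"
    and a: "Affine x y [^]\<^bsub>legendre_group l\<^esub> (a :: int) = \<one>\<^bsub>legendre_group l\<^esub>"
  shows "a = 0"
proof -
  interpret comm_group "legendre_group l" by (rule comm_group_legendre_group[OF l(1,2)])
  have dbl: "\<exists>u v. Affine x y [^]\<^bsub>legendre_group l\<^esub> (2 ^ j :: nat) = Affine u v \<and> two_adic_pole (n + j) u" for j
  proof (induction j)
    case 0
    then show ?case using g x by auto
  next
    case (Suc j)
    then obtain u v where uv: "Affine x y [^]\<^bsub>legendre_group l\<^esub> (2 ^ j :: nat) = Affine u v"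
      and u: "two_adic_pole (n + j) u" by blast
    have "Affine u v \<in> carrier (legendre_group l)" using g uv by (metis nat_pow_closed)
    then have on: "on_legendre l (u, v)" by (auto simp: legendre_group_def on_legendre_def)
    have nz: "u * (u - 1) * (u - l) \<noteq> 0" using two_adic_pole_double(1)[OF u _ l(3)] x(2) by simp
    then have "v \<noteq> 0" using on unfolding on_legendre_def by auto
    then obtain v' where "ec_add l (Affine u v) (Affine u v) =
        Affine ((u\<^sup>2 - l)\<^sup>2 / (4 * (u * (u - 1) * (u - l)))) v'"
      using ec_add_double[OF on] by blast
    moreover have "Affine x y [^]\<^bsub>legendre_group l\<^esub> (2 ^ Suc j :: nat) = ec_add l (Affine u v) (Affine u v)"
    proof -
      have "Affine x y [^]\<^bsub>legendre_group l\<^esub> (2 ^ Suc j :: nat) = Affine u v \<otimes>\<^bsub>legendre_group l\<^esub> Affine u v"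
        using nat_pow_mult[OF g, of "2 ^ j" "2 ^ j"] by (simp add: uv mult_2)
      then show ?thesis by (simp add: legendre_group_def)
    qed
    ultimately show ?case using two_adic_pole_double(2)[OF u _ l(3)] x(2) by auto
  qed
  have "inj (\<lambda>j::nat. Affine x y [^]\<^bsub>legendre_group l\<^esub> (2 ^ j :: nat))"
  proof (rule injI)
    fix i j :: nat
    assume "Affine x y [^]\<^bsub>legendre_group l\<^esub> (2 ^ i :: nat) = Affine x y [^]\<^bsub>legendre_group l\<^esub> (2 ^ j :: nat)"
    then show "i = j" using dbl[of i] dbl[of j] two_adic_pole_unique by fastforce
  qed
  then show ?thesis using infinite_order_if_inj_doubling g a by blast
qed

text \<open>The fourth power of the relation kills the torsion and gives \<open>a = 0\<close>; its
  square then kills \<open>s\<close> and makes \<open>b\<close> even. Four combinations of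
  \<open>\<one>\<close>, \<open>r [^] 2\<close> and \<open>s\<close> remain, and only one of them is
  trivial.\<close>

lemma (in comm_group) free_torsion_independent:
  assumes c: "g \<in> carrier G" "r \<in> carrier G" "s \<in> carrier G"
    and g: "\<And>a::int. g [^] a = \<one> \<Longrightarrow> a = 0"
    and r: "r [^] (4::int) = \<one>" "r [^] (2::int) \<noteq> \<one>"
    and s: "s [^] (2::int) = \<one>" "s \<noteq> \<one>" "s \<noteq> r [^] (2::int)"
    and 1: "g [^] (a::int) \<otimes> r [^] (b::int) \<otimes> s [^] (c::int) = \<one>"
  shows "a = 0" "4 dvd b" "2 dvd c"
proof -
  have r4: "r [^] (4 * n) = \<one>" and s2: "s [^] (2 * n) = \<one>" for n :: int
    using int_pow_pow[OF c(2), of 4 n] int_pow_pow[OF c(3), of 2 n] unfolding r(1) s(1) int_pow_one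
    by metis+
  have "g [^] (a * 4) \<otimes> r [^] (b * 4) \<otimes> s [^] (c * 4) = \<one>"
    using arg_cong[OF 1, of "\<lambda>x. x [^] (4::int)"] c by (simp add: int_pow_distrib int_pow_pow)
  moreover have "r [^] (b * 4) = \<one>" "s [^] (c * 4) = \<one>" using r4[of b] s2[of "2 * c"] by (simp_all add: ac_simps)
  ultimately have "g [^] (a * 4) = \<one>" using c by simp
  then show a: "a = 0" using g[of "a * 4"] by simp
  then have rs: "r [^] b \<otimes> s [^] c = \<one>" using 1 c by simp
  have even_b: "even b"
  proof (rule ccontr)
    assume "odd b"
    then obtain n where n: "b = 2 * n + 1" by (elim oddE)
    have "r [^] (b * 2) \<otimes> s [^] (c * 2) = \<one>"
      using arg_cong[OF rs, of "\<lambda>x. x [^] (2::int)"] c by (simp add: int_pow_distrib int_pow_pow)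
    then have "r [^] (b * 2) = \<one>" using s2[of c] c by (simp add: ac_simps)
    moreover have "r [^] (b * 2) = r [^] (4 * n) \<otimes> r [^] (2::int)"
      using c by (simp add: n int_pow_mult[symmetric] algebra_simps)
    ultimately show False using r4 r(2) c by simp
  qed
  then obtain n where n: "b = 2 * n" by (elim evenE)
  have rb: "r [^] b = (if even n then \<one> else r [^] (2::int))"
  proof (cases "even n")
    case True
    then obtain m where "n = 2 * m" by (elim evenE)
    then show ?thesis using r4[of m] n True by simp
  next
    case False
    then obtain m where "n = 2 * m + 1" by (elim oddE)
    then have "r [^] b = r [^] (4 * m) \<otimes> r [^] (2::int)"
      using c n by (simp add: int_pow_mult[symmetric] algebra_simps)
    then show ?thesis using r4[of m] False c by simp
  qed
  have sc: "s [^] c = (if even c then \<one> else s)"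
  proof (cases "even c")
    case True
    then show ?thesis using s2 by (auto elim!: evenE)
  next
    case False
    then obtain m where "c = 2 * m + 1" by (elim oddE)
    then have "s [^] c = s [^] (2 * m) \<otimes> s"
      using c int_pow_mult[of s "2 * m" 1] by simp
    then show ?thesis using s2[of m] False c by simp
  qed
  have "s \<otimes> s = \<one>" using s(1) c int_pow_mult[of s 1 1] by simp
  then have inv_s: "x = s" if "x \<otimes> s = \<one>" "x \<in> carrier G" for x
    using that c by (metis inv_equality inv_unique')
  have "even n \<and> even c"
    using rs r(2) s(2,3) c inv_s[of "r [^] (2::int)"] inv_s[of "\<one>"] unfolding rb sc
    by (auto split: if_splits)
  then show "4 dvd b" "2 dvd c" using n by auto
qed

section \<open>The images of the embedded points\<close>

text \<open>The common shape of the five maps: with coordinates indexed relative to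
  \<open>k\<close>, they differ only in the constants \<open>nu_slope\<close>,
  \<open>nu_shift\<close>, \<open>nu_scale\<close>.\<close>

definition nu_affine :: "complex \<Rightarrow> complex \<Rightarrow> complex \<Rightarrow> complex \<Rightarrow> complex \<Rightarrow> complex \<Rightarrow> ec_point" where
  "nu_affine p c n d t w = affine_or_infty d (p * (t\<^sup>2 / d\<^sup>2) + c) (n * (w / d ^ 3))"

definition nu_slope :: "complex^5" where
  "nu_slope = vector [- (2 * of_real phi + 1), 1, 2 * of_real phi + 1, of_real phi + 1, -1]"

definition nu_shift :: "complex^5" where
  "nu_shift = vector [- of_real phi, of_real phi + 1, of_real phi + 1, - of_real phi, of_real phi + 1]"

definition nu_scale :: "complex^5" where
  "nu_scale = vector [2 * of_real phi + 1, \<i>, \<i> * (2 * of_real phi + 1), \<i> * of_real phi, \<i>]"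

lemma rainbow_arith:
  "(6 :: 5) = 1" "(7 :: 5) = 2" "(8 :: 5) = 3" "(9 :: 5) = 4" "(0 :: 5) = 5"
  "(-1 :: 5) = 4" "(-2 :: 5) = 3"
  by simp_all

lemma nu_abs_proj4:
  assumes "x \<noteq> 0"
  shows "nu k (abs_proj4 x) = nu_affine (nu_slope $ k) (nu_shift $ k) (nu_scale $ k)
    (x $ (k + 4)) (x $ k) (x $ (k + 1) * x $ (k + 2) * x $ (k + 3))"
proof -
  have k: "k = 1 \<or> k = 2 \<or> k = 3 \<or> k = 4 \<or> k = 5" by (rule exhaust_5)
  show ?thesis
    unfolding nu.abs_eq[OF proportional_refl[OF assms]] Let_def nu_affine_def
    using k by (elim disjE)
      (simp_all add: nu_slope_def nu_shift_def nu_scale_def vector_5 rainbow_arith mult_ac add.assoc diff_add_eq)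
qed

lemma nu_affine_eqI:
  assumes "d \<noteq> 0" "p * t\<^sup>2 + c * d\<^sup>2 = x * d\<^sup>2" "n * w = y * d ^ 3"
  shows "nu_affine p c n d t w = Affine x y"
proof -
  have "p * (t\<^sup>2 / d\<^sup>2) + c = (p * t\<^sup>2 + c * d\<^sup>2) / d\<^sup>2" "n * (w / d ^ 3) = (n * w) / d ^ 3"
    using assms(1) by (simp_all add: field_simps)
  then show ?thesis using assms by (simp add: nu_affine_def affine_or_infty_def)
qed

fun ec_reflect :: "complex \<Rightarrow> ec_point \<Rightarrow> ec_point" where
  "ec_reflect s Infty = Infty"
| "ec_reflect s (Affine x y) = Affine (cnj x) (s * cnj y)"

definition color_sign :: "5 \<Rightarrow> 5 \<Rightarrow> int" where
  "color_sign k j = (if j = k \<or> j = k + 2 then 1 else -1)"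

text \<open>The sign by which colours \<open>k\<close> and \<open>k + 2\<close> act on ordinates.
  With it, conjugation acts on the three generators by the same formulas for every
  \<open>k\<close>.\<close>

definition conj_sign :: "5 \<Rightarrow> int" where
  "conj_sign k = (if k = 1 \<or> k = 4 then 1 else -1)"

text \<open>The abscissa contains only squares of coordinates, so the signs of the reflection vanish
  from it. In the ordinate they combine with the conjugated scale into one sign, compared over the
  25 pairs of \<open>k\<close> and \<open>j\<close>.\<close>

lemma nu_reflect: "nu k (reflect j P) = ec_reflect (of_int (conj_sign k * color_sign k j)) (nu k P)"
proof -
  define x where "x = rep_proj4 P"
  have "proportional x x" and P: "P = abs_proj4 x"
    unfolding x_def using Quotient3_rep_reflp[OF Quotient3_proj4] Quotient3_abs_rep[OF Quotient3_proj4]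
    by metis+
  then have x: "x \<noteq> 0" and pp: "proportional x x" by (auto simp: proportional_def)
  define y where "y = (\<chi> k. sgn_table $ k $ j * cnj (x $ k))"
  have y: "y \<noteq> 0"
  proof -
    obtain i where "x $ i \<noteq> 0" using x by (auto simp: vec_eq_iff)
    then have "y $ i \<noteq> 0" using sgn_table_cases[of i j] by (auto simp: y_def)
    then show ?thesis by auto
  qed
  have "sgn_table $ k $ j * sgn_table $ k $ j = 1" for k by (rule sgn_table_square)
  then have sq: "(sgn_table $ k $ j)\<^sup>2 = 1" for k by (simp add: power2_eq_square)
  have cube: "sgn_table $ k $ j ^ 3 = sgn_table $ k $ j" for k
    using sq[of k] by (simp add: power3_eq_cube power2_eq_square)
  have refl: "nu_affine p c n' (e * cnj d) (e' * cnj t) (u * cnj w) = ec_reflect s (nu_affine p c n d t w)"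
    if "e = 1 \<or> e = -1" "e' = 1 \<or> e' = -1" "cnj p = p" "cnj c = c" "n' * u = s * cnj n * e" for p c n n' e d e' t u w s
  proof -
    have "e ^ 2 = 1" "e' ^ 2 = 1" "e ^ 3 = e" "e \<noteq> 0" "e * e = 1" using that(1,2) by auto
    moreover have "n' * (u * z / (e * v)) = s * (cnj n * (z / v))" for z v
    proof -
      have "n' * (u * z / (e * v)) = (n' * u) * (z / v) / e" by (simp add: mult_ac)
      also have "\<dots> = s * (cnj n * (z / v))" using \<open>e \<noteq> 0\<close> unfolding that(5) by simp
      finally show ?thesis .
    qed
    ultimately show ?thesis using that(3,4)
      by (simp add: nu_affine_def affine_or_infty_def power_mult_distrib)
  qed
  have k: "k = 1 \<or> k = 2 \<or> k = 3 \<or> k = 4 \<or> k = 5" and j: "j = 1 \<or> j = 2 \<or> j = 3 \<or> j = 4 \<or> j = 5"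
    by (rule exhaust_5)+
  have "nu k (reflect j P) = nu k (abs_proj4 y)"
    unfolding P reflect.abs_eq[OF pp] y_def ..
  also have "\<dots> = nu_affine (nu_slope $ k) (nu_shift $ k) (nu_scale $ k)
      (sgn_table $ (k + 4) $ j * cnj (x $ (k + 4))) (sgn_table $ k $ j * cnj (x $ k))
      ((sgn_table $ (k + 1) $ j * sgn_table $ (k + 2) $ j * sgn_table $ (k + 3) $ j) *
        cnj (x $ (k + 1) * x $ (k + 2) * x $ (k + 3)))"
    unfolding nu_abs_proj4[OF y] by (simp add: y_def mult_ac)
  also have "\<dots> = ec_reflect (of_int (conj_sign k * color_sign k j)) (nu k P)"
    unfolding P nu_abs_proj4[OF x]
  proof (rule refl[OF sgn_table_cases sgn_table_cases])
    show "cnj (nu_slope $ k) = nu_slope $ k" "cnj (nu_shift $ k) = nu_shift $ k"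
      using k by (auto simp: nu_slope_def nu_shift_def vector_5)
    show "nu_scale $ k * (sgn_table $ (k + 1) $ j * sgn_table $ (k + 2) $ j * sgn_table $ (k + 3) $ j) =
        of_int (conj_sign k * color_sign k j) * cnj (nu_scale $ k) * sgn_table $ (k + 4) $ j"
      using k by (elim disjE) (insert j, elim disjE;
        simp add: nu_scale_def vector_5 sgn_table_def rainbow_arith conj_sign_def color_sign_def)+
  qed
  finally show ?thesis .
qed

lemma ec_reflect_1_add:
  assumes "cnj l = l"
  shows "ec_reflect 1 (ec_add l P Q) = ec_add l (ec_reflect 1 P) (ec_reflect 1 Q)"
proof -
  have "cnj y = - cnj y' \<longleftrightarrow> y = - y'" for y y'
    by (metis complex_cnj_cancel_iff complex_cnj_minus)
  then show ?thesis using assms by (cases P; cases Q) (simp_all add: Let_def)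
qed

section \<open>Coordinates of the generators and of the base faces\<close>

lemma zeta_phi_relations:
  "of_real phi = 1 + zeta ^ 2 - zeta ^ 3" "zeta ^ 4 = zeta ^ 3 - zeta ^ 2 + zeta - 1"
  using zeta_phi zeta_min by algebra+

lemma zeta_nonzero: "zeta \<noteq> 0"
  using zeta_power by auto

lemma cnj_zeta: "cnj zeta = - (zeta ^ 4)"
proof -
  have "zeta = cis (pi / 5)" by (simp add: zeta_def cis_conv_exp mult.commute)
  then have "zeta * cnj zeta = 1" by (metis cis_cnj cis_mult cis_zero add.right_inverse)
  moreover have "zeta * - (zeta ^ 4) = 1" using zeta_power by algebra
  ultimately show ?thesis using zeta_nonzero by (metis mult_cancel_left)
qed

definition root_phi :: complex where
  "root_phi = of_real (sqrt phi)"

lemma root_phi_square: "root_phi\<^sup>2 = of_real phi"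
  using phi_gt_1 unfolding root_phi_def by (metis of_real_power real_sqrt_pow2 less_eq_real_def less_trans zero_less_one)

lemma phi_nonzero: "complex_of_real phi \<noteq> 0"
  using phi_gt_1 by auto

lemma root_phi_nonzero: "root_phi \<noteq> 0"
  using root_phi_square phi_nonzero by auto

lemma sqrt_phi_plus_1: "complex_of_real (sqrt (phi + 1)) = of_real phi"
  using phi_gt_1 phi_square by (metis less_eq_real_def less_trans real_sqrt_unique zero_less_one)

text \<open>\<open>phi - 1\<close> is the inverse of \<open>phi\<close>, so this radical also lies
  in the field generated by \<open>root_phi\<close>.\<close>

lemma sqrt_phi_minus_1: "complex_of_real (sqrt (phi - 1)) = root_phi * (of_real phi - 1)"
proof -
  have "phi * (phi - 1)\<^sup>2 = phi - 1" using phi_square by algebra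
  then have "(sqrt phi * (phi - 1))\<^sup>2 = phi - 1" using phi_gt_1 by (simp add: power_mult_distrib)
  then have "sqrt (phi - 1) = sqrt phi * (phi - 1)"
    using phi_gt_1 by (intro real_sqrt_unique) auto
  then show ?thesis by (simp add: root_phi_def)
qed

lemma cnj_root_phi: "cnj root_phi = root_phi"
  by (simp add: root_phi_def)

lemma base_vertex_coords:
  "base_vertex = abs_proj4 (vector [1, zeta\<^sup>2 * root_phi, - (zeta ^ 4), - (\<i> * zeta), - (zeta ^ 3 * root_phi)])"
proof -
  have "zeta ^ 9 = - (zeta ^ 4)" "zeta ^ 6 = - zeta" "zeta ^ 8 = - (zeta ^ 3)"
    using zeta_power by algebra+
  then show ?thesis unfolding base_vertex_def root_phi_def by simp
qed

lemma base_face_coords: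
  "base_face 1 = abs_proj4 (vector [1, \<i>, 0, - \<i> * root_phi * (of_real phi - 1), - \<i> * root_phi])"
  "base_face 2 = abs_proj4 (vector [1, \<i> * root_phi, root_phi * (of_real phi - 1), 0, - \<i>])"
  "base_face 3 = abs_proj4 (vector [1, \<i> * of_real phi, root_phi, 1, 0])"
  "base_face 4 = abs_proj4 (vector [0, 1, - \<i>, - \<i>, - \<i>])"
  "base_face 5 = abs_proj4 (vector [1, 0, - \<i>, - \<i> * root_phi, - \<i> * of_real phi])"
  by (simp_all add: base_face_def vector_5 sqrt_phi_plus_1 sqrt_phi_minus_1 flip: root_phi_def mult.assoc)

lemma vector_5_nonzero: "a \<noteq> 0 \<or> b \<noteq> 0 \<Longrightarrow> (vector [a, b, c, d, e] :: complex^5) \<noteq> 0"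
  by (auto simp: vec_eq_iff forall_5 vector_5)

text \<open>Curves 1 and 4 have the same equation, as do 2 and 5, and their generators have the same
  coordinates too. Only three types remain from here on.\<close>

lemma e_inf_coords:
  "e_inf k = (if k = 1 \<or> k = 4
     then Affine (- ((of_real phi)\<^sup>2 * zeta ^ 4) - of_real phi) (\<i> * (of_real phi)\<^sup>2 * zeta ^ 3)
   else if k = 2 \<or> k = 5
     then Affine (of_real phi * zeta ^ 4 + of_real phi + 1) (- (zeta ^ 3 * root_phi))
   else Affine ((of_real phi)\<^sup>2 * zeta ^ 4 + of_real phi + 1) ((of_real phi)\<^sup>2 * zeta ^ 3))"
proof -
  define f z q where fzq: "f = complex_of_real phi" "z = zeta" "q = root_phi"
  \<comment> \<open>With these relations every coordinate comparison becomes a polynomial identity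
    in \<open>z\<close>, \<open>q\<close> and the imaginary unit.\<close>
  note rel = zeta_phi_relations[folded fzq] root_phi_square[folded fzq] i_squared zeta_power[folded fzq]
  note nz = phi_nonzero[folded fzq] root_phi_nonzero[folded fzq] zeta_nonzero[folded fzq]
  have k: "k = 1 \<or> k = 2 \<or> k = 3 \<or> k = 4 \<or> k = 5" by (rule exhaust_5)
  have e: "e_inf k = nu k base_vertex" by (simp add: e_inf_def propagate_all_ones)
  show ?thesis
    unfolding e base_vertex_coords fzq[symmetric]
    apply (subst nu_abs_proj4)
     apply (simp add: vector_5_nonzero)
    using k apply (elim disjE)
        apply (simp_all add: vector_5 rainbow_arith nu_slope_def nu_shift_def nu_scale_def fzq[symmetric])
        apply (erule thin_rl, rule nu_affine_eqI; (unfold power_one)?; (simp add: nz; fail | use rel in algebra))+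
    done
qed

lemma e_four_coords:
  "e_four k = (if k = 1 \<or> k = 4 then Affine (- of_real phi) (\<i> * (2 * of_real phi + 1))
   else if k = 2 \<or> k = 5 then Affine (of_real phi + 1) (- (of_real phi * root_phi))
   else Affine (of_real phi + 1) (2 * of_real phi + 1))"
proof -
  define f q where fzq: "f = complex_of_real phi" "q = root_phi"
  note rel = phi_square_complex[folded fzq] root_phi_square[folded fzq] i_squared
  note nz = phi_nonzero[folded fzq] root_phi_nonzero[folded fzq]
  have k: "k = 1 \<or> k = 2 \<or> k = 3 \<or> k = 4 \<or> k = 5" by (rule exhaust_5)
  have k3: "k - 2 = k + 3" by (simp add: algebra_simps)
  have e: "e_four k = nu k (base_face (k + 3))"
    unfolding k3[symmetric] by (simp add: e_four_def position_face_center propagate_all_ones del: position.simps)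
  show ?thesis
    unfolding e fzq[symmetric]
    using k apply (elim disjE)
        apply (simp_all add: rainbow_arith base_face_coords fzq[symmetric] nu_abs_proj4 vector_5_nonzero)
        apply (simp_all add: vector_5 rainbow_arith nu_slope_def nu_shift_def nu_scale_def fzq[symmetric])
        apply (erule thin_rl, rule nu_affine_eqI; (unfold power_one)?; (simp add: nz; fail | use rel in algebra))+
    done
qed

text \<open>The vanishing coordinate of \<open>base_face m\<close> has index \<open>m + 2\<close>.
  For \<open>m\<close> equal to \<open>k\<close>, \<open>k + 1\<close> or \<open>k + 4\<close> it is
  a factor of the ordinate, and for \<open>m = k + 2\<close> it is the denominator. In the remaining
  case \<open>m = k + 3\<close> it is coordinate \<open>k\<close>, which enters the abscissa only;
  this is \<open>e_four k\<close>.\<close>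

lemma nu_base_face_two_torsion:
  "e_two k = (if k = 3 then Affine 0 0 else Affine 1 0)"
  "nu k (base_face (k + 4)) = (if k = 1 \<or> k = 4 then Affine 0 0
     else if k = 2 \<or> k = 5 then Affine (of_real phi) 0 else Affine 1 0)"
  "nu k (base_face (k + 1)) = (if k = 1 \<or> k = 4 then Affine (of_real phi + 1) 0
     else if k = 2 \<or> k = 5 then Affine 0 0 else Affine (- of_real phi) 0)"
  "nu k (base_face (k + 2)) = Infty"
proof -
  define f q where fzq: "f = complex_of_real phi" "q = root_phi"
  note rel = phi_square_complex[folded fzq] root_phi_square[folded fzq] i_squared
  note nz = phi_nonzero[folded fzq] root_phi_nonzero[folded fzq]
  have k: "k = 1 \<or> k = 2 \<or> k = 3 \<or> k = 4 \<or> k = 5" by (rule exhaust_5)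
  have e: "e_two k = nu k (base_face k)"
    by (simp add: e_two_def position_face_center propagate_all_ones del: position.simps)
  show "e_two k = (if k = 3 then Affine 0 0 else Affine 1 0)"
    unfolding e fzq[symmetric]
    using k apply (elim disjE)
        apply (simp_all add: rainbow_arith base_face_coords fzq[symmetric] nu_abs_proj4 vector_5_nonzero)
        apply (simp_all add: vector_5 rainbow_arith nu_slope_def nu_shift_def nu_scale_def fzq[symmetric])
        apply (erule thin_rl, rule nu_affine_eqI; (unfold power_one)?; (simp add: nz; fail | use rel in algebra))+
    done
  show "nu k (base_face (k + 4)) = (if k = 1 \<or> k = 4 then Affine 0 0
     else if k = 2 \<or> k = 5 then Affine (of_real phi) 0 else Affine 1 0)"
    unfolding fzq[symmetric]
    using k apply (elim disjE)
        apply (simp_all add: rainbow_arith base_face_coords fzq[symmetric] nu_abs_proj4 vector_5_nonzero)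
        apply (simp_all add: vector_5 rainbow_arith nu_slope_def nu_shift_def nu_scale_def fzq[symmetric])
        apply (erule thin_rl, rule nu_affine_eqI; (unfold power_one)?; (simp add: nz; fail | use rel in algebra))+
    done
  show "nu k (base_face (k + 1)) = (if k = 1 \<or> k = 4 then Affine (of_real phi + 1) 0
     else if k = 2 \<or> k = 5 then Affine 0 0 else Affine (- of_real phi) 0)"
    unfolding fzq[symmetric]
    using k apply (elim disjE)
        apply (simp_all add: rainbow_arith base_face_coords fzq[symmetric] nu_abs_proj4 vector_5_nonzero)
        apply (simp_all add: vector_5 rainbow_arith nu_slope_def nu_shift_def nu_scale_def fzq[symmetric])
        apply (erule thin_rl, rule nu_affine_eqI; (unfold power_one)?; (simp add: nz; fail | use rel in algebra))+
    done
  show "nu k (base_face (k + 2)) = Infty"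
    using k apply (elim disjE)
        apply (simp_all add: rainbow_arith base_face_coords fzq[symmetric] nu_abs_proj4 vector_5_nonzero)
        apply (simp_all add: vector_5 rainbow_arith nu_affine_def affine_or_infty_def)
    done
qed


section \<open>Relations between the generators\<close>

definition EC_param :: "5 \<Rightarrow> complex" where
  "EC_param k = (if k = 1 \<or> k = 4 then of_real phi + 1 else if k = 3 then - of_real phi else of_real phi)"

lemma EC_param: "EC k = legendre_group (EC_param k)" "cnj (EC_param k) = EC_param k"
  "EC_param k \<noteq> 0" "EC_param k \<noteq> 1" "phi_integer (EC_param k)"
proof -
  show "EC k = legendre_group (EC_param k)"
    using exhaust_5[of k] by (auto simp: EC_def EC_param_def vector_5)
  have "phi + 1 \<noteq> 0" "phi \<noteq> 1" "- phi \<noteq> 1" "phi + 1 \<noteq> 1" "phi \<noteq> 0" using phi_gt_1 by linarith+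
  then have "complex_of_real (phi + 1) \<noteq> 0" "complex_of_real phi \<noteq> 1" "complex_of_real (- phi) \<noteq> 1"
    "complex_of_real (phi + 1) \<noteq> 1" "complex_of_real phi \<noteq> 0"
    unfolding of_real_eq_0_iff of_real_eq_1_iff by blast+
  then show "EC_param k \<noteq> 0" "EC_param k \<noteq> 1" by (auto simp: EC_param_def)
  show "cnj (EC_param k) = EC_param k" by (simp add: EC_param_def)
  have "phi_integer (of_real phi + 1)" "phi_integer (of_real phi)" "phi_integer (- of_real phi)"
    unfolding phi_integer_def
    by (rule exI[of _ 1], rule exI[of _ 1], simp) (rule exI[of _ 0], rule exI[of _ 1], simp,
      rule exI[of _ 0], rule exI[of _ "- 1"], simp)
  then show "phi_integer (EC_param k)" by (simp add: EC_param_def)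
qed

lemma comm_group_EC: "comm_group (EC k)"
  unfolding EC_param(1) by (rule comm_group_legendre_group) (rule EC_param)+

lemma EC_mult: "P \<otimes>\<^bsub>EC k\<^esub> Q = ec_add (EC_param k) P Q" "\<one>\<^bsub>EC k\<^esub> = Infty"
  by (simp_all add: EC_param(1) legendre_group_def)

lemma nu_position_carrier:
  "nu k (position (Vertex v)) \<in> carrier (EC k)" "nu k (position (face_center m v)) \<in> carrier (EC k)"
  by (rule nu_in_EC position_in_X5)+

lemma generators_carrier:
  "e_inf k \<in> carrier (EC k)" "e_four k \<in> carrier (EC k)" "e_two k \<in> carrier (EC k)"
  unfolding e_inf_def e_four_def e_two_def by (rule nu_position_carrier)+

lemma line_meets_imp_mult:
  assumes "line_meets (EC_param k) (x1, y1) (x2, y2) (x3, - y3) s t"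
  shows "Affine x1 y1 \<otimes>\<^bsub>EC k\<^esub> Affine x2 y2 = Affine x3 y3"
  using ec_add_line_meets[OF assms line_meets_not_opposite[OF assms EC_param(3,4)]]
  by (simp add: EC_mult pt_def flip_def)

lemma e_four_double: "e_four k \<otimes>\<^bsub>EC k\<^esub> e_four k = nu k (base_face (k + 4))"
proof -
  define f q where fzq: "f = complex_of_real phi" "q = root_phi"
  note rel = phi_square_complex[folded fzq] root_phi_square[folded fzq] i_squared
  \<comment> \<open>For each of the three types, the tangent at \<open>e_four k\<close>, given by
    its slope and intercept, and its third intersection, a point of order 2.\<close>
  have "line_meets (f + 1) (- f, \<i> * (2 * f + 1)) (- f, \<i> * (2 * f + 1)) (0, - 0) (- \<i> * (f + 1)) 0"
    using rel unfolding line_meets_def fst_conv snd_conv by (intro conjI; (simp; fail | algebra | simp add: algebra_simps power2_eq_square; fail))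
  moreover have "line_meets f (f + 1, - (f * q)) (f + 1, - (f * q)) (f, - 0) (- (f * q)) ((f + 1) * q)"
    using rel unfolding line_meets_def fst_conv snd_conv by (intro conjI; (simp; fail | algebra | simp add: algebra_simps power2_eq_square; fail))
  moreover have "line_meets (- f) (f + 1, 2 * f + 1) (f + 1, 2 * f + 1) (1, - 0) (f + 1) (- (f + 1))"
    using rel unfolding line_meets_def fst_conv snd_conv by (intro conjI; (simp; fail | algebra | simp add: algebra_simps power2_eq_square; fail))
  ultimately show ?thesis
    using exhaust_5[of k] line_meets_imp_mult[of k] unfolding fzq nu_base_face_two_torsion
    by (elim disjE) (simp_all add: EC_param_def e_four_coords)
qed


text \<open>The three points of order 2 lie on the line \<open>y = 0\<close>.\<close>

lemma e_two_four: "nu k (base_face (k + 4)) \<otimes>\<^bsub>EC k\<^esub> e_two k = nu k (base_face (k + 1))"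
proof -
  have *: "line_meets l (0, 0) (1, 0) (l, - 0) 0 0" "line_meets l (l, 0) (1, 0) (0, - 0) 0 0"
    "line_meets l (1, 0) (0, 0) (l, - 0) 0 0" for l
    by (simp_all add: line_meets_def)
  show ?thesis
    using exhaust_5[of k] *[of "EC_param k", THEN line_meets_imp_mult[of k]]
    unfolding nu_base_face_two_torsion by (elim disjE) (simp_all add: EC_param_def)
qed

lemma nu_base_face_square: "nu k (base_face (k + 4)) \<otimes>\<^bsub>EC k\<^esub> nu k (base_face (k + 4)) = \<one>\<^bsub>EC k\<^esub>"
  by (auto simp: EC_mult nu_base_face_two_torsion)

lemma e_two_square: "e_two k \<otimes>\<^bsub>EC k\<^esub> e_two k = \<one>\<^bsub>EC k\<^esub>"
  by (auto simp: EC_mult nu_base_face_two_torsion)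

lemma torsion_distinct:
  "nu k (base_face (k + 4)) \<noteq> \<one>\<^bsub>EC k\<^esub>" "e_two k \<noteq> \<one>\<^bsub>EC k\<^esub>" "e_two k \<noteq> nu k (base_face (k + 4))"
proof -
  have "complex_of_real phi \<noteq> 1" using phi_gt_1 by simp
  then show "nu k (base_face (k + 4)) \<noteq> \<one>\<^bsub>EC k\<^esub>" "e_two k \<noteq> \<one>\<^bsub>EC k\<^esub>"
    "e_two k \<noteq> nu k (base_face (k + 4))"
    using exhaust_5[of k] unfolding EC_mult nu_base_face_two_torsion by auto
qed

lemma reflect_e_four: "e_four k \<otimes>\<^bsub>EC k\<^esub> ec_reflect (of_int (conj_sign k)) (e_four k) = \<one>\<^bsub>EC k\<^esub>"
  by (auto simp: EC_mult e_four_coords conj_sign_def cnj_root_phi)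

lemma reflect_e_two: "ec_reflect s (e_two k) = e_two k"
  by (simp add: nu_base_face_two_torsion)

lemma reflect_e_inf:
  "ec_reflect (of_int (conj_sign k)) (e_inf k) = e_inf k \<otimes>\<^bsub>EC k\<^esub> nu k (base_face (k + 4))"
proof -
  define f z q where fzq: "f = complex_of_real phi" "z = zeta" "q = root_phi"
  note rel = zeta_phi_relations[folded fzq] root_phi_square[folded fzq] i_squared zeta_power[folded fzq]
  have c: "cnj f = f" "cnj z = - (z ^ 4)" "cnj q = q"
    using cnj_zeta cnj_root_phi by (simp_all add: fzq)
  \<comment> \<open>\<open>A\<close>, \<open>B\<close>, \<open>C\<close> treat the three types: each
    line passes through \<open>e_inf k\<close>, the double of \<open>e_four k\<close>, and the
    negative of the reflected \<open>e_inf k\<close>.\<close>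
  have A: "line_meets (f + 1) (- (f\<^sup>2 * z ^ 4) - f, \<i> * f\<^sup>2 * z ^ 3) (0, 0)
      (cnj (- (f\<^sup>2 * z ^ 4) - f), - cnj (\<i> * f\<^sup>2 * z ^ 3)) (- \<i> * f) 0"
    unfolding line_meets_def fst_conv snd_conv complex_cnj_mult complex_cnj_minus complex_cnj_diff complex_cnj_power complex_cnj_i c
    using rel by (intro conjI; (simp; fail | algebra | simp add: algebra_simps power2_eq_square; fail))
  have B: "line_meets f (f * z ^ 4 + f + 1, - (z ^ 3 * q)) (f, 0)
      (cnj (f * z ^ 4 + f + 1), - (- cnj (- (z ^ 3 * q)))) (- q) (q * f)"
    unfolding line_meets_def fst_conv snd_conv complex_cnj_mult complex_cnj_minus complex_cnj_add complex_cnj_one complex_cnj_power c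
    using rel by (intro conjI; (simp; fail | algebra | simp add: algebra_simps power2_eq_square; fail))
  have C: "line_meets (- f) (f\<^sup>2 * z ^ 4 + f + 1, f\<^sup>2 * z ^ 3) (1, 0)
      (cnj (f\<^sup>2 * z ^ 4 + f + 1), - (- cnj (f\<^sup>2 * z ^ 3))) f (- f)"
    unfolding line_meets_def fst_conv snd_conv complex_cnj_mult complex_cnj_minus complex_cnj_add complex_cnj_one complex_cnj_power c
    using rel by (intro conjI; (simp; fail | algebra | simp add: algebra_simps power2_eq_square; fail))
  consider "k = 1 \<or> k = 4" | "k = 2 \<or> k = 5" | "k = 3" using exhaust_5[of k] by blast
  then show ?thesis
  proof cases
    case 1
    then have e: "e_inf k = Affine (- (f\<^sup>2 * z ^ 4) - f) (\<i> * f\<^sup>2 * z ^ 3)" "EC_param k = f + 1"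
      "nu k (base_face (k + 4)) = Affine 0 0" "conj_sign k = 1"
      by (auto simp: e_inf_coords EC_param_def fzq nu_base_face_two_torsion conj_sign_def)
    show ?thesis using line_meets_imp_mult[of k, unfolded e, OF A] unfolding e by simp
  next
    case 2
    then have e: "e_inf k = Affine (f * z ^ 4 + f + 1) (- (z ^ 3 * q))" "EC_param k = f"
      "nu k (base_face (k + 4)) = Affine f 0" "conj_sign k = - 1"
      by (auto simp: e_inf_coords EC_param_def fzq nu_base_face_two_torsion conj_sign_def)
    show ?thesis using line_meets_imp_mult[of k, unfolded e, OF B] unfolding e by simp
  next
    case 3
    then have e: "e_inf k = Affine (f\<^sup>2 * z ^ 4 + f + 1) (f\<^sup>2 * z ^ 3)" "EC_param k = - f"
      "nu k (base_face (k + 4)) = Affine 1 0" "conj_sign k = - 1"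
      unfolding nu_base_face_two_torsion by (auto simp: e_inf_coords EC_param_def fzq conj_sign_def)
    show ?thesis using line_meets_imp_mult[of k, unfolded e, OF C] unfolding e by simp
  qed
qed

text \<open>By \<open>reflect_e_inf\<close> the reflection changes \<open>e_inf k\<close> by a point
  of order 2, so it fixes the double, whose abscissa is therefore real. Explicitly it is an odd
  element of \<int>[\<phi>] divided by 4.\<close>

lemma e_inf_double_pole:
  "\<exists>x y. e_inf k \<otimes>\<^bsub>EC k\<^esub> e_inf k = Affine x y \<and> two_adic_pole 1 x"
proof -
  define f z q where fzq: "f = complex_of_real phi" "z = zeta" "q = root_phi"
  note rel = zeta_phi_relations[folded fzq] root_phi_square[folded fzq] i_squared zeta_power[folded fzq]
  note nz = phi_nonzero[folded fzq] root_phi_nonzero[folded fzq] zeta_nonzero[folded fzq]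
  have odd: "phi_odd (2 + f)" "phi_odd (2 * f + 1)" "phi_odd (2 - f)" "phi_odd 1"
    unfolding phi_odd_def fzq
    by (rule exI[of _ 2], rule exI[of _ 1], simp) (rule exI[of _ 1], rule exI[of _ 2], simp,
      rule exI[of _ 2], rule exI[of _ "- 1"], simp, rule exI[of _ 1], rule exI[of _ 0], simp)
  have *: "\<exists>x y. Affine u v \<otimes>\<^bsub>EC k\<^esub> Affine u v = Affine x y \<and> two_adic_pole 1 x"
    if "v\<^sup>2 = u * (u - 1) * (u - EC_param k)" "v \<noteq> 0" "(u\<^sup>2 - EC_param k)\<^sup>2 = \<alpha> * v\<^sup>2" "phi_odd \<alpha>" for u v \<alpha>
  proof -
    note uv = that
    obtain y where "ec_add (EC_param k) (Affine u v) (Affine u v) = Affine ((u\<^sup>2 - EC_param k)\<^sup>2 / (4 * v\<^sup>2)) y"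
      using ec_add_double[of "EC_param k" u v] uv(1,2) unfolding on_legendre_def fst_conv snd_conv by metis
    moreover have "(u\<^sup>2 - EC_param k)\<^sup>2 / (4 * v\<^sup>2) = \<alpha> / (4 ^ 1 * 1)"
      using uv(2,3) by simp
    ultimately show ?thesis
      using odd(4) uv(4) unfolding two_adic_pole_def EC_mult by blast
  qed
  have on: "v\<^sup>2 = u * (u - 1) * (u - EC_param k)" if "e_inf k = Affine u v" for u v
    using generators_carrier(1)[of k] that by (simp add: EC_param(1) legendre_group_def)
  \<comment> \<open>The double has abscissa \<open>(2 + f) / 4\<close>,
    \<open>(2 * f + 1) / 4\<close> or \<open>(2 - f) / 4\<close>, according to the type.\<close>
  have A: "((- (f\<^sup>2 * z ^ 4) - f)\<^sup>2 - (f + 1))\<^sup>2 = (2 + f) * (\<i> * f\<^sup>2 * z ^ 3)\<^sup>2"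
    and B: "((f * z ^ 4 + f + 1)\<^sup>2 - f)\<^sup>2 = (2 * f + 1) * (- (z ^ 3 * q))\<^sup>2"
    and C: "((f\<^sup>2 * z ^ 4 + f + 1)\<^sup>2 - - f)\<^sup>2 = (2 - f) * (f\<^sup>2 * z ^ 3)\<^sup>2"
    using rel by algebra+
  consider "k = 1 \<or> k = 4" | "k = 2 \<or> k = 5" | "k = 3" using exhaust_5[of k] by blast
  then show ?thesis
  proof cases
    case 1
    then have e: "e_inf k = Affine (- (f\<^sup>2 * z ^ 4) - f) (\<i> * f\<^sup>2 * z ^ 3)" "EC_param k = f + 1"
      by (auto simp: e_inf_coords EC_param_def fzq)
    show ?thesis unfolding e(1)
      by (rule *[OF on[OF e(1)] _ A[folded e(2)] odd(1)]) (use nz in simp)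
  next
    case 2
    then have e: "e_inf k = Affine (f * z ^ 4 + f + 1) (- (z ^ 3 * q))" "EC_param k = f"
      by (auto simp: e_inf_coords EC_param_def fzq)
    have B': "((f * z ^ 4 + f + 1)\<^sup>2 - EC_param k)\<^sup>2 = (2 * f + 1) * (- (z ^ 3 * q))\<^sup>2"
      unfolding e(2) by (rule B)
    show ?thesis unfolding e(1)
      by (rule *[OF on[OF e(1)] _ B' odd(2)]) (use nz in simp)
  next
    case 3
    then have e: "e_inf k = Affine (f\<^sup>2 * z ^ 4 + f + 1) (f\<^sup>2 * z ^ 3)" "EC_param k = - f"
      by (auto simp: e_inf_coords EC_param_def fzq)
    show ?thesis unfolding e(1)
      by (rule *[OF on[OF e(1)] _ C[folded e(2)] odd(3)]) (use nz in simp)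
  qed
qed

lemma e_inf_infinite_order:
  assumes "e_inf k [^]\<^bsub>EC k\<^esub> (a :: int) = \<one>\<^bsub>EC k\<^esub>"
  shows "a = 0"
proof -
  interpret comm_group "EC k" by (rule comm_group_EC)
  obtain x y where xy: "e_inf k \<otimes>\<^bsub>EC k\<^esub> e_inf k = Affine x y" "two_adic_pole 1 x"
    using e_inf_double_pole by blast
  have "Affine x y [^]\<^bsub>EC k\<^esub> a = \<one>\<^bsub>EC k\<^esub>"
    unfolding xy(1)[symmetric] using assms generators_carrier by (simp add: int_pow_distrib)
  moreover have "Affine x y \<in> carrier (EC k)" using generators_carrier xy(1) m_closed by metis
  ultimately show ?thesis
    using infinite_order_if_two_adic_pole[OF EC_param(3-5) _ xy(2)] unfolding EC_param(1) by simp
qed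

section \<open>Coordinates with respect to the generators\<close>

definition gen :: "5 \<Rightarrow> int \<Rightarrow> int \<Rightarrow> int \<Rightarrow> ec_point" where
  "gen k a b c = e_inf k [^]\<^bsub>EC k\<^esub> a \<otimes>\<^bsub>EC k\<^esub> e_four k [^]\<^bsub>EC k\<^esub> b \<otimes>\<^bsub>EC k\<^esub> e_two k [^]\<^bsub>EC k\<^esub> c"

context
  fixes k :: 5
begin

interpretation comm_group "EC k"
  by (rule comm_group_EC)

lemma gen_closed: "gen k a b c \<in> carrier (EC k)"
  using generators_carrier by (simp add: gen_def)

lemma gen_mult: "gen k a b c \<otimes>\<^bsub>EC k\<^esub> gen k a' b' c' = gen k (a + a') (b + b') (c + c')"
  unfolding gen_def using generators_carrier[of k] by (simp add: int_pow_mult m_ac)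

lemma gen_pow: "gen k a b c [^]\<^bsub>EC k\<^esub> n = gen k (a * n) (b * n) (c * n)"
  unfolding gen_def using generators_carrier by (simp add: int_pow_distrib int_pow_pow)

lemma gen_0: "gen k 0 0 0 = \<one>\<^bsub>EC k\<^esub>"
  by (simp add: gen_def)

lemma gen_generators: "gen k 1 0 0 = e_inf k" "gen k 0 1 0 = e_four k" "gen k 0 0 1 = e_two k"
  using generators_carrier by (simp_all add: gen_def)

lemma gen_face_center:
  "nu k (base_face (k + 4)) = gen k 0 2 0" "nu k (base_face (k + 1)) = gen k 0 2 1"
  "nu k (base_face (k + 2)) = gen k 0 0 0"
  unfolding e_four_double[symmetric] e_two_four[symmetric] gen_generators[symmetric] gen_mult
  by (simp_all add: gen_0 EC_mult nu_base_face_two_torsion)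

lemma gen_torsion: "gen k 0 (4 * n) 0 = \<one>\<^bsub>EC k\<^esub>" "gen k 0 0 (2 * n) = \<one>\<^bsub>EC k\<^esub>"
proof -
  have "gen k 0 4 0 = \<one>\<^bsub>EC k\<^esub>" "gen k 0 0 2 = \<one>\<^bsub>EC k\<^esub>"
    using nu_base_face_square[of k] e_two_square[of k] unfolding gen_face_center gen_generators[symmetric] gen_mult by simp_all
  then show "gen k 0 (4 * n) 0 = \<one>\<^bsub>EC k\<^esub>" "gen k 0 0 (2 * n) = \<one>\<^bsub>EC k\<^esub>"
    using gen_pow[of 0 4 0 n] gen_pow[of 0 0 2 n] unfolding mult_zero_left by (metis int_pow_one)+
qed

lemma gen_eq_one_iff: "gen k a b c = \<one>\<^bsub>EC k\<^esub> \<longleftrightarrow> a = 0 \<and> 4 dvd b \<and> 2 dvd c"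
proof
  have pow: "x [^]\<^bsub>EC k\<^esub> (2::int) = x \<otimes>\<^bsub>EC k\<^esub> x" if "x \<in> carrier (EC k)" for x
    using int_pow_mult[OF that, of 1 1] that by simp
  assume "gen k a b c = \<one>\<^bsub>EC k\<^esub>"
  then show "a = 0 \<and> 4 dvd b \<and> 2 dvd c"
    using free_torsion_independent[OF generators_carrier[of k] e_inf_infinite_order, where a = a and b = b and c = c]
      torsion_distinct[of k] gen_torsion[of 1] e_four_double[of k] e_two_square[of k]
      pow[OF generators_carrier(2)] pow[OF generators_carrier(3)] generators_carrier
    unfolding gen_def by simp
next
  assume "a = 0 \<and> 4 dvd b \<and> 2 dvd c"
  then obtain m n where "a = 0" "b = 4 * m" "c = 2 * n" by (auto elim!: dvdE)
  then show "gen k a b c = \<one>\<^bsub>EC k\<^esub>"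
    using gen_mult[of 0 "4 * m" 0 0 0 "2 * n"] gen_torsion[of m] gen_torsion[of n] by simp
qed

lemma gen_eq_iff: "gen k a b c = gen k a' b' c' \<longleftrightarrow> a = a' \<and> [b = b'] (mod 4) \<and> [c = c'] (mod 2)"
proof -
  have "gen k a b c = gen k (a - a') (b - b') (c - c') \<otimes>\<^bsub>EC k\<^esub> gen k a' b' c'"
    by (simp add: gen_mult)
  then have "gen k a b c = gen k a' b' c' \<longleftrightarrow> gen k (a - a') (b - b') (c - c') = \<one>\<^bsub>EC k\<^esub>"
    using gen_closed by (metis l_one r_cancel_one')
  then show ?thesis by (simp add: gen_eq_one_iff cong_iff_dvd_diff)
qed

lemma ec_reflect_minus:
  assumes "P \<in> carrier (EC k)"
  shows "ec_reflect 1 P \<in> carrier (EC k)" "ec_reflect (-1) P = inv\<^bsub>EC k\<^esub> (ec_reflect 1 P)"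
proof -
  have on: "(cnj y)\<^sup>2 = cnj x * (cnj x - 1) * (cnj x - EC_param k)" if "y\<^sup>2 = x * (x - 1) * (x - EC_param k)" for x y
    using arg_cong[OF that, of cnj] by (simp add: EC_param(2))
  then show c: "ec_reflect 1 P \<in> carrier (EC k)"
    using assms unfolding EC_param(1) by (auto simp: legendre_group_def)
  have "ec_reflect (-1) P \<in> carrier (EC k)"
    using assms on unfolding EC_param(1) by (auto simp: legendre_group_def)
  moreover have "ec_reflect (-1) P \<otimes>\<^bsub>EC k\<^esub> ec_reflect 1 P = \<one>\<^bsub>EC k\<^esub>"
    by (cases P) (simp_all add: EC_mult)
  ultimately show "ec_reflect (-1) P = inv\<^bsub>EC k\<^esub> (ec_reflect 1 P)"
    using c by (simp add: inv_equality)
qed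

lemma ec_reflect_hom:
  assumes "s = 1 \<or> s = -1"
  shows "ec_reflect s \<in> hom (EC k) (EC k)"
proof (rule homI)
  fix P Q assume "P \<in> carrier (EC k)" "Q \<in> carrier (EC k)"
  then show "ec_reflect s P \<in> carrier (EC k)"
    "ec_reflect s (P \<otimes>\<^bsub>EC k\<^esub> Q) = ec_reflect s P \<otimes>\<^bsub>EC k\<^esub> ec_reflect s Q"
    using assms ec_reflect_minus ec_reflect_1_add[OF EC_param(2)] inv_mult
    by (auto simp flip: EC_mult)
qed

text \<open>The normalized conjugation \<open>\<kappa>\<close> adds twice \<open>e_four\<close> to
  \<open>e_inf\<close>, inverts \<open>e_four\<close> and fixes \<open>e_two\<close>. Colours of
  sign \<open>-1\<close> invert the result in addition.\<close>

lemma nu_reflect_gen: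
  assumes "nu k P = gen k a b c"
  shows "nu k (reflect j P) =
    gen k (color_sign k j * a) (color_sign k j * (2 * a - b)) (color_sign k j * c)"
proof -
  define \<kappa> where "\<kappa> = ec_reflect (of_int (conj_sign k))"
  have s: "of_int (conj_sign k) = (1::complex) \<or> of_int (conj_sign k) = (-1::complex)"
    by (simp add: conj_sign_def)
  interpret \<kappa>: group_hom "EC k" "EC k" \<kappa>
    using ec_reflect_hom[OF s] by unfold_locales (simp add: \<kappa>_def)
  have \<kappa>g: "\<kappa> (e_inf k) = gen k 1 2 0" "\<kappa> (e_two k) = gen k 0 0 1"
    using reflect_e_inf[of k] reflect_e_two[of _ k]
    unfolding \<kappa>_def gen_face_center gen_generators[symmetric] gen_mult by simp_all
  have "\<kappa> (e_four k) = inv\<^bsub>EC k\<^esub> e_four k"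
    using reflect_e_four[of k] generators_carrier \<kappa>.hom_closed unfolding \<kappa>_def
    by (metis inv_equality m_comm)
  also have "\<dots> = gen k 0 (-1) 0"
    using gen_mult[of 0 "-1" 0 0 1 0] gen_closed unfolding gen_generators gen_0 add_0 
    by (intro inv_equality) (simp_all add: gen_generators gen_0 generators_carrier)
  finally have "\<kappa> (gen k a b c) = gen k a (2 * a - b) c"
    unfolding gen_def[of k a b c] using generators_carrier \<kappa>g
    by (simp add: \<kappa>.hom_mult \<kappa>.hom_int_pow gen_pow gen_mult)
  moreover have "nu k (reflect j P) = (\<kappa> (nu k P)) [^]\<^bsub>EC k\<^esub> (color_sign k j)"
  proof (cases "color_sign k j = 1")
    case False
    have n: "nu k P \<in> carrier (EC k)" using assms gen_closed by simp
    have "conj_sign k = 1 \<or> conj_sign k = -1" by (simp add: conj_sign_def)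
    then have "ec_reflect (- of_int (conj_sign k)) (nu k P) = inv\<^bsub>EC k\<^esub> \<kappa> (nu k P)"
      using ec_reflect_minus[OF n] ec_reflect_minus(1)[OF n, THEN inv_inv] by (auto simp: \<kappa>_def)
    moreover have "color_sign k j = -1" using False by (simp add: color_sign_def split: if_splits)
    ultimately show ?thesis using n by (simp add: nu_reflect int_pow_neg)
  qed (use assms gen_closed \<kappa>.hom_closed in \<open>simp add: nu_reflect \<kappa>_def\<close>)
  ultimately show ?thesis by (simp add: assms gen_pow mult.commute)
qed

section \<open>Images of vertices and face centres\<close>

definition flips :: "cube_vertex \<Rightarrow> 5 set" where
  "flips v = {j. \<not> v $ j}"

text \<open>The \<open>e_inf\<close> coefficient stays 1 or -1 and the \<open>e_four\<close>
  coefficient stays even, so each reflection adds 2 to the latter modulo 4, whatever its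
  sign.\<close>

lemma nu_vertex:
  "nu k (position (Vertex v)) = gen k (\<Prod>j\<in>flips v. color_sign k j) (2 * int (card (flips v))) 0"
proof -
  have "nu k (Finite_Set.fold reflect base_vertex S) = gen k (\<Prod>j\<in>S. color_sign k j) (2 * int (card S)) 0"
    if "finite S" for S
    using that
  proof induction
    case empty
    then show ?case using gen_generators(1) by (simp add: e_inf_def propagate_all_ones)
  next
    case (insert j S)
    let ?p = "\<Prod>j\<in>S. color_sign k j"
    have c: "color_sign k i = 1 \<or> color_sign k i = -1" for i by (simp add: color_sign_def)
    have "?p = 1 \<or> ?p = -1"
      using insert.hyps(1)
    proof induction
      case (insert i S)
      then show ?case using c[of i] by auto
    qed simp
    then have "[color_sign k j * (2 * ?p - 2 * int (card S)) = 2 * int (card (insert j S))] (mod 4)"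
      using c[of j] insert.hyps by (auto simp: cong_iff_dvd_diff; presburger)
    then show ?case
      using insert.hyps nu_reflect_gen[OF insert.IH, of j]
      by (simp add: gen_eq_iff)
  qed
  then show ?thesis by (simp add: propagate_def flips_def)
qed

lemma nu_face_propagate:
  assumes "nu k (base_face m) = gen k 0 b c"
  shows "nu k (position (face_center m v)) = gen k 0 (b * (\<Prod>j\<in>flips v. - color_sign k j)) c"
proof -
  have "nu k (Finite_Set.fold reflect (base_face m) S) = gen k 0 (b * (\<Prod>j\<in>S. - color_sign k j)) c"
    if "finite S" for S
    using that
  proof induction
    case empty
    then show ?case using assms by simp
  next
    case (insert j S)
    have "color_sign k j = 1 \<or> color_sign k j = -1" by (simp add: color_sign_def)
    then have "[color_sign k j * c = c] (mod 2)" by (auto simp: cong_iff_dvd_diff)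
    then show ?case
      using insert.hyps nu_reflect_gen[OF insert.IH, of j]
      by (simp add: gen_eq_iff mult_ac)
  qed
  then show ?thesis unfolding position_face_center by (simp add: propagate_def flips_def)
qed

lemma rainbow_cases: "m = k \<or> m = k + 1 \<or> m = k + 2 \<or> m = k + 3 \<or> m = k + 4"
  using exhaust_5[of "m - k"] by (auto simp: algebra_simps)

text \<open>Only faces with colours \<open>k + 3\<close>, \<open>k + 4\<close> map to points of
  order 4 and keep a sign. Elsewhere the coefficient is 2 or 0, and modulo 4 signs do not
  matter.\<close>

definition face_four :: "5 \<Rightarrow> cube_vertex \<Rightarrow> int" where
  "face_four m v = (if m = k + 3 then \<Prod>j\<in>flips v. - color_sign k j
     else if m = k + 4 \<or> m = k + 1 then 2 else 0)"

definition face_two :: "5 \<Rightarrow> int" where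
  "face_two m = (if m = k \<or> m = k + 1 then 1 else 0)"

lemma nu_face: "nu k (position (face_center m v)) = gen k 0 (face_four m v) (face_two m)"
proof -
  let ?p = "\<Prod>j\<in>flips v. - color_sign k j"
  have "finite S \<Longrightarrow> (\<Prod>j\<in>S. - color_sign k j) = 1 \<or> (\<Prod>j\<in>S. - color_sign k j) = -1" for S
    by (induction S rule: finite_induct) (auto simp: color_sign_def)
  then have "?p = 1 \<or> ?p = -1" by simp
  then have 2: "[2 * ?p = 2] (mod 4)" by (auto simp: cong_iff_dvd_diff)
  have e: "e_two k = nu k (base_face k)" "e_four k = nu k (base_face (k + 3))"
  proof -
    have k3: "k - 2 = k + 3" by (simp add: algebra_simps)
    show "e_two k = nu k (base_face k)" "e_four k = nu k (base_face (k + 3))"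
      by (simp_all only: e_two_def e_four_def position_face_center propagate_all_ones k3)
  qed
  show ?thesis
    using rainbow_cases[of m] 2 gen_face_center[THEN nu_face_propagate, of v]
      gen_generators(2,3)[unfolded e, symmetric, THEN nu_face_propagate, of v]
    by (elim disjE) (auto simp: face_four_def face_two_def gen_eq_iff simp del: position.simps)
qed

lemma gen_finprod:
  assumes "finite J" "\<And>i. i \<in> J \<Longrightarrow> x i = gen k (\<alpha> i) (\<beta> i) (\<gamma> i)"
  shows "finprod (EC k) (\<lambda>i. x i [^]\<^bsub>EC k\<^esub> (n i :: int)) J =
    gen k (\<Sum>i\<in>J. n i * \<alpha> i) (\<Sum>i\<in>J. n i * \<beta> i) (\<Sum>i\<in>J. n i * \<gamma> i)"
  using assms
proof (induction J rule: finite_induct)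
  case empty
  then show ?case by (simp add: gen_0)
next
  case (insert i J)
  have "x j [^]\<^bsub>EC k\<^esub> n j \<in> carrier (EC k)" if "j \<in> insert i J" for j
    using insert.prems[OF that] gen_closed by simp
  then have "finprod (EC k) (\<lambda>i. x i [^]\<^bsub>EC k\<^esub> n i) (insert i J) =
      x i [^]\<^bsub>EC k\<^esub> n i \<otimes>\<^bsub>EC k\<^esub> finprod (EC k) (\<lambda>i. x i [^]\<^bsub>EC k\<^esub> n i) J"
    using insert.hyps by (intro finprod_insert) auto
  then show ?case
    using insert by (simp add: gen_pow gen_mult mult.commute)
qed

text \<open>A 4-cycle has exactly one corner with both of its colours \<open>True\<close>, so each
  face centre is listed once.\<close>

definition face_reps :: "(5 \<times> cube_vertex) set" where
  "face_reps = {(m, v). v $ m \<and> v $ (m + 1)}"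

lemma inj_on_face_center: "inj_on (\<lambda>(m, v). face_center m v) face_reps"
proof (rule inj_onI, clarify)
  fix m v m' v'
  assume r: "(m, v) \<in> face_reps" "(m', v') \<in> face_reps" and f: "face_center m v = face_center m' v'"
  then have m: "m = m'" and "v' \<in> cycle4 m v" by (auto simp: face_center_def cycle4_def)
  moreover have "\<not> nbr m v $ m" "\<not> nbr m (nbr (m + 1) v) $ m" "\<not> nbr (m + 1) v $ (m + 1)"
    using r by (auto simp: face_reps_def nbr_def)
  ultimately show "m = m' \<and> v = v'" using r by (auto simp: cycle4_def face_reps_def)
qed

lemma face_center_rep:
  obtains w where "face_center m v = face_center m w" "(m, w) \<in> face_reps"
proof -
  have c: "cycle4 m (nbr m v) = cycle4 m v" "cycle4 m (nbr (m + 1) v) = cycle4 m v" for v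
    by (auto simp: cycle4_def nbr_nbr nbr_commute[of m "m + 1"])
  define u where "u = (if v $ m then v else nbr m v)"
  define w where "w = (if u $ (m + 1) then u else nbr (m + 1) u)"
  have "cycle4 m w = cycle4 m v" by (simp add: w_def u_def c)
  moreover have "w $ m" "w $ (m + 1)" by (auto simp: w_def u_def nbr_def)
  ultimately show ?thesis using that[of w] by (simp add: face_center_def face_reps_def)
qed

lemma nu_divisor_gen:
  assumes "\<And>p. D p \<noteq> 0 \<Longrightarrow> p \<in> range Vertex \<union> {face_center m v | m v. True}"
  shows "nu_divisor k D = gen k
    (\<Sum>v\<in>UNIV. D (Vertex v) * (\<Prod>j\<in>flips v. color_sign k j))
    ((\<Sum>v\<in>UNIV. D (Vertex v) * (2 * int (card (flips v)))) +
      (\<Sum>(m, v)\<in>face_reps. D (face_center m v) * face_four m v))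
    (\<Sum>(m, v)\<in>face_reps. D (face_center m v) * face_two m)"
proof -
  let ?fc = "\<lambda>(m, v). face_center m v" and ?x = "\<lambda>p. nu k (position p)"
  let ?y = "\<lambda>p. ?x p [^]\<^bsub>EC k\<^esub> D p"
  have inj: "inj_on Vertex UNIV" by (simp add: inj_on_def)
  have fin: "finite (range Vertex)" "finite (?fc ` face_reps)" by simp_all
  have cl: "?y p \<in> carrier (EC k)" if "p \<in> range Vertex \<union> ?fc ` face_reps" for p
    using that nu_position_carrier by (auto simp del: position.simps)
  have "{p. D p \<noteq> 0} \<subseteq> range Vertex \<union> ?fc ` face_reps"
  proof
    fix p assume "p \<in> {p. D p \<noteq> 0}"
    then consider "p \<in> range Vertex" | m v where "p = face_center m v" using assms by blast
    then show "p \<in> range Vertex \<union> ?fc ` face_reps"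
    proof cases
      case 2
      then show ?thesis using face_center_rep[of m v] by (metis UnI2 case_prod_conv image_eqI)
    qed simp
  qed
  then have "nu_divisor k D = finprod (EC k) ?y (range Vertex \<union> ?fc ` face_reps)"
    unfolding nu_divisor_def using fin cl by (intro finprod_mono_neutral_cong_left) auto
  also have "\<dots> = finprod (EC k) ?y (range Vertex) \<otimes>\<^bsub>EC k\<^esub> finprod (EC k) ?y (?fc ` face_reps)"
    using fin cl by (intro finprod_Un_disjoint) (auto simp: face_center_def)
  also have "finprod (EC k) ?y (range Vertex) = finprod (EC k) (\<lambda>v. ?x (Vertex v) [^]\<^bsub>EC k\<^esub> D (Vertex v)) UNIV"
    using cl inj by (intro finprod_reindex) auto
  also have "\<dots> = gen k (\<Sum>v\<in>UNIV. D (Vertex v) * (\<Prod>j\<in>flips v. color_sign k j))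
      (\<Sum>v\<in>UNIV. D (Vertex v) * (2 * int (card (flips v)))) (\<Sum>v\<in>UNIV. D (Vertex v) * 0)"
    by (rule gen_finprod) (simp_all only: finite nu_vertex)
  also have "finprod (EC k) ?y (?fc ` face_reps) =
      finprod (EC k) (\<lambda>i. ?x (?fc i) [^]\<^bsub>EC k\<^esub> D (?fc i)) face_reps"
    using cl inj_on_face_center by (intro finprod_reindex) auto
  also have "\<dots> = gen k (\<Sum>i\<in>face_reps. D (?fc i) * 0) (\<Sum>i\<in>face_reps. D (?fc i) * (case i of (m, v) \<Rightarrow> face_four m v))
      (\<Sum>i\<in>face_reps. D (?fc i) * (case i of (m, v) \<Rightarrow> face_two m))"
    by (rule gen_finprod) (auto simp: nu_face simp del: position.simps)
  finally show ?thesis by (simp add: gen_mult case_prod_unfold)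
qed

end

lemma morse_divisor_support:
  "morse_divisor h p \<noteq> 0 \<Longrightarrow> p \<in> range Vertex \<union> {face_center m v | m v. True}"
  by (auto simp: morse_divisor_def mesh_points_def split: if_splits)

section \<open>Diagonals of 2-faces and their parity\<close>

text \<open>The arguments are the coordinates \<open>k\<close>, \<open>k + 1\<close>, ...,
  \<open>k + 4\<close> in this order; this is how \<open>k\<close> disappears.\<close>

type_synonym cube_heights = "bool \<Rightarrow> bool \<Rightarrow> bool \<Rightarrow> bool \<Rightarrow> bool \<Rightarrow> int"

definition unit_steps :: "cube_heights \<Rightarrow> bool" where
  "unit_steps H \<longleftrightarrow> (\<forall>a b c d e.
     \<bar>H a b c d e - H (\<not> a) b c d e\<bar> = 1 \<and> \<bar>H a b c d e - H a (\<not> b) c d e\<bar> = 1 \<and>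
     \<bar>H a b c d e - H a b (\<not> c) d e\<bar> = 1 \<and> \<bar>H a b c d e - H a b c (\<not> d) e\<bar> = 1 \<and>
     \<bar>H a b c d e - H a b c d (\<not> e)\<bar> = 1)"

definition neq :: "int \<Rightarrow> int \<Rightarrow> int" where
  "neq x y = (if x = y then 0 else 1)"

lemma neq_commute: "neq x y = neq y x"
  by (simp add: neq_def)

definition sg :: "bool \<Rightarrow> int" where
  "sg b = (if b then 1 else -1)"

definition turns :: "cube_heights \<Rightarrow> cube_heights" where
  "turns H a b c d e =
     neq (H (\<not> a) b c d e) (H a (\<not> b) c d e) + neq (H a (\<not> b) c d e) (H a b (\<not> c) d e) +
     neq (H a b (\<not> c) d e) (H a b c (\<not> d) e) + neq (H a b c (\<not> d) e) (H a b c d (\<not> e)) +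
     neq (H a b c d (\<not> e)) (H (\<not> a) b c d e)"

definition kappa :: "cube_heights \<Rightarrow> cube_heights" where
  "kappa H a b c d e = turns H a b c d e div 2 - 1"

definition falses :: "bool \<Rightarrow> bool \<Rightarrow> bool \<Rightarrow> bool \<Rightarrow> bool \<Rightarrow> int" where
  "falses a b c d e = of_bool (\<not> a) + of_bool (\<not> b) + of_bool (\<not> c) + of_bool (\<not> d) + of_bool (\<not> e)"

text \<open>With unit steps around the cycle at least one diagonal is level. Both are level in a
  bow-tie, giving 1, and exactly one in a diamond, giving 0.\<close>

definition bow :: "int \<Rightarrow> int \<Rightarrow> int \<Rightarrow> int \<Rightarrow> int" where
  "bow p q r s = 1 - neq p r - neq q s"

text \<open>It tells which diagonal is slanted: 0 for a bow-tie, 1 or -1 for the two kinds of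
  diamond.\<close>

definition tau :: "int \<Rightarrow> int \<Rightarrow> int \<Rightarrow> int \<Rightarrow> int" where
  "tau p q r s = neq q s - neq p r"

text \<open>The neighbours of a vertex take only two heights, so a cyclic tour changes between them
  an even number of times.\<close>

lemma two_kappa: "unit_steps H \<Longrightarrow> 2 * kappa H a b c d e = turns H a b c d e - 2"
proof -
  assume H: "unit_steps H"
  have "even (neq v w + neq w x + neq x y + neq y z + neq z v)"
    if "\<bar>u - v\<bar> = 1" "\<bar>u - w\<bar> = 1" "\<bar>u - x\<bar> = 1" "\<bar>u - y\<bar> = 1" "\<bar>u - z\<bar> = 1" for u v w x y z :: int
  proof -
    have "v = u + 1 \<or> v = u - 1" "w = u + 1 \<or> w = u - 1" "x = u + 1 \<or> x = u - 1"
      "y = u + 1 \<or> y = u - 1" "z = u + 1 \<or> z = u - 1"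
      using that by arith+
    then show ?thesis by (elim disjE) (simp_all add: neq_def)
  qed
  then have "even (turns H a b c d e)"
    using H unfolding unit_steps_def turns_def by blast
  then show ?thesis by (auto simp: kappa_def elim!: evenE)
qed

lemma sum_bool: "sum f (UNIV :: bool set) = f True + f False"
  by (simp add: UNIV_bool add.commute)

text \<open>
  Opposite corners of a 2-face see the same diagonal.  The signs of the two corners cancel unless the
  two colours of the face are the last two.
\<close>

lemma sum_signed_kappa:
  assumes "unit_steps H"
  shows "(\<Sum>a\<in>UNIV. \<Sum>b\<in>UNIV. \<Sum>c\<in>UNIV. \<Sum>d\<in>UNIV. \<Sum>e\<in>UNIV. kappa H a b c d e * (sg b * sg d * sg e)) =
    (\<Sum>a\<in>UNIV. \<Sum>b\<in>UNIV. \<Sum>c\<in>UNIV. sg b *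
      tau (H a b c True True) (H a b c False True) (H a b c False False) (H a b c True False))"
    (is "?l = ?r")
proof -
  have "2 * ?l = (\<Sum>a\<in>UNIV. \<Sum>b\<in>UNIV. \<Sum>c\<in>UNIV. \<Sum>d\<in>UNIV. \<Sum>e\<in>UNIV.
      (turns H a b c d e - 2) * (sg b * sg d * sg e))"
    unfolding two_kappa[OF assms, symmetric] by (simp add: sum_distrib_left mult.assoc)
  \<comment> \<open>The summand 2 disappears because the signs add up to zero over the cube.\<close>
  also have "\<dots> = 2 * ?r"
    by (simp add: sum_bool sg_def turns_def tau_def neq_commute)
  finally show ?thesis by simp
qed

definition white :: "bool \<Rightarrow> bool \<Rightarrow> bool \<Rightarrow> bool \<Rightarrow> bool \<Rightarrow> bool" where
  "white a b c d e \<longleftrightarrow> (a = (b = (c = (d = e))))"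

lemma white_iff_even: "white a b c d e \<longleftrightarrow> even (falses a b c d e)"
  by (cases a; cases b; cases c; cases d; cases e) (simp_all add: white_def falses_def)

lemma heights_parity:
  assumes "unit_steps H"
  shows "even (H a b c d e - H True True True True True) \<longleftrightarrow> white a b c d e"
proof -
  have o: "odd x \<longleftrightarrow> even y" if "\<bar>x - y\<bar> = 1" for x y :: int
    using that by presburger
  have s: "odd (H (\<not> a) b c d e) = even (H a b c d e)" "odd (H a (\<not> b) c d e) = even (H a b c d e)"
    "odd (H a b (\<not> c) d e) = even (H a b c d e)" "odd (H a b c (\<not> d) e) = even (H a b c d e)"
    "odd (H a b c d (\<not> e)) = even (H a b c d e)" for a b c d e
    using assms o unfolding unit_steps_def by blast+
  have "odd (H a b c d e) = (odd (H True b c d e) = a)"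
    using s(1)[of True b c d e] by (cases a) auto
  moreover have "odd (H True b c d e) = (odd (H True True c d e) = b)"
    using s(2)[of True True c d e] by (cases b) auto
  moreover have "odd (H True True c d e) = (odd (H True True True d e) = c)"
    using s(3)[of True True True d e] by (cases c) auto
  moreover have "odd (H True True True d e) = (odd (H True True True True e) = d)"
    using s(4)[of True True True True e] by (cases d) auto
  moreover have "odd (H True True True True e) = (odd (H True True True True True) = e)"
    using s(5)[of True True True True True] by (cases e) auto
  ultimately show ?thesis by (auto simp: white_def)
qed

definition white_sum :: "cube_heights \<Rightarrow> int" where
  "white_sum G = (\<Sum>x\<in>UNIV. \<Sum>y\<in>UNIV. \<Sum>z\<in>UNIV. \<Sum>u\<in>UNIV. \<Sum>v\<in>UNIV. if white x y z u v then G x y z u v else 0)"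

definition black_sum :: "cube_heights \<Rightarrow> int" where
  "black_sum G = (\<Sum>x\<in>UNIV. \<Sum>y\<in>UNIV. \<Sum>z\<in>UNIV. \<Sum>u\<in>UNIV. \<Sum>v\<in>UNIV. if white x y z u v then 0 else G x y z u v)"

text \<open>Each 2-face in the last two colours has one diagonal with white ends and one with black
  ends. The slanted white ones are counted here.\<close>

definition white_diagonals :: "cube_heights \<Rightarrow> int" where
  "white_diagonals G = (\<Sum>x\<in>UNIV. \<Sum>y\<in>UNIV. \<Sum>z\<in>UNIV.
     if white x y z True True then neq (G x y z True True) (G x y z False False)
     else neq (G x y z True False) (G x y z False True))"

definition black_diagonals :: "cube_heights \<Rightarrow> int" where
  "black_diagonals G = (\<Sum>x\<in>UNIV. \<Sum>y\<in>UNIV. \<Sum>z\<in>UNIV.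
     if white x y z True True then neq (G x y z True False) (G x y z False True)
     else neq (G x y z True True) (G x y z False False))"

text \<open>For one diagonal with end heights \<open>x\<close>, \<open>y\<close>,
  \<open>2 * neq x y\<close> is \<open>x + y - 2 * z\<close> modulo 4 for any \<open>z\<close> of
  the parity of \<open>x\<close>. The eight diagonals of one colour partition the vertices of that
  colour, and the eight corrections \<open>2 * z\<close> add up to a multiple of 16.\<close>

lemma diagonals_mod_4:
  assumes "unit_steps G"
  shows "4 dvd 2 * white_diagonals G - white_sum G" "4 dvd 2 * black_diagonals G - black_sum G"
proof -
  define g where "g = G True True True True True"
  have n: "4 dvd 2 * neq x y - (x + y) + 2 * z" if "\<bar>w - x\<bar> = 1" "\<bar>w - y\<bar> = 1" "even (x - z)" for w x y z :: int
  proof -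
    have "x = y \<or> x = y + 2 \<or> y = x + 2" using that(1,2) by arith
    then have "neq x y = 0 \<and> x = y \<or> neq x y = 1 \<and> (x = y + 2 \<or> y = x + 2)"
      by (auto simp: neq_def)
    moreover have "4 dvd 2 * n - (x + y) + 2 * z" if "n = 0 \<and> x = y \<or> n = 1 \<and> (x = y + 2 \<or> y = x + 2)" for n
      using that \<open>even (x - z)\<close> by presburger
    ultimately show ?thesis by blast
  qed
  have st: "\<bar>G x y z u v - G x y z (\<not> u) v\<bar> = 1" "\<bar>G x y z u v - G x y z u (\<not> v)\<bar> = 1" for x y z u v
    using assms unfolding unit_steps_def by blast+
  have drop: "4 dvd t" if "4 dvd t + 16 * w" for t w :: int
    using that by presburger
  have d1: "4 dvd 2 * neq (G x y z True True) (G x y z False False) - (G x y z True True + G x y z False False) + 2 * w"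
    if "even (G x y z True True - w)" for x y z w
    using n[OF _ _ that] st(1)[of x y z False True] st(2)[of x y z False True] by simp
  have d2: "4 dvd 2 * neq (G x y z True False) (G x y z False True) - (G x y z True False + G x y z False True) + 2 * w"
    if "even (G x y z True False - w)" for x y z w
    using st(1)[of x y z True True] st(2)[of x y z True True]
    by (intro n[OF _ _ that, of "G x y z True True"]) simp_all
  note par = heights_parity[OF assms, folded g_def]
  define g' where "g' = g + 1"
  have par': "even (G x y z u v - g') \<longleftrightarrow> \<not> white x y z u v" for x y z u v
  proof -
    have t: "even (t - (g + 1)) \<longleftrightarrow> \<not> even (t - g)" for t by presburger
    show ?thesis unfolding g'_def t par ..
  qed
  have fl: "white x y z True False \<longleftrightarrow> \<not> white x y z True True" for x y z
    by (auto simp: white_def)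
  have "4 dvd (\<Sum>x\<in>UNIV. \<Sum>y\<in>UNIV. \<Sum>z\<in>UNIV. if white x y z True True
      then 2 * neq (G x y z True True) (G x y z False False) - (G x y z True True + G x y z False False) + 2 * g
      else 2 * neq (G x y z True False) (G x y z False True) - (G x y z True False + G x y z False True) + 2 * g)"
    using d1 d2 par fl by (intro dvd_sum) auto
  also have "\<dots> = 2 * white_diagonals G - white_sum G + 16 * g"
    by (simp add: white_diagonals_def white_sum_def white_def sum_bool)
  finally show "4 dvd 2 * white_diagonals G - white_sum G" by (rule drop)
  have "4 dvd (\<Sum>x\<in>UNIV. \<Sum>y\<in>UNIV. \<Sum>z\<in>UNIV. if white x y z True True
      then 2 * neq (G x y z True False) (G x y z False True) - (G x y z True False + G x y z False True) + 2 * g'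
      else 2 * neq (G x y z True True) (G x y z False False) - (G x y z True True + G x y z False False) + 2 * g')"
    using d1 d2 par' fl by (intro dvd_sum) auto
  also have "\<dots> = 2 * black_diagonals G - black_sum G + 16 * g'"
    by (simp add: black_diagonals_def black_sum_def white_def sum_bool)
  finally show "4 dvd 2 * black_diagonals G - black_sum G" by (rule drop)
qed

text \<open>Iteration brings the colour pairs \<open>(k + 4, k)\<close>, \<open>(k, k + 1)\<close>,
  \<open>(k + 1, k + 2)\<close>, \<open>(k + 2, k + 3)\<close> in turn to the last two
  arguments.\<close>

definition cycle_colors :: "cube_heights \<Rightarrow> cube_heights" where
  "cycle_colors H x y z u v = H v x y z u"

lemma cycle_colors_invariants:
  "unit_steps H \<Longrightarrow> unit_steps (cycle_colors H)"
  "white_sum (cycle_colors H) = white_sum H" "black_sum (cycle_colors H) = black_sum H"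
  by (auto simp: unit_steps_def cycle_colors_def white_sum_def black_sum_def white_def sum_bool)

definition bow_count :: "cube_heights \<Rightarrow> int" where
  "bow_count G = (\<Sum>x\<in>UNIV. \<Sum>y\<in>UNIV. \<Sum>z\<in>UNIV.
     bow (G x y z True True) (G x y z False True) (G x y z False False) (G x y z True False))"

lemma bow_count_diagonals: "bow_count G = 8 - white_diagonals G - black_diagonals G"
  by (simp add: bow_count_def bow_def white_diagonals_def black_diagonals_def white_def sum_bool neq_commute)

definition signed_bow_count :: "cube_heights \<Rightarrow> int" where
  "signed_bow_count H = (\<Sum>a\<in>UNIV. \<Sum>b\<in>UNIV. \<Sum>c\<in>UNIV. sg a * sg c *
     bow (H a b c True True) (H a b c False True) (H a b c False False) (H a b c True False))"

text \<open>This sum is the coefficient of \<open>e_two\<close>. The white counts of the two colour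
  pairs have equal parity, and so do the black ones.\<close>

lemma bow_counts_even:
  assumes "unit_steps H"
  shows "even (bow_count (cycle_colors (cycle_colors H)) + bow_count (cycle_colors (cycle_colors (cycle_colors H))))"
proof -
  let ?G = "cycle_colors (cycle_colors H)"
  have "unit_steps ?G" "unit_steps (cycle_colors ?G)" using assms cycle_colors_invariants(1) by blast+
  from this[THEN diagonals_mod_4(1)] this[THEN diagonals_mod_4(2)]
  have "4 dvd 2 * white_diagonals ?G - white_sum H" "4 dvd 2 * black_diagonals ?G - black_sum H"
    "4 dvd 2 * white_diagonals (cycle_colors ?G) - white_sum H" "4 dvd 2 * black_diagonals (cycle_colors ?G) - black_sum H"
    by (simp_all only: cycle_colors_invariants(2,3))
  moreover have "even (8 - w - b + (8 - w' - b'))"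
    if "4 dvd 2 * w - s" "4 dvd 2 * b - t" "4 dvd 2 * w' - s" "4 dvd 2 * b' - t" for w b w' b' s t :: int
    using that by presburger
  ultimately show ?thesis unfolding bow_count_diagonals by blast
qed


text \<open>The first sum is the coefficient of \<open>e_inf\<close> and the other terms form that
  of \<open>e_four\<close>, so this is \<open>b = - a\<close> modulo 4.\<close>

lemma torsion_balance:
  assumes "unit_steps H"
  defines "\<Sigma>\<kappa> \<equiv> \<lambda>w. \<Sum>a\<in>UNIV. \<Sum>b\<in>UNIV. \<Sum>c\<in>UNIV. \<Sum>d\<in>UNIV. \<Sum>e\<in>UNIV. kappa H a b c d e * w a b c d e"
  shows "4 dvd (\<Sigma>\<kappa> (\<lambda>a b c d e. sg b * sg d * sg e) + \<Sigma>\<kappa> (\<lambda>a b c d e. 2 * falses a b c d e) +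
    signed_bow_count H + 2 * bow_count (cycle_colors H) + 2 * bow_count (cycle_colors (cycle_colors (cycle_colors H))))"
proof -
  define G1 G2 G3 G4 where "G1 = cycle_colors H" and "G2 = cycle_colors G1" and "G3 = cycle_colors G2"
    and "G4 = cycle_colors G3"
  note G = G1_def G2_def G3_def G4_def
  have u: "unit_steps G1" "unit_steps G2" "unit_steps G3" "unit_steps G4"
    using assms(1) unfolding G by (blast intro: cycle_colors_invariants(1))+
  have w: "4 dvd 2 * white_diagonals G - white_sum H" "4 dvd 2 * black_diagonals G - black_sum H"
    if "G \<in> {G1, G2, G3, G4}" for G
    using that u[THEN diagonals_mod_4(1)] u[THEN diagonals_mod_4(2)]
    by (auto simp: G cycle_colors_invariants)
  \<comment> \<open>Modulo 4 only the parity of \<open>falses\<close> matters: white vertices drop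
    out and black ones contribute twice their \<open>kappa\<close>.\<close>
  have m: "4 dvd 2 * (kappa H a b c d e * falses a b c d e) - (if white a b c d e then 0 else turns H a b c d e - 2)" for a b c d e
  proof -
    have "4 dvd 2 * (x * n) - (if even n then 0 else 2 * x)" for x n :: int
    proof (cases "even n")
      case False
      then obtain t where "n = 2 * t + 1" by (elim oddE)
      then have "2 * (x * n) - 2 * x = 4 * (x * t)" by (simp add: algebra_simps)
      then show ?thesis using False by simp
    qed (auto elim!: evenE)
    then show ?thesis unfolding white_iff_even two_kappa[OF assms(1), symmetric] .
  qed
  define V where "V = (\<Sum>a\<in>UNIV. \<Sum>b\<in>UNIV. \<Sum>c\<in>UNIV. \<Sum>d\<in>UNIV. \<Sum>e\<in>UNIV.
      if white a b c d e then 0 else turns H a b c d e - 2)"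
  have "4 dvd (\<Sum>a\<in>UNIV. \<Sum>b\<in>UNIV. \<Sum>c\<in>UNIV. \<Sum>d\<in>UNIV. \<Sum>e\<in>UNIV.
      2 * (kappa H a b c d e * falses a b c d e) - (if white a b c d e then 0 else turns H a b c d e - 2))"
    by (intro dvd_sum m)
  then have V: "4 dvd \<Sigma>\<kappa> (\<lambda>a b c d e. 2 * falses a b c d e) - V"
    unfolding V_def \<Sigma>\<kappa>_def by (simp only: sum_subtractf mult.left_commute)
  define W where "W = (\<Sum>a\<in>UNIV. \<Sum>b\<in>UNIV. \<Sum>c\<in>UNIV. (if sg a * sg c = 1 then 0 else
     if white a b c True True then neq (H a b c True True) (H a b c False False)
     else neq (H a b c True False) (H a b c False True)))"
  \<comment> \<open>A black vertex compares white neighbours. Each slanted white diagonal is seen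
    from the two black corners of its face, and the 16 black vertices account for the 32.\<close>
  have "V = 2 * (white_diagonals H + white_diagonals G1 + white_diagonals G2 + white_diagonals G3 + white_diagonals G4) - 32"
    unfolding V_def G
    by (simp add: turns_def white_diagonals_def cycle_colors_def white_def sum_bool neq_commute)
  \<comment> \<open>Black diagonals cancel between the two sums, because
    \<open>sg b = sg a * sg c\<close> decides which diagonal is white. White ones get coefficient
    \<open>-2\<close> or, where \<open>sg a * sg c = -1\<close>, \<open>2\<close>; the difference is
    collected in \<open>W\<close>.\<close>
  moreover have "\<Sigma>\<kappa> (\<lambda>a b c d e. sg b * sg d * sg e) + signed_bow_count H = 4 * W - 2 * white_diagonals H"
    unfolding \<Sigma>\<kappa>_def sum_signed_kappa[OF assms(1)]
    by (simp add: W_def signed_bow_count_def white_diagonals_def tau_def bow_def sg_def white_def sum_bool neq_commute)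
  \<comment> \<open>What remains modulo 4 is \<open>2 * (w2 + w4) - 2 * (b1 + b3)\<close>, and both
    brackets are even by \<open>diagonals_mod_4\<close>.\<close>
  moreover have "4 dvd x + y + s + 2 * (8 - w1 - b1) + 2 * (8 - w3 - b3)"
    if "4 dvd y - V" "V = 2 * (w0 + w1 + w2 + w3 + w4) - 32" "x + s = 4 * W - 2 * w0"
      "4 dvd 2 * w2 - t" "4 dvd 2 * w4 - t" "4 dvd 2 * b1 - t'" "4 dvd 2 * b3 - t'"
    for x y s w0 w1 w2 w3 w4 b1 b3 V W t t' :: int
    using that by presburger
  ultimately show ?thesis
    using V w(1)[of G2] w(1)[of G4] w(2)[of G1] w(2)[of G3]
    unfolding bow_count_diagonals G1_def[symmetric] G2_def[symmetric] G3_def[symmetric] by blast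
qed

section \<open>Counting closed walks of 3-cube heights\<close>

definition near :: "int \<Rightarrow> int \<Rightarrow> bool" where
  "near x y \<longleftrightarrow> x - y = 1 \<or> y - x = 1"

text \<open>
  A fiber lists the heights on a 4-cycle with the last two colours in cyclic order, and a layer is a
  height function on a 3-cube, given by its two opposite fibers.
\<close>

type_synonym fiber = "(int \<times> int) \<times> int \<times> int"

text \<open>The sides \<open>p q\<close> and \<open>r s\<close> have been tested by
  \<open>edges\<close>.\<close>

fun closed_fiber :: "fiber \<Rightarrow> bool" where
  "closed_fiber ((p, q), r, s) \<longleftrightarrow> near q r \<and> near s p"

fun near_fiber :: "fiber \<Rightarrow> fiber \<Rightarrow> bool" where
  "near_fiber ((p, q), r, s) ((p', q'), r', s') \<longleftrightarrow> near p p' \<and> near q q' \<and> near r r' \<and> near s s'"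

fun fiber_weight :: "fiber \<Rightarrow> int" where
  "fiber_weight ((p, q), r, s) = (if q = s then 0 else 1) - (if p = r then 0 else 1)"

definition edges :: "int list \<Rightarrow> int list \<Rightarrow> (int \<times> int) list" where
  "edges ps qs = filter (\<lambda>(p, q). near p q) (List.product ps qs)"

definition fibers :: "int list \<Rightarrow> int list \<Rightarrow> int list \<Rightarrow> int list \<Rightarrow> fiber list" where
  "fibers ps qs rs ss = filter closed_fiber (List.product (edges ps qs) (edges rs ss))"

type_synonym layer = "fiber \<times> fiber"

definition layers :: "fiber list \<Rightarrow> fiber list \<Rightarrow> layer list" where
  "layers xs ys = filter (\<lambda>(x, y). near_fiber x y) (List.product xs ys)"

fun layer_weight :: "layer \<Rightarrow> int" where
  "layer_weight (x, y) = fiber_weight x - fiber_weight y"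

definition fibers_at :: "int \<Rightarrow> fiber list" where
  "fibers_at p = fibers [p] [p - 1, p + 1] [p - 2, p, p + 2] [p - 1, p + 1]"

definition layers_at :: "int \<Rightarrow> layer list" where
  "layers_at p = layers (fibers_at p) (fibers_at (p - 1) @ fibers_at (p + 1))"

definition mids :: "int \<Rightarrow> int \<Rightarrow> int list" where
  "mids x z = filter (near z) [x - 1, x + 1]"

fun mid_fibers :: "fiber \<Rightarrow> fiber \<Rightarrow> fiber list" where
  "mid_fibers ((p, q), r, s) ((p', q'), r', s') = fibers (mids p p') (mids q q') (mids r r') (mids s s')"

fun mid_layers :: "layer \<Rightarrow> layer \<Rightarrow> layer list" where
  "mid_layers (x, y) (x', y') = layers (mid_fibers x x') (mid_fibers y y')"

definition tally :: "int list \<Rightarrow> int \<Rightarrow> int" where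
  "tally ws u = sum_list (map (\<lambda>w. if w = u then 1 else 0) ws)"

text \<open>The coefficients of the square of a polynomial of degree 4, that is, the distribution of
  the sum of two independent weights.\<close>

fun square5 :: "int list \<Rightarrow> int list" where
  "square5 [a, b, c, d, e] = [a * a, 2 * a * b, 2 * a * c + b * b, 2 * (a * d + b * c),
     2 * (a * e + b * d) + c * c, 2 * (b * e + c * d), 2 * c * e + d * d, 2 * d * e, e * e]"
| "square5 _ = []"

fun add_lists :: "int list \<Rightarrow> int list \<Rightarrow> int list" where
  "add_lists (x # xs) (y # ys) = (x + y) # add_lists xs ys"
| "add_lists [] ys = ys"
| "add_lists xs [] = xs"

text \<open>The layers \<open>y\<close> and \<open>w\<close> range independently over the common
  neighbours of \<open>x\<close> and \<open>z\<close>. Without common neighbours the result is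
  \<open>[]\<close>, a neutral element of \<open>add_lists\<close>.\<close>

definition pair_counts :: "layer \<Rightarrow> layer \<Rightarrow> int list" where
  "pair_counts x z = (case mid_layers x z of [] \<Rightarrow> []
     | ys \<Rightarrow> let ws = map layer_weight ys in square5 (map (tally ws) [-2, -1, 0, 1, 2]))"

text \<open>
  Entry \<open>i\<close> counts the closed walks \<open>x, y, z, w\<close> through given \<open>x\<close> and \<open>z\<close> in which \<open>y\<close> and \<open>w\<close> have
  total weight \<open>i - 4\<close>.
\<close>

definition cycle_table :: "layer list \<Rightarrow> layer list \<Rightarrow> int list" where
  "cycle_table xs zs = foldr (\<lambda>(x, z). add_lists (pair_counts x z)) (List.product xs zs) []"

text \<open>
  Besides the height 0 at the base vertex, the height 1 at one neighbour is fixed, as negation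
  exchanges the two possible heights there.
\<close>

definition start_layers :: "int \<Rightarrow> layer list" where
  "start_layers w = filter (\<lambda>x. layer_weight x = w)
     (layers (fibers [0] [1] [-2, 0, 2] [-1, 1]) (fibers_at (-1) @ fibers_at 1))"

text \<open>The base of the opposite layer is two steps from height 0.\<close>

definition opposite_layers :: "int \<Rightarrow> layer list" where
  "opposite_layers w = filter (\<lambda>x. layer_weight x = w) (layers_at (-2) @ layers_at 0 @ layers_at 2)"

section \<open>Completeness and distinctness of the enumerated fibers and layers\<close>

fun fiber_ok :: "fiber \<Rightarrow> bool" where
  "fiber_ok ((p, q), r, s) \<longleftrightarrow> near p q \<and> near q r \<and> near r s \<and> near s p"

fun layer_ok :: "layer \<Rightarrow> bool" where
  "layer_ok (x, y) \<longleftrightarrow> fiber_ok x \<and> fiber_ok y \<and> near_fiber x y"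

fun near_layer :: "layer \<Rightarrow> layer \<Rightarrow> bool" where
  "near_layer (x, y) (x', y') \<longleftrightarrow> near_fiber x x' \<and> near_fiber y y'"

lemma near_commute: "near x y = near y x"
  by (auto simp: near_def)

lemma set_fibers:
  "((p, q), r, s) \<in> set (fibers ps qs rs ss) \<longleftrightarrow>
     fiber_ok ((p, q), r, s) \<and> p \<in> set ps \<and> q \<in> set qs \<and> r \<in> set rs \<and> s \<in> set ss"
  by (auto simp: fibers_def edges_def)

lemma set_fibers_at: "f \<in> set (fibers_at p0) \<longleftrightarrow> fiber_ok f \<and> fst (fst f) = p0"
proof -
  obtain p q r s where f: "f = ((p, q), r, s)" by (metis surj_pair)
  have "near p q \<Longrightarrow> q = p - 1 \<or> q = p + 1" "near q r \<Longrightarrow> r = q - 1 \<or> r = q + 1"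
    "near s p \<Longrightarrow> s = p - 1 \<or> s = p + 1" by (auto simp: near_def)
  then show ?thesis by (auto simp: f fibers_at_def set_fibers)
qed

lemma set_layers: "(x, y) \<in> set (layers xs ys) \<longleftrightarrow> x \<in> set xs \<and> y \<in> set ys \<and> near_fiber x y"
  by (auto simp: layers_def)

lemma near_fiber_base: "near_fiber x y \<Longrightarrow> near (fst (fst x)) (fst (fst y))"
  by (cases "(x, y)" rule: near_fiber.cases) auto

lemma set_layers_at: "x \<in> set (layers_at p0) \<longleftrightarrow> layer_ok x \<and> fst (fst (fst x)) = p0"
proof -
  obtain f g where x: "x = (f, g)" by (metis surj_pair)
  have "fst (fst g) = fst (fst f) - 1 \<or> fst (fst g) = fst (fst f) + 1" if "near_fiber f g"
    using near_fiber_base[OF that] by (auto simp: near_def)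
  then show ?thesis by (auto simp: x layers_at_def set_layers set_fibers_at)
qed

lemma set_mids: "y \<in> set (mids x z) \<longleftrightarrow> near x y \<and> near y z"
  by (auto simp: mids_def near_def)

lemma set_mid_fibers: "f \<in> set (mid_fibers x z) \<longleftrightarrow> fiber_ok f \<and> near_fiber x f \<and> near_fiber f z"
  by (cases "(x, z)" rule: mid_fibers.cases; cases f) (auto simp: set_fibers set_mids)

lemma set_mid_layers: "y \<in> set (mid_layers x z) \<longleftrightarrow> layer_ok y \<and> near_layer x y \<and> near_layer y z"
  by (cases x; cases z; cases y) (auto simp: set_layers set_mid_fibers)

lemma distinct_fibers:
  "distinct ps \<Longrightarrow> distinct qs \<Longrightarrow> distinct rs \<Longrightarrow> distinct ss \<Longrightarrow> distinct (fibers ps qs rs ss)"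
  by (simp add: fibers_def edges_def distinct_product)

lemma distinct_layers: "distinct xs \<Longrightarrow> distinct ys \<Longrightarrow> distinct (layers xs ys)"
  by (simp add: layers_def distinct_product)

lemma distinct_fibers_at: "distinct (fibers_at p)"
  by (simp add: fibers_at_def distinct_fibers)

lemma distinct_fibers_two: "p \<noteq> p' \<Longrightarrow> distinct (fibers_at p @ fibers_at p')"
  by (auto simp: distinct_fibers_at set_fibers_at)

lemma distinct_layers_at: "distinct (layers_at p)"
  unfolding layers_at_def by (intro distinct_layers distinct_fibers_at distinct_fibers_two) simp

lemma distinct_mid_layers: "distinct (mid_layers x z)"
proof -
  have "distinct (mids a b)" for a b by (simp add: mids_def)
  then have "distinct (mid_fibers f g)" for f g
    by (cases "(f, g)" rule: mid_fibers.cases) (simp add: distinct_fibers)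
  then show ?thesis by (cases x; cases z) (simp add: distinct_layers)
qed

lemma distinct_start_layers: "distinct (start_layers w)"
  unfolding start_layers_def
  by (intro distinct_filter distinct_layers distinct_fibers distinct_fibers_two) simp_all

lemma distinct_opposite_layers: "distinct (opposite_layers w)"
  unfolding opposite_layers_def
  by (intro distinct_filter) (auto simp: distinct_layers_at set_layers_at)

lemma set_start_layers:
  "x \<in> set (start_layers w) \<longleftrightarrow> layer_weight x = w \<and> layer_ok x \<and> fst (fst x) = (0, 1)"
proof -
  obtain p q r s g where x: "x = (((p, q), r, s), g)" by (metis surj_pair)
  have "near q r \<Longrightarrow> r = q - 1 \<or> r = q + 1" "near s p \<Longrightarrow> s = p - 1 \<or> s = p + 1"
    "near_fiber ((p, q), r, s) g \<Longrightarrow> fst (fst g) = p - 1 \<or> fst (fst g) = p + 1"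
    using near_fiber_base[of "((p, q), r, s)" g] by (auto simp: near_def)
  then show ?thesis
    by (auto simp: x start_layers_def set_layers set_fibers set_fibers_at near_def)
qed

lemma set_opposite_layers:
  "z \<in> set (opposite_layers w) \<longleftrightarrow>
     layer_weight z = w \<and> layer_ok z \<and> fst (fst (fst z)) \<in> {-2, 0, 2}"
  by (auto simp: opposite_layers_def set_layers_at)

lemma layer_weight_range: "layer_weight x \<in> {-2, -1, 0, 1, 2}"
proof -
  have "fiber_weight f \<in> {-1, 0, 1}" for f
    by (cases f rule: fiber_weight.cases) auto
  moreover have "a - b \<in> {-2, -1, 0, 1, 2}" if "a \<in> {-1, 0, 1}" "b \<in> {-1, 0, 1}" for a b :: int
    using that by auto
  ultimately show ?thesis by (metis layer_weight.simps surj_pair)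
qed

fun coef :: "int list \<Rightarrow> nat \<Rightarrow> int" where
  "coef [] n = 0"
| "coef (x # xs) 0 = x"
| "coef (x # xs) (Suc n) = coef xs n"

text \<open>Joint weights start at \<open>-4\<close>, stored at position 0. The explicit test is
  needed below that, where \<open>nat\<close> would truncate to position 0; beyond the end
  \<open>coef\<close> returns 0.\<close>

definition centered_coef :: "int list \<Rightarrow> int \<Rightarrow> int" where
  "centered_coef xs n = (if n < -4 then 0 else coef xs (nat (n + 4)))"

lemma coef_add_lists: "coef (add_lists xs ys) n = coef xs n + coef ys n"
proof (induction xs ys arbitrary: n rule: add_lists.induct)
  case (1 x xs y ys)
  then show ?case by (cases n) auto
qed auto

lemma centered_coef_add_lists:
  "centered_coef (add_lists xs ys) n = centered_coef xs n + centered_coef ys n"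
  by (simp add: centered_coef_def coef_add_lists)

lemma centered_coef_cycle_table:
  "centered_coef (cycle_table xs zs) n = (\<Sum>x\<leftarrow>xs. \<Sum>z\<leftarrow>zs. centered_coef (pair_counts x z) n)"
proof -
  have "centered_coef (foldr (\<lambda>(x, z). add_lists (pair_counts x z)) ps []) n =
      (\<Sum>(x, z)\<leftarrow>ps. centered_coef (pair_counts x z) n)" for ps
    by (induction ps) (auto simp: centered_coef_add_lists, simp add: centered_coef_def)
  moreover have "(\<Sum>(x, z)\<leftarrow>List.product xs zs. f x z) = (\<Sum>x\<leftarrow>xs. \<Sum>z\<leftarrow>zs. f x z)" for f :: "_ \<Rightarrow> _ \<Rightarrow> int"
    by (induction xs) (auto simp: o_def)
  ultimately show ?thesis by (simp add: cycle_table_def)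
qed

lemma tally_eq_card: "distinct ys \<Longrightarrow> tally (map f ys) u = int (card {y \<in> set ys. f y = u})"
proof (induction ys)
  case (Cons y ys)
  have "{x \<in> set (y # ys). f x = u} = (if f y = u then insert y else id) {x \<in> set ys. f x = u}"
    by auto
  then show ?case using Cons by (simp add: tally_def)
qed (simp add: tally_def)

lemma card_pairs:
  fixes f :: "'a \<Rightarrow> int"
  assumes "finite S" "finite U" "\<And>y. f y \<in> U"
  shows "card {(y, w) \<in> S \<times> S. f y + f w = n} = (\<Sum>u\<in>U. card {y \<in> S. f y = u} * card {y \<in> S. f y = n - u})"
proof -
  have "{(y, w) \<in> S \<times> S. f y + f w = n} = (\<Union>u\<in>U. {y \<in> S. f y = u} \<times> {y \<in> S. f y = n - u})"
    using assms(3) by auto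
  also have "card \<dots> = (\<Sum>u\<in>U. card ({y \<in> S. f y = u} \<times> {y \<in> S. f y = n - u}))"
    using assms(1,2) by (intro card_UN_disjoint) auto
  finally show ?thesis by (simp only: card_cartesian_product)
qed

lemma centered_coef_pair_counts:
  "centered_coef (pair_counts x z) n = int (card {(y, w) \<in> set (mid_layers x z) \<times> set (mid_layers x z).
     layer_weight y + layer_weight w = n})"
proof -
  define ws where "ws = map layer_weight (mid_layers x z)"
  define t where "t = tally ws"
  have t: "t u = int (card {y \<in> set (mid_layers x z). layer_weight y = u})" for u
    unfolding t_def ws_def by (rule tally_eq_card[OF distinct_mid_layers])
  have t0: "t u = 0" if "u \<notin> {-2, -1, 0, 1, 2}" for u
    using layer_weight_range that unfolding t by (metis (mono_tags, lifting) card.empty empty_Collect_eq of_nat_0)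
  have p: "pair_counts x z = square5 (map t [-2, -1, 0, 1, 2]) \<or> (pair_counts x z = [] \<and> (\<forall>u. t u = 0))"
    by (auto simp: pair_counts_def t_def ws_def tally_def Let_def split: list.split)
  have "int (card {(y, w) \<in> set (mid_layers x z) \<times> set (mid_layers x z). layer_weight y + layer_weight w = n}) =
      (\<Sum>u\<in>{-2, -1, 0, 1, 2}. t u * t (n - u))"
    by (subst card_pairs[where U = "{-2, -1, 0, 1, 2}"]) (use layer_weight_range in \<open>simp_all add: t\<close>)
  also have "\<dots> = centered_coef (pair_counts x z) n"
  proof -
    consider "n < -4" | "n > 4" | "n \<in> {-4, -3, -2, -1, 0, 1, 2, 3, 4}" by fastforce
    then show ?thesis
    proof cases
      case 1
      then show ?thesis by (simp add: t0 centered_coef_def)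
    next
      case 2
      then have "nat (n + 4) = 9 + nat (n - 5)" by arith
      then show ?thesis using 2 p by (auto simp: t0 centered_coef_def numeral_eq_Suc)
    next
      case 3
      then show ?thesis using p by (auto simp: t0 centered_coef_def numeral_eq_Suc algebra_simps)
    qed
  qed
  finally show ?thesis by simp
qed

section \<open>Height functions as closed walks of four layers\<close>

definition signed_turning :: "cube_heights \<Rightarrow> int" where
  "signed_turning H = (\<Sum>a\<in>UNIV. \<Sum>b\<in>UNIV. \<Sum>c\<in>UNIV. sg b *
     tau (H a b c True True) (H a b c False True) (H a b c False False) (H a b c True False))"

lemma signed_turning_bound: "\<bar>signed_turning H\<bar> \<le> 8"
proof -
  have "-1 \<le> sg b * tau p q r s \<and> sg b * tau p q r s \<le> 1" for b p q r s
    by (auto simp: sg_def tau_def neq_def)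
  then have "(\<Sum>a\<in>(UNIV :: bool set). \<Sum>b\<in>(UNIV :: bool set). \<Sum>c\<in>(UNIV :: bool set). - 1) \<le> signed_turning H"
    "signed_turning H \<le> (\<Sum>a\<in>(UNIV :: bool set). \<Sum>b\<in>(UNIV :: bool set). \<Sum>c\<in>(UNIV :: bool set). 1)"
    unfolding signed_turning_def by (intro sum_mono; blast)+
  then show ?thesis by simp
qed

fun fiber_val :: "fiber \<Rightarrow> bool \<Rightarrow> bool \<Rightarrow> int" where
  "fiber_val ((p, q), r, s) d e = (if d then if e then p else s else if e then q else r)"

text \<open>Consecutive layers in the cycle \<open>x\<close>, \<open>y\<close>, \<open>z\<close>,
  \<open>w\<close> differ in just one of \<open>a\<close> and \<open>c\<close>. Within a layer
  \<open>b\<close> selects the fiber, which makes the sign \<open>sg b\<close> a difference in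
  \<open>layer_weight\<close>.\<close>

fun cube_of_layers :: "layer \<times> layer \<times> layer \<times> layer \<Rightarrow> cube_heights" where
  "cube_of_layers (x, y, z, w) a b c d e =
     fiber_val ((if b then fst else snd) (if a then if c then x else w else if c then y else z)) d e"

definition layer_of_cube :: "cube_heights \<Rightarrow> bool \<Rightarrow> bool \<Rightarrow> layer" where
  "layer_of_cube H a c =
     (((H a True c True True, H a True c False True), H a True c False False, H a True c True False),
      ((H a False c True True, H a False c False True), H a False c False False, H a False c True False))"

lemma bij_cube_of_layers: "bij cube_of_layers"
proof (rule o_bij)
  let ?g = "\<lambda>H. (layer_of_cube H True True, layer_of_cube H False True, layer_of_cube H False False, layer_of_cube H True False)"
  show "?g \<circ> cube_of_layers = id"
    by (auto simp: fun_eq_iff layer_of_cube_def)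
  show "cube_of_layers \<circ> ?g = id"
    by (intro ext) (simp add: layer_of_cube_def)
qed

lemma near_iff: "\<bar>x - y\<bar> = 1 \<longleftrightarrow> near x y"
  by (auto simp: near_def)

lemma all_bool: "(\<forall>b. P b) \<longleftrightarrow> P True \<and> P False"
  by (metis (full_types))

lemma near_layer_of_cube:
  "near_layer (layer_of_cube H a c) (layer_of_cube H a' c') \<longleftrightarrow>
     (\<forall>b d e. near (H a b c d e) (H a' b c' d e))"
  unfolding all_bool by (auto simp: layer_of_cube_def)

lemma layer_ok_layer_of_cube:
  "layer_ok (layer_of_cube H a c) \<longleftrightarrow>
     (\<forall>b d e. near (H a b c d e) (H a (\<not> b) c d e) \<and> near (H a b c d e) (H a b c (\<not> d) e) \<and>
       near (H a b c d e) (H a b c d (\<not> e)))"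
  unfolding all_bool by (auto simp: layer_of_cube_def near_commute)

lemma unit_steps_layers:
  "unit_steps H \<longleftrightarrow> (\<forall>a c. layer_ok (layer_of_cube H a c) \<and>
     near_layer (layer_of_cube H a c) (layer_of_cube H (\<not> a) c) \<and>
     near_layer (layer_of_cube H a c) (layer_of_cube H a (\<not> c)))"
  unfolding unit_steps_def near_iff near_layer_of_cube layer_ok_layer_of_cube by blast

lemma near_layer_commute: "near_layer x y = near_layer y x"
proof -
  have "near_fiber f g = near_fiber g f" for f g
    by (cases "(f, g)" rule: near_fiber.cases) (simp add: near_commute)
  then show ?thesis by (cases x; cases y) simp
qed

lemma layer_of_cube_of_layers:
  "layer_of_cube (cube_of_layers (x, y, z, w)) a c = (if a then if c then x else w else if c then y else z)"
proof -
  obtain f f' g g' h h' i i' where l: "x = (f, f')" "y = (g, g')" "z = (h, h')" "w = (i, i')" by (metis surj_pair)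
  have "((fiber_val f True True, fiber_val f False True), fiber_val f False False, fiber_val f True False) = f" for f
    by (cases f rule: fiber_weight.cases) (simp only: fiber_val.simps if_True if_False)
  then show ?thesis
    by (cases a; cases c) (simp_all only: l layer_of_cube_def cube_of_layers.simps if_True if_False fst_conv snd_conv)
qed

lemma unit_steps_cube_of_layers:
  "unit_steps (cube_of_layers (x, y, z, w)) \<longleftrightarrow>
     layer_ok x \<and> layer_ok y \<and> layer_ok z \<and> layer_ok w \<and>
     near_layer x y \<and> near_layer y z \<and> near_layer x w \<and> near_layer w z"
  unfolding unit_steps_layers layer_of_cube_of_layers all_bool
  by (auto simp: near_layer_commute)

lemma signed_turning_layers:
  "signed_turning H = (\<Sum>a\<in>UNIV. \<Sum>c\<in>UNIV. layer_weight (layer_of_cube H a c))"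
proof -
  have "tau p q r s = fiber_weight ((p, q), r, s)" for p q r s
    by (simp add: tau_def neq_def)
  then show ?thesis
    by (simp add: signed_turning_def sum_bool sg_def layer_of_cube_def del: fiber_weight.simps)
qed

lemma signed_turning_cube_of_layers:
  "signed_turning (cube_of_layers (x, y, z, w)) = layer_weight x + layer_weight y + layer_weight z + layer_weight w"
  unfolding signed_turning_layers layer_of_cube_of_layers by (simp add: sum_bool)

definition normalized_count :: "int \<Rightarrow> nat" where
  "normalized_count m = card {H. unit_steps H \<and> H True True True True True = 0 \<and> signed_turning H = m}"

text \<open>Splitting by the weights \<open>v\<close> of the first layer and \<open>u\<close> of the
  opposite one leaves the joint weight \<open>m - v - u\<close> for the two middle layers, which is
  read off the table.\<close>

lemma card_layer_cycles:
  "int (card {H. unit_steps H \<and> H True True True True True = 0 \<and> H True True True False True = 1 \<and> signed_turning H = m}) =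
    (\<Sum>v\<in>{-2, -1, 0, 1, 2}. \<Sum>u\<in>{-2, -1, 0, 1, 2}.
       centered_coef (cycle_table (start_layers v) (opposite_layers u)) (m - v - u))"
proof -
  let ?W = "{-2, -1, 0, 1, 2} :: int set"
  define X where "X = {x. layer_ok x \<and> fst (fst x) = (0, 1)}"
  define Z where "Z = {z. layer_ok z \<and> fst (fst (fst z)) \<in> {-2, 0, 2}}"
  define M where "M x z = set (mid_layers x z)" for x z
  define P where "P x z = {(y, w) \<in> M x z \<times> M x z. layer_weight y + layer_weight w = m - layer_weight x - layer_weight z}" for x z
  have "x \<in> X \<longleftrightarrow> x \<in> (\<Union>v\<in>?W. set (start_layers v))" for x
    unfolding X_def UN_iff set_start_layers mem_Collect_eq using layer_weight_range[of x] by blast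
  then have X: "X = (\<Union>v\<in>?W. set (start_layers v))" by blast
  have "z \<in> Z \<longleftrightarrow> z \<in> (\<Union>u\<in>?W. set (opposite_layers u))" for z
    unfolding Z_def UN_iff set_opposite_layers mem_Collect_eq using layer_weight_range[of z] by blast
  then have Z: "Z = (\<Union>u\<in>?W. set (opposite_layers u))" by blast
  have fin: "finite X" "finite Z" "finite (P x z)" for x z
  proof -
    show "finite X" "finite Z" unfolding X Z by simp_all
    have "P x z \<subseteq> M x z \<times> M x z" by (auto simp: P_def)
    then show "finite (P x z)" by (rule finite_subset) (simp add: M_def)
  qed
  have base: "fst (fst (fst z)) \<in> {-2, 0, 2}" if "near_layer x y" "near_layer y z" "fst (fst x) = (0, 1)" for x y z
  proof -
    obtain f f' g g' h h' where e: "x = (f, f')" "y = (g, g')" "z = (h, h')" by (metis surj_pair)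
    have "near 0 (fst (fst g))" "near (fst (fst g)) (fst (fst h))"
      using that near_fiber_base[of f g] near_fiber_base[of g h] by (auto simp: e)
    then show ?thesis by (auto simp: e near_def)
  qed
  have "{H. unit_steps H \<and> H True True True True True = 0 \<and> H True True True False True = 1 \<and> signed_turning H = m} =
      cube_of_layers ` {(x, y, z, w). (x, z) \<in> X \<times> Z \<and> (y, w) \<in> P x z}" (is "?L = _ ` ?Q")
  proof -
    have "H \<in> ?L \<longleftrightarrow> q \<in> ?Q" if "H = cube_of_layers q" for H q
    proof -
      obtain x y z w where q: "q = (x, y, z, w)" by (metis surj_pair)
      have "H True True True True True = fst (fst (fst x))" "H True True True False True = snd (fst (fst x))"
        unfolding that q by (cases x; cases "fst x" rule: fiber_weight.cases; simp)+
      then show ?thesis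
        using base[of x y z] unfolding that q
        by (auto simp: unit_steps_cube_of_layers signed_turning_cube_of_layers X_def Z_def P_def M_def set_mid_layers prod_eq_iff)
    qed
    note * = this
    have inj: "inj cube_of_layers" and surj: "surj cube_of_layers"
      using bij_cube_of_layers by (simp_all add: bij_def)
    show ?thesis
    proof (rule Set.set_eqI)
      fix H
      obtain q where q: "H = cube_of_layers q" using surj by blast
      show "H \<in> ?L \<longleftrightarrow> H \<in> cube_of_layers ` ?Q"
        unfolding *[OF q] unfolding q inj_image_mem_iff[OF inj] ..
    qed
  qed
  then have "card ?L = card ?Q"
    using bij_cube_of_layers by (simp only:) (rule card_image, blast intro: inj_on_subset dest: bij_is_inj)
  also have "\<dots> = card (SIGMA (x, z) : X \<times> Z. P x z)"
    by (rule bij_betw_same_card[of "\<lambda>(x, y, z, w). ((x, z), (y, w))"])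
      (rule bij_betwI[of _ _ _ "\<lambda>((x, z), (y, w)). (x, y, z, w)"], auto)
  also have "\<dots> = (\<Sum>(x, z)\<in>X \<times> Z. card (P x z))"
    using fin by (subst card_SigmaI) (auto simp: case_prod_unfold)
  also have "int \<dots> = (\<Sum>x\<in>X. \<Sum>z\<in>Z. int (card (P x z)))"
    by (simp add: sum.cartesian_product case_prod_unfold)
  also have "\<dots> = (\<Sum>v\<in>?W. \<Sum>u\<in>?W. \<Sum>x\<in>set (start_layers v). \<Sum>z\<in>set (opposite_layers u). int (card (P x z)))"
  proof -
    have "(\<Sum>x\<in>X. f x) = (\<Sum>v\<in>?W. \<Sum>x\<in>set (start_layers v). f x)"
      "(\<Sum>z\<in>Z. f z) = (\<Sum>u\<in>?W. \<Sum>z\<in>set (opposite_layers u). f z)" for f :: "layer \<Rightarrow> int"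
      unfolding X Z by (subst sum.UNION_disjoint; force simp: set_start_layers set_opposite_layers)+
    then show ?thesis by (simp only:) (simp only: sum.swap[of _ ?W "set (start_layers _)"])
  qed
  also have "\<dots> = (\<Sum>v\<in>?W. \<Sum>u\<in>?W. \<Sum>x\<leftarrow>start_layers v. \<Sum>z\<leftarrow>opposite_layers u.
      centered_coef (pair_counts x z) (m - v - u))"
  proof (intro sum.cong refl)
    fix v u
    have "int (card (P x z)) = centered_coef (pair_counts x z) (m - v - u)"
      if "x \<in> set (start_layers v)" "z \<in> set (opposite_layers u)" for x z
      using that unfolding centered_coef_pair_counts P_def M_def set_start_layers set_opposite_layers by simp
    then show "(\<Sum>x\<in>set (start_layers v). \<Sum>z\<in>set (opposite_layers u). int (card (P x z))) =
        (\<Sum>x\<leftarrow>start_layers v. \<Sum>z\<leftarrow>opposite_layers u. centered_coef (pair_counts x z) (m - v - u))"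
      by (simp add: sum_list_distinct_conv_sum_set distinct_start_layers distinct_opposite_layers)
  qed
  finally show ?thesis unfolding centered_coef_cycle_table .
qed

text \<open>Weights only compare heights for equality, so negating all heights preserves
  \<open>signed_turning\<close> while exchanging 1 and -1 at the chosen neighbour.\<close>

lemma normalized_count_half:
  "normalized_count m =
    2 * card {H. unit_steps H \<and> H True True True True True = 0 \<and> H True True True False True = 1 \<and> signed_turning H = m}"
proof -
  define S where "S t = {H. unit_steps H \<and> H True True True True True = 0 \<and> H True True True False True = t \<and> signed_turning H = m}" for t
  define neg :: "cube_heights \<Rightarrow> cube_heights" where "neg H a b c d e = - H a b c d e" for H a b c d e
  have neg: "neg H \<in> S (- t)" if "H \<in> S t" for H t
  proof -
    have "unit_steps (neg H)" using that by (auto simp: S_def unit_steps_def neg_def abs_minus_commute)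
    moreover have "neq (- x) (- y) = neq x y" for x y by (simp add: neq_def)
    then have "signed_turning (neg H) = signed_turning H" by (simp add: signed_turning_def neg_def tau_def)
    ultimately show ?thesis using that by (simp add: S_def neg_def)
  qed
  have nn: "neg (neg H) = H" for H by (simp add: neg_def fun_eq_iff)
  have "bij_betw neg (S 1) (S (-1))"
    using neg[of _ 1] neg[of _ "-1"] nn by (intro bij_betwI[of _ _ _ neg]) auto
  then have c: "card (S (-1)) = card (S 1)" by (simp add: bij_betw_same_card)
  have split: "{H. unit_steps H \<and> H True True True True True = 0 \<and> signed_turning H = m} = S 1 \<union> S (-1)"
  proof -
    have "H True True True False True = 1 \<or> H True True True False True = -1"
      if "unit_steps H" "H True True True True True = 0" for H :: cube_heights
    proof -
      have "\<bar>H True True True True True - H True True True (\<not> True) True\<bar> = 1"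
        using that(1) unfolding unit_steps_def by blast
      then show ?thesis using that(2) by auto
    qed
    then show ?thesis by (auto simp: S_def)
  qed
  \<comment> \<open>Finiteness has not been established here; in the infinite case both
    cardinalities are 0.\<close>
  show ?thesis
  proof (cases "finite (S 1)")
    case True
    then have "finite (S (-1))" using \<open>bij_betw neg (S 1) (S (-1))\<close> bij_betw_finite by blast
    then show ?thesis
      using True c unfolding normalized_count_def split S_def[symmetric]
      by (subst card_Un_disjoint) (auto simp: S_def)
  next
    case False
    then have "\<not> finite (S 1 \<union> S (-1))" by simp
    then show ?thesis using False unfolding normalized_count_def split S_def[symmetric] by simp
  qed
qed

text \<open>One row for each weight of the opposite layer. As a check on the five evaluations,
  reversing the rows and all their entries exchanges the tables of opposite start weights.\<close>

lemma cycle_table_minus_two: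
  "map (\<lambda>u. cycle_table (start_layers (-2)) (opposite_layers u)) [-2, -1, 0, 1, 2] =
     [[12, 32, 112, 288, 592, 896, 896, 512, 128],
      [16, 64, 200, 544, 1168, 1792, 1792, 1024, 256],
      [32, 112, 328, 688, 1220, 1600, 1440, 768, 192],
      [32, 128, 288, 480, 624, 624, 496, 256, 64],
      [16, 64, 128, 192, 232, 192, 128, 64, 16]]"
  by code_simp

lemma cycle_table_minus_one:
  "map (\<lambda>u. cycle_table (start_layers (-1)) (opposite_layers u)) [-2, -1, 0, 1, 2] =
     [[16, 64, 200, 544, 1168, 1792, 1792, 1024, 256],
      [48, 176, 508, 1240, 2528, 3744, 3648, 2048, 512],
      [112, 416, 1020, 1872, 2904, 3472, 2976, 1536, 384],
      [128, 512, 1056, 1472, 1648, 1472, 1056, 512, 128],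
      [64, 256, 496, 624, 624, 480, 288, 128, 32]]"
  by code_simp

lemma cycle_table_zero:
  "map (\<lambda>u. cycle_table (start_layers 0) (opposite_layers u)) [-2, -1, 0, 1, 2] =
     [[32, 112, 328, 688, 1220, 1600, 1440, 768, 192],
      [112, 416, 1020, 1872, 2904, 3472, 2976, 1536, 384],
      [304, 1184, 2600, 3728, 4363, 3728, 2600, 1184, 304],
      [384, 1536, 2976, 3472, 2904, 1872, 1020, 416, 112],
      [192, 768, 1440, 1600, 1220, 688, 328, 112, 32]]"
  by code_simp

lemma cycle_table_one:
  "map (\<lambda>u. cycle_table (start_layers 1) (opposite_layers u)) [-2, -1, 0, 1, 2] =
     [[32, 128, 288, 480, 624, 624, 496, 256, 64],
      [128, 512, 1056, 1472, 1648, 1472, 1056, 512, 128],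
      [384, 1536, 2976, 3472, 2904, 1872, 1020, 416, 112],
      [512, 2048, 3648, 3744, 2528, 1240, 508, 176, 48],
      [256, 1024, 1792, 1792, 1168, 544, 200, 64, 16]]"
  by code_simp

lemma cycle_table_two:
  "map (\<lambda>u. cycle_table (start_layers 2) (opposite_layers u)) [-2, -1, 0, 1, 2] =
     [[16, 64, 128, 192, 232, 192, 128, 64, 16],
      [64, 256, 496, 624, 624, 480, 288, 128, 32],
      [192, 768, 1440, 1600, 1220, 688, 328, 112, 32],
      [256, 1024, 1792, 1792, 1168, 544, 200, 64, 16],
      [128, 512, 896, 896, 592, 288, 112, 32, 12]]"
  by code_simp

lemma normalized_count_table:
  "int (normalized_count m) = 2 * (\<Sum>v\<in>{-2, -1, 0, 1, 2}. \<Sum>u\<in>{-2, -1, 0, 1, 2}.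
     centered_coef (cycle_table (start_layers v) (opposite_layers u)) (m - v - u))"
  unfolding normalized_count_half of_nat_mult card_layer_cycles by simp

lemma normalized_counts:
  "normalized_count 0 = 83830"
  "normalized_count 1 = 72384" "normalized_count (-1) = 72384"
  "normalized_count 2 = 47200" "normalized_count (-2) = 47200"
  "normalized_count 3 = 23392" "normalized_count (-3) = 23392"
  "normalized_count 4 = 9048" "normalized_count (-4) = 9048"
  "normalized_count 5 = 2752" "normalized_count (-5) = 2752"
  "normalized_count 6 = 704" "normalized_count (-6) = 704"
  "normalized_count 7 = 128" "normalized_count (-7) = 128"
  "normalized_count 8 = 24" "normalized_count (-8) = 24"
proof -
  note tables = cycle_table_minus_two cycle_table_minus_one cycle_table_zero cycle_table_one cycle_table_two
  note t = tables[unfolded list.map list.inject]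
  have "int (normalized_count 0) = 83830"
    "int (normalized_count 1) = 72384" "int (normalized_count (-1)) = 72384"
    "int (normalized_count 2) = 47200" "int (normalized_count (-2)) = 47200"
    "int (normalized_count 3) = 23392" "int (normalized_count (-3)) = 23392"
    "int (normalized_count 4) = 9048" "int (normalized_count (-4)) = 9048"
    "int (normalized_count 5) = 2752" "int (normalized_count (-5)) = 2752"
    "int (normalized_count 6) = 704" "int (normalized_count (-6)) = 704"
    "int (normalized_count 7) = 128" "int (normalized_count (-7)) = 128"
    "int (normalized_count 8) = 24" "int (normalized_count (-8)) = 24"
    unfolding normalized_count_table by (simp_all add: t centered_coef_def numeral_eq_Suc)
  then show "normalized_count 0 = 83830"
    "normalized_count 1 = 72384" "normalized_count (-1) = 72384"
    "normalized_count 2 = 47200" "normalized_count (-2) = 47200"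
    "normalized_count 3 = 23392" "normalized_count (-3) = 23392"
    "normalized_count 4 = 9048" "normalized_count (-4) = 9048"
    "normalized_count 5 = 2752" "normalized_count (-5) = 2752"
    "normalized_count 6 = 704" "normalized_count (-6) = 704"
    "normalized_count 7 = 128" "normalized_count (-7) = 128"
    "normalized_count 8 = 24" "normalized_count (-8) = 24"
    by linarith+
qed

section \<open>Height functions on the hypercube\<close>

definition cube_vertex_of :: "5 \<Rightarrow> bool \<Rightarrow> bool \<Rightarrow> bool \<Rightarrow> bool \<Rightarrow> bool \<Rightarrow> cube_vertex" where
  "cube_vertex_of k a b c d e =
     (\<chi> i. if i = k then a else if i = k + 1 then b else if i = k + 2 then c else if i = k + 3 then d else e)"

definition heights_in :: "5 \<Rightarrow> (cube_vertex \<Rightarrow> int) \<Rightarrow> cube_heights" where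
  "heights_in k h a b c d e = h (cube_vertex_of k a b c d e)"

context
  fixes k :: 5
begin

lemma rainbow_wrap: "k + 4 + 1 = k" "k + 1 + 1 = k + 2" "k + 2 + 1 = k + 3" "k + 3 + 1 = k + 4"
  by (simp_all add: add.assoc)

lemma rainbow_UNIV: "UNIV = {k, k + 1, k + 2, k + 3, k + 4}"
  using rainbow_cases[of _ k] by auto

lemma sum_rainbow: "sum f UNIV = f k + f (k + 1) + f (k + 2) + f (k + 3) + f (k + 4)"
  for f :: "5 \<Rightarrow> int"
  by (subst rainbow_UNIV) (simp add: add.assoc)

lemma prod_rainbow: "prod f UNIV = f k * f (k + 1) * f (k + 2) * f (k + 3) * f (k + 4)"
  for f :: "5 \<Rightarrow> int"
  by (subst rainbow_UNIV) (simp add: mult.assoc)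

lemma cube_vertex_of_nth:
  "cube_vertex_of k a b c d e $ k = a" "cube_vertex_of k a b c d e $ (k + 1) = b"
  "cube_vertex_of k a b c d e $ (k + 2) = c" "cube_vertex_of k a b c d e $ (k + 3) = d"
  "cube_vertex_of k a b c d e $ (k + 4) = e"
  by (simp_all add: cube_vertex_of_def)

lemma cube_vertex_eqI:
  assumes "v $ k = w $ k" "v $ (k + 1) = w $ (k + 1)" "v $ (k + 2) = w $ (k + 2)"
    "v $ (k + 3) = w $ (k + 3)" "v $ (k + 4) = w $ (k + 4)"
  shows "v = (w :: cube_vertex)"
proof -
  have "v $ i = w $ i" for i using rainbow_cases[of i k] assms by auto
  then show ?thesis by (simp add: vec_eq_iff)
qed

lemma nbr_cube_vertex_of:
  "nbr k (cube_vertex_of k a b c d e) = cube_vertex_of k (\<not> a) b c d e"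
  "nbr (k + 1) (cube_vertex_of k a b c d e) = cube_vertex_of k a (\<not> b) c d e"
  "nbr (k + 2) (cube_vertex_of k a b c d e) = cube_vertex_of k a b (\<not> c) d e"
  "nbr (k + 3) (cube_vertex_of k a b c d e) = cube_vertex_of k a b c (\<not> d) e"
  "nbr (k + 4) (cube_vertex_of k a b c d e) = cube_vertex_of k a b c d (\<not> e)"
  by (rule cube_vertex_eqI; simp add: cube_vertex_of_nth; simp add: nbr_def cube_vertex_of_nth)+

lemma cube_vertex_of_surj:
  "cube_vertex_of k (v $ k) (v $ (k + 1)) (v $ (k + 2)) (v $ (k + 3)) (v $ (k + 4)) = v"
  by (rule cube_vertex_eqI) (simp_all add: cube_vertex_of_nth)

lemma all_cube_vertex_of: "(\<forall>v. P v) \<longleftrightarrow> (\<forall>a b c d e. P (cube_vertex_of k a b c d e))"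
  by (metis cube_vertex_of_surj)

lemma all_ones_cube_vertex_of: "all_ones = cube_vertex_of k True True True True True"
  by (rule cube_vertex_eqI) (simp_all add: cube_vertex_of_nth all_ones_def)

lemma bij_cube_vertex_of: "bij (\<lambda>(a, b, c, d, e). cube_vertex_of k a b c d e)"
  by (rule o_bij[of "\<lambda>v. (v $ k, v $ (k + 1), v $ (k + 2), v $ (k + 3), v $ (k + 4))"])
    (auto simp: fun_eq_iff cube_vertex_of_nth cube_vertex_of_surj)

lemma sum_cube_vertex_of:
  "(\<Sum>v\<in>UNIV. f v) = (\<Sum>a\<in>UNIV. \<Sum>b\<in>UNIV. \<Sum>c\<in>UNIV. \<Sum>d\<in>UNIV. \<Sum>e\<in>UNIV. f (cube_vertex_of k a b c d e))"
  by (subst sum.reindex_bij_betw[OF bij_cube_vertex_of, symmetric])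
    (simp add: sum.cartesian_product case_prod_unfold flip: UNIV_Times_UNIV)

lemma bij_heights_in: "bij (heights_in k)"
proof (rule o_bij[of "\<lambda>H v. H (v $ k) (v $ (k + 1)) (v $ (k + 2)) (v $ (k + 3)) (v $ (k + 4))"])
  show "(\<lambda>H v. H (v $ k) (v $ (k + 1)) (v $ (k + 2)) (v $ (k + 3)) (v $ (k + 4))) \<circ> heights_in k = id"
    by (auto simp: fun_eq_iff heights_in_def cube_vertex_of_surj)
  show "heights_in k \<circ> (\<lambda>H v. H (v $ k) (v $ (k + 1)) (v $ (k + 2)) (v $ (k + 3)) (v $ (k + 4))) = id"
    by (intro ext) (simp add: heights_in_def cube_vertex_of_nth)
qed

lemma unit_steps_heights_in: "unit_steps (heights_in k h) \<longleftrightarrow> height_function h"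
proof -
  have "height_function h \<longleftrightarrow> (\<forall>v j. \<bar>h v - h (nbr j v)\<bar> = 1)"
  proof -
    have "\<bar>h u - h v\<bar> = 1" if n: "\<And>v j. \<bar>h v - h (nbr j v)\<bar> = 1" and "adjacent u v" for u v
    proof -
      obtain j where j: "u $ j \<noteq> v $ j" "\<And>i. u $ i \<noteq> v $ i \<Longrightarrow> i = j"
        using \<open>adjacent u v\<close> unfolding adjacent_def Ex1_def by (elim exE conjE) metis
      have "v $ i = nbr j u $ i" for i
      proof -
        have n: "nbr j u $ i = (if i = j then \<not> u $ i else u $ i)" by (simp add: nbr_def)
        show ?thesis
        proof (cases "i = j")
          case True
          have "v $ i = (\<not> u $ i)" using j(1) unfolding True by blast
          then show ?thesis unfolding n if_P[OF True] .
        next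
          case False
          then show ?thesis unfolding n if_not_P[OF False] using j(2)[of i] by blast
        qed
      qed
      then have v: "v = nbr j u" by (simp add: vec_eq_iff)
      show ?thesis unfolding v by (rule n)
    qed
    moreover have "\<bar>h v - h (nbr j v)\<bar> = 1" if "height_function h" for v j
      using that adjacent_nbr[of v j] unfolding height_function_def by simp
    ultimately show ?thesis unfolding height_function_def[of h] by (intro iffI allI impI) (simp_all add: height_function_def)
  qed
  also have "\<dots> \<longleftrightarrow> (\<forall>v. \<forall>j\<in>{k, k + 1, k + 2, k + 3, k + 4}. \<bar>h v - h (nbr j v)\<bar> = 1)"
    unfolding rainbow_UNIV[symmetric] by simp
  also have "\<dots> \<longleftrightarrow> unit_steps (heights_in k h)"
    unfolding all_cube_vertex_of unit_steps_def heights_in_def by (simp add: nbr_cube_vertex_of)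
  finally show ?thesis ..
qed

section \<open>The image of the Morse divisor in rotated coordinates\<close>

lemma morse_divisor_cube_vertex_of:
  assumes "height_function h"
  shows "morse_divisor h (Vertex (cube_vertex_of k a b c d e)) = kappa (heights_in k h) a b c d e"
proof -
  let ?v = "cube_vertex_of k a b c d e"
  have "int (card {j. h (nbr j ?v) \<noteq> h (nbr (j + 1) ?v)}) = (\<Sum>j\<in>UNIV. neq (h (nbr j ?v)) (h (nbr (j + 1) ?v)))"
    by (simp add: neq_def sum.If_cases Collect_neg_eq[symmetric])
  also have "\<dots> = turns (heights_in k h) a b c d e"
    unfolding sum_rainbow rainbow_wrap by (simp add: turns_def heights_in_def nbr_cube_vertex_of)
  finally show ?thesis by (simp add: morse_divisor_Vertex[OF assms] kappa_def)
qed

lemma morse_divisor_bow: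
  assumes "height_function h"
  shows "morse_divisor h (face_center m v) =
    bow (h v) (h (nbr m v)) (h (nbr m (nbr (m + 1) v))) (h (nbr (m + 1) v))"
  by (rule cycle4_cases[OF assms, of m v])
    (auto simp: morse_divisor_face_center[OF assms] bow_tie_iff[OF assms] bow_def neq_def)

lemma sum_face_reps:
  "(\<Sum>(m, v)\<in>face_reps. f m v) = (\<Sum>m\<in>UNIV. \<Sum>v\<in>UNIV. if v $ m \<and> v $ (m + 1) then f m v else 0)"
  for f :: "5 \<Rightarrow> cube_vertex \<Rightarrow> int"
proof -
  have "face_reps = (SIGMA m : UNIV. {v. v $ m \<and> v $ (m + 1)})" by (auto simp: face_reps_def)
  then have "(\<Sum>(m, v)\<in>face_reps. f m v) = (\<Sum>m\<in>UNIV. \<Sum>v\<in>{v. v $ m \<and> v $ (m + 1)}. f m v)"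
    by (simp add: sum.Sigma)
  also have "\<dots> = (\<Sum>m\<in>UNIV. \<Sum>v\<in>UNIV. if v $ m \<and> v $ (m + 1) then f m v else 0)"
    by (simp flip: sum.inter_filter)
  finally show ?thesis .
qed

text \<open>\<open>color_sign k\<close> is negative exactly at \<open>k + 1\<close>,
  \<open>k + 3\<close>, \<open>k + 4\<close>, which are the coordinates \<open>b\<close>,
  \<open>d\<close>, \<open>e\<close>; its negation is negative at \<open>a\<close> and
  \<open>c\<close>.\<close>

lemma flips_cube_vertex_of:
  "(\<Prod>j\<in>flips (cube_vertex_of k a b c d e). color_sign k j) = sg b * sg d * sg e"
  "(\<Prod>j\<in>flips (cube_vertex_of k a b c d e). - color_sign k j) = sg a * sg c"
  "int (card (flips (cube_vertex_of k a b c d e))) = falses a b c d e"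
proof -
  let ?v = "cube_vertex_of k a b c d e"
  have p: "(\<Prod>j\<in>flips ?v. f j) = (\<Prod>j\<in>UNIV. if \<not> ?v $ j then f j else 1)" for f :: "5 \<Rightarrow> int"
    by (simp add: prod.If_cases flips_def)
  show "(\<Prod>j\<in>flips ?v. color_sign k j) = sg b * sg d * sg e"
    "(\<Prod>j\<in>flips ?v. - color_sign k j) = sg a * sg c"
    unfolding p prod_rainbow cube_vertex_of_nth by (auto simp: color_sign_def sg_def)
  have "int (card (flips ?v)) = (\<Sum>j\<in>UNIV. of_bool (\<not> ?v $ j))"
    by (simp add: of_bool_def sum.If_cases flips_def)
  then show "int (card (flips ?v)) = falses a b c d e"
    unfolding sum_rainbow cube_vertex_of_nth falses_def .
qed

text \<open>The cancellation in \<open>sum_signed_kappa\<close> gives the first coefficient;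
  \<open>torsion_balance\<close> and \<open>bow_counts_even\<close> give the torsion ones, up to the
  orders of the generators.\<close>

lemma nu_divisor_morse:
  assumes "height_function h"
  shows "nu_divisor k (morse_divisor h) =
    gen k (signed_turning (heights_in k h)) (- signed_turning (heights_in k h)) 0"
proof -
  let ?H = "heights_in k h"
  have H: "unit_steps ?H" using assms by (simp add: unit_steps_heights_in)
  define A where "A = (\<Sum>a\<in>UNIV. \<Sum>b\<in>UNIV. \<Sum>c\<in>UNIV. \<Sum>d\<in>UNIV. \<Sum>e\<in>UNIV. kappa ?H a b c d e * (sg b * sg d * sg e))"
  define B where "B = (\<Sum>a\<in>UNIV. \<Sum>b\<in>UNIV. \<Sum>c\<in>UNIV. \<Sum>d\<in>UNIV. \<Sum>e\<in>UNIV. kappa ?H a b c d e * (2 * falses a b c d e))"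
  let ?K = "bow_count (cycle_colors (cycle_colors ?H))"
    and ?K1 = "bow_count (cycle_colors (cycle_colors (cycle_colors ?H)))"
    and ?K4 = "bow_count (cycle_colors ?H)"
  have faces: "(\<Sum>v\<in>UNIV. if v $ k \<and> v $ (k + 1) then morse_divisor h (face_center k v) else 0) = ?K"
    "(\<Sum>v\<in>UNIV. if v $ (k + 1) \<and> v $ (k + 2) then morse_divisor h (face_center (k + 1) v) else 0) = ?K1"
    "(\<Sum>v\<in>UNIV. if v $ (k + 4) \<and> v $ k then morse_divisor h (face_center (k + 4) v) else 0) = ?K4"
    "(\<Sum>v\<in>UNIV. if v $ (k + 3) \<and> v $ (k + 4) then morse_divisor h (face_center (k + 3) v) *
        (\<Prod>j\<in>flips v. - color_sign k j) else 0) = signed_bow_count ?H"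
    unfolding sum_cube_vertex_of morse_divisor_bow[OF assms] rainbow_wrap nbr_cube_vertex_of cube_vertex_of_nth
      flips_cube_vertex_of bow_count_def signed_bow_count_def cycle_colors_def heights_in_def
    by (simp_all add: sum_bool mult.commute)
  have "(\<Sum>v\<in>UNIV. morse_divisor h (Vertex v) * (\<Prod>j\<in>flips v. color_sign k j)) = A"
    "(\<Sum>v\<in>UNIV. morse_divisor h (Vertex v) * (2 * int (card (flips v)))) = B"
    unfolding sum_cube_vertex_of morse_divisor_cube_vertex_of[OF assms] flips_cube_vertex_of A_def B_def by simp_all
  moreover have w: "face_two k k = 1" "face_two k (k + 1) = 1" "face_two k (k + 2) = 0" "face_two k (k + 3) = 0"
    "face_two k (k + 4) = 0" "face_four k k v = 0" "face_four k (k + 1) v = 2" "face_four k (k + 2) v = 0"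
    "face_four k (k + 3) v = (\<Prod>j\<in>flips v. - color_sign k j)" "face_four k (k + 4) v = 2" for v
    by (simp_all add: face_two_def face_four_def)
  have "(\<Sum>(m, v)\<in>face_reps. morse_divisor h (face_center m v) * face_two k m) = ?K + ?K1"
    unfolding sum_face_reps sum_rainbow rainbow_wrap faces(1,2)[symmetric]
    by (simp add: w cong: if_cong)
  moreover have "(\<Sum>(m, v)\<in>face_reps. morse_divisor h (face_center m v) * face_four k m v) =
      signed_bow_count ?H + 2 * ?K4 + 2 * ?K1"
    unfolding sum_face_reps sum_rainbow rainbow_wrap faces[symmetric] sum_distrib_left
    by (simp add: w if_distrib mult.commute cong: if_cong)
  ultimately have "nu_divisor k (morse_divisor h) = gen k A (B + (signed_bow_count ?H + 2 * ?K4 + 2 * ?K1)) (?K + ?K1)"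
    using nu_divisor_gen[OF morse_divisor_support[of h], where k = k] by simp
  moreover have "A = signed_turning ?H"
    unfolding A_def signed_turning_def by (rule sum_signed_kappa[OF H])
  moreover have "4 dvd A + B + signed_bow_count ?H + 2 * ?K4 + 2 * ?K1"
    using torsion_balance[OF H] unfolding A_def B_def .
  then have "4 dvd B + (signed_bow_count ?H + 2 * ?K4 + 2 * ?K1) - - A" by (simp add: ac_simps)
  ultimately show ?thesis
    using bow_counts_even[OF H] by (simp add: gen_eq_iff cong_iff_dvd_diff)
qed

end

text \<open>Every class has exactly one member that is 0 at \<open>all_ones\<close>.\<close>

lemma card_quotient_shift_rel:
  assumes "\<And>g h. h \<in> S \<Longrightarrow> (g, h) \<in> shift_rel \<Longrightarrow> g \<in> S"
  shows "card (S // shift_rel) = card {h \<in> S. h all_ones = 0}"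
proof -
  have "bij_betw (\<lambda>h. shift_rel `` {h}) {h \<in> S. h all_ones = 0} (S // shift_rel)"
  proof (rule bij_betwI')
    fix g h assume g: "g \<in> {h \<in> S. h all_ones = 0}" and h: "h \<in> {h \<in> S. h all_ones = 0}"
    have "g = h" if "shift_rel `` {g} = shift_rel `` {h}"
    proof -
      have "(g, h) \<in> shift_rel" using that eq_equiv_class[OF that equiv_shift_rel] by simp
      then obtain c where "\<forall>v. g v = h v + c" by (auto simp: shift_rel_def)
      then show ?thesis using g h by (auto simp: fun_eq_iff)
    qed
    then show "(shift_rel `` {g} = shift_rel `` {h}) = (g = h)" by blast
  next
    fix h assume "h \<in> {h \<in> S. h all_ones = 0}"
    then show "shift_rel `` {h} \<in> S // shift_rel" by (auto intro: quotientI)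
  next
    fix C assume "C \<in> S // shift_rel"
    then obtain h where h: "h \<in> S" "C = shift_rel `` {h}" by (auto elim: quotientE)
    define g where "g v = h v - h all_ones" for v
    have gh: "(g, h) \<in> shift_rel" by (auto simp: shift_rel_def g_def intro!: exI[of _ "- h all_ones"])
    then have "g \<in> S" using assms h(1) by blast
    moreover have "C = shift_rel `` {g}" using equiv_class_eq[OF equiv_shift_rel gh] h(2) by simp
    ultimately show "\<exists>g\<in>{h \<in> S. h all_ones = 0}. C = shift_rel `` {g}" by (auto simp: g_def)
  qed
  then show ?thesis by (rule bij_betw_same_card[symmetric])
qed

lemma card_height_functions_in:
  "card {h \<in> {h. height_function h \<and> P (heights_in k h)}. h all_ones = 0} =
   card {H. unit_steps H \<and> H True True True True True = 0 \<and> P H}"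
proof -
  have "heights_in k ` {h \<in> {h. height_function h \<and> P (heights_in k h)}. h all_ones = 0} =
      {H. unit_steps H \<and> H True True True True True = 0 \<and> P H}" (is "_ ` ?L = ?R")
  proof -
    have "h \<in> ?L \<longleftrightarrow> heights_in k h \<in> ?R" for h
      by (auto simp: unit_steps_heights_in all_ones_cube_vertex_of[of k] heights_in_def[of k h True])
    then have "?L = heights_in k -` ?R" by blast
    then show ?thesis
      using bij_heights_in[of k, THEN bij_is_surj] by (simp only: surj_image_vimage_eq)
  qed
  then show ?thesis
    using card_image[OF inj_on_subset[OF bij_is_inj[OF bij_heights_in[of k]] subset_UNIV]] by metis
qed

lemma generator_difference_pow:
  "(e_inf k \<otimes>\<^bsub>EC k\<^esub> inv\<^bsub>EC k\<^esub> e_four k) [^]\<^bsub>EC k\<^esub> (m :: int) = gen k m (- m) 0"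
proof -
  interpret comm_group "EC k" by (rule comm_group_EC)
  have "inv\<^bsub>EC k\<^esub> e_four k = gen k 0 (-1) 0"
    using gen_mult[of k 0 "-1" 0 0 1 0] generators_carrier gen_closed
    by (intro inv_equality) (simp_all add: gen_generators gen_0)
  then have "e_inf k \<otimes>\<^bsub>EC k\<^esub> inv\<^bsub>EC k\<^esub> e_four k = gen k 1 (-1) 0"
    by (simp add: gen_mult flip: gen_generators(1))
  then show ?thesis by (simp add: gen_pow)
qed

text \<open>Uniqueness of coefficients turns the condition on the image into
  \<open>signed_turning = m\<close>, and the bijection \<open>heights_in k\<close> removes
  \<open>k\<close>.\<close>

lemma height_count_normalized: "height_count k m = normalized_count m"
proof -
  let ?S = "{h. height_function h \<and> signed_turning (heights_in k h) = m}"
  have eq: "{h. height_function h \<and> nu_divisor k (morse_divisor h) =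
      (e_inf k \<otimes>\<^bsub>EC k\<^esub> inv\<^bsub>EC k\<^esub> e_four k) [^]\<^bsub>EC k\<^esub> m} = ?S"
    unfolding generator_difference_pow by (auto simp: nu_divisor_morse gen_eq_iff)
  have "card (?S // shift_rel) = card {h \<in> ?S. h all_ones = 0}"
  proof (rule card_quotient_shift_rel)
    fix g h assume "h \<in> ?S" "(g, h) \<in> shift_rel"
    then show "g \<in> ?S" unfolding eq[symmetric] using shift_invariant by auto
  qed
  then show ?thesis
    unfolding height_count_def eq normalized_count_def
    using card_height_functions_in[of "\<lambda>H. signed_turning H = m" k] by simp
qed

lemma card_height_functions: "card ({h. height_function h} // shift_rel) = 395094"
proof -
  let ?N = "\<lambda>m. {H. unit_steps H \<and> H True True True True True = 0 \<and> signed_turning H = m}"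
  have M: "{-8..8 :: int} = {-8, -7, -6, -5, -4, -3, -2, -1, 0, 1, 2, 3, 4, 5, 6, 7, 8}"
    by (rule Set.set_eqI, unfold atLeastAtMost_iff insert_iff empty_iff) presburger
  have "card ({h. height_function h} // shift_rel) = card {h \<in> {h. height_function h}. h all_ones = 0}"
    using shift_invariant(1) by (intro card_quotient_shift_rel) auto
  also have "\<dots> = card {H. unit_steps H \<and> H True True True True True = 0}"
    using card_height_functions_in[of "\<lambda>_. True" 1] by simp
  also have "{H. unit_steps H \<and> H True True True True True = 0} = (\<Union>m\<in>{-8..8}. ?N m)"
  proof -
    have "signed_turning H \<in> {-8..8}" for H using signed_turning_bound[of H] by (simp add: abs_le_iff)
    then show ?thesis by blast
  qed
  also have "card \<dots> = (\<Sum>m\<in>{-8..8}. card (?N m))"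
  proof (rule card_UN_disjoint)
    \<comment> \<open>Infinite sets have cardinality 0, so the nonzero counts supply the finiteness
      that the union formula requires.\<close>
    have "card (?N m) \<noteq> 0" if "m \<in> {-8..8}" for m
      using that unfolding M normalized_count_def[symmetric]
      by (elim insertE emptyE) (simp_all add: normalized_counts)
    then show "\<forall>m\<in>{-8..8}. finite (?N m)" using card.infinite by blast
  qed auto
  also have "\<dots> = 395094"
    using normalized_counts unfolding normalized_count_def[symmetric] M by simp
  finally show ?thesis .
qed

theorem theorem3p22:
  fixes k :: 5
  shows
    "(\<forall>h. height_function h \<longrightarrow>
        (\<exists>(a::int) (b::int) (c::int). nu_divisor k (morse_divisor h) =
           e_inf k [^]\<^bsub>EC k\<^esub> a \<otimes>\<^bsub>EC k\<^esub> e_four k [^]\<^bsub>EC k\<^esub> b \<otimes>\<^bsub>EC k\<^esub> e_two k [^]\<^bsub>EC k\<^esub> c) \<and>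
        (\<forall>(a::int) (b::int) (c::int). nu_divisor k (morse_divisor h) =
           e_inf k [^]\<^bsub>EC k\<^esub> a \<otimes>\<^bsub>EC k\<^esub> e_four k [^]\<^bsub>EC k\<^esub> b \<otimes>\<^bsub>EC k\<^esub> e_two k [^]\<^bsub>EC k\<^esub> c \<longrightarrow>
           0 \<le> \<bar>a\<bar> \<and> \<bar>a\<bar> \<le> 8 \<and> [b = - a] (mod 4) \<and> [c = 0] (mod 2))) \<and>
     card ({h. height_function h} // shift_rel) = 395094 \<and>
     height_count k 0 = 83830 \<and>
     (\<forall>m\<in>{1, -1}. height_count k m = 72384) \<and>
     (\<forall>m\<in>{2, -2}. height_count k m = 47200) \<and>
     (\<forall>m\<in>{3, -3}. height_count k m = 23392) \<and>
     (\<forall>m\<in>{4, -4}. height_count k m = 9048) \<and>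
     (\<forall>m\<in>{5, -5}. height_count k m = 2752) \<and>
     (\<forall>m\<in>{6, -6}. height_count k m = 704) \<and>
     (\<forall>m\<in>{7, -7}. height_count k m = 128) \<and>
     (\<forall>m\<in>{8, -8}. height_count k m = 24)"
proof (intro conjI allI impI)
  fix h
  assume h: "height_function h"
  have nu: "nu_divisor k (morse_divisor h) = gen k (signed_turning (heights_in k h)) (- signed_turning (heights_in k h)) 0"
    by (rule nu_divisor_morse[OF h])
  show "\<exists>(a::int) (b::int) (c::int). nu_divisor k (morse_divisor h) =
      e_inf k [^]\<^bsub>EC k\<^esub> a \<otimes>\<^bsub>EC k\<^esub> e_four k [^]\<^bsub>EC k\<^esub> b \<otimes>\<^bsub>EC k\<^esub> e_two k [^]\<^bsub>EC k\<^esub> c"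
    unfolding nu gen_def by blast
  fix a b c :: int
  assume "nu_divisor k (morse_divisor h) =
      e_inf k [^]\<^bsub>EC k\<^esub> a \<otimes>\<^bsub>EC k\<^esub> e_four k [^]\<^bsub>EC k\<^esub> b \<otimes>\<^bsub>EC k\<^esub> e_two k [^]\<^bsub>EC k\<^esub> c"
  then have "signed_turning (heights_in k h) = a \<and> [- signed_turning (heights_in k h) = b] (mod 4) \<and> [0 = c] (mod 2)"
    unfolding nu gen_def[symmetric] gen_eq_iff .
  then show "0 \<le> \<bar>a\<bar>" "\<bar>a\<bar> \<le> 8" "[b = - a] (mod 4)" "[c = 0] (mod 2)"
    using signed_turning_bound[of "heights_in k h"] by (auto simp: cong_sym_eq)
qed (auto simp: height_count_normalized normalized_counts card_height_functions)

end
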